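(* Let $Q=(q_n)_{n\ge1}$ be a basic sequence that is infinite in limit, let $P\subseteq\mathbb{Z}[X]$ be a sparsely intersecting set of polynomials, and for each $p\in P$ let $\{\overline{f}_{p,m,r}\}_{m\in\mathbb{N},\,0\le r<m}$ and $\{\underline{f}_{p,m,r}\}_{m\in\mathbb{N},\,0\le r<m}$ be linear families of asymptotic distribution functions. Put $$\Phi_{Q,P,F}=\Big\{x\in[0,1):\ \text{for all } p\in P,\ m\in\mathbb{N},\ 0\le r<m,\ \text{the sequence } \big(T_{Q,p(mn+r)}(x)\big)_{n=0}^\infty \text{ has upper adf } \overline{f}_{p,m,r} \text{ and lower adf } \underline{f}_{p,m,r}\Big\}.$$ Then $\dim_H \Phi_{Q,P,F}=1$. Furthermore, if $Q$ is computable and computably growing, $P$ is an explicit sparsely intersecting set of polynomials, and each of the families $\{\overline{f}_{p,m,r}\}$, $\{\underline{f}_{p,m,r}\}$ is an explicit linear family of adfs, then there exist a subset $\Phi'_{Q,P,F}\subseteq\Phi_{Q,P,F}$ and computable sequences of integers $(\alpha(n))_{n\ge1}$, $(\beta(n))_{n\ge1}$ such that (1) $\dim_H\Phi'_{Q,P,F}=1$, and (2) $\Phi'_{Q,P,F}=\{x\in[0,1):\ \alpha(n)\le E_n(x)\le\beta(n)\ \text{for all } n\ge1\}$.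
   Context: $\mathbb{N}=\{1,2,3,\dots\}$. A basic sequence is a sequence $Q=(q_n)_{n\ge1}$ of integers $q_n\ge2$; it is infinite in limit if $q_n\to\infty$. The $Q$-Cantor series expansion of $x\in\mathbb{R}$ is the unique expansion $x=E_0(x)+\sum_{n\ge1}\frac{E_n(x)}{q_1\cdots q_n}$ with $E_0(x)=\lfloor x\rfloor$, $E_n(x)\in\{0,\dots,q_n-1\}$ and $E_n(x)\ne q_n-1$ for infinitely many $n$. Put $T_{Q,n}(x)=q_nq_{n-1}\cdots q_1x \pmod 1$ (with $T_{Q,0}(x)=x\bmod 1$). For a sequence $\omega=(x_i)$ in $[0,1)$ and interval $I$, $A_n(I,\omega)=\#\{i\le n: x_i\in I\}$ (counting the first $n$ terms). An asymptotic distribution function (adf) is a non-decreasing $f:[0,1]\to[0,1]$ with $f(0)=0$, $f(1)=1$. $\omega$ has upper adf $\overline f$ if $\limsup_{n}A_n([0,x),\omega)/n=\overline f(x)$ for all $x\in[0,1]$, and lower adf $\underline f$ if $\liminf_n A_n([0,x),\omega)/n=\underline f(x)$ for all $x$. A linear family of adfs is a collection $\{f_{m,r}\}_{m\in\mathbb{N},0\le r<m}$ of adfs with $f_{m,r}=\frac1d\sum_{i=0}^{d-1}f_{md,mi+r}$ for all $m\in\mathbb{N}$, $0\le r<m$, $d\in\mathbb{N}$. For $p,q\in\mathbb{Z}[X]$ and integers $s<n$ let $d(p,q,s,n)=\dfrac{\#\big(p(\mathbb{N})\cap q(\mathbb{N})\cap\{s,\dots,n\}\big)}{\#\big(q(\mathbb{N})\cap\{s,\dots,n\}\big)}$.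 Write $q\lesssim p$ if $\limsup_{n-s\to\infty}d(p,q,s,n)>0$ (i.e. $\lim_{L\to\infty}\sup_{n-s\ge L}d(p,q,s,n)>0$); write $p\lnsim q$ if $p\lesssim q$ but not $q\lesssim p$. A set $P=\{p_i\}\subseteq\mathbb{Z}[X]$ is sparsely intersecting if for all $i\ne j$, $p_i\lnsim p_j$ or $p_j\lnsim p_i$. It is an explicit sparsely intersecting set if moreover for all distinct $p,q\in P$ there is a computable sequence $(N(m))$ such that $n-s>N(m)$ implies $d(p,q,s,n)<1/m$ or $d(q,p,s,n)<1/m$. Computability: a real $x$ is computable if for some base $b\ge2$ a total recursive function computes its base-$b$ digits. A sequence of reals $(x_n)$ is computable if there is a total recursive $f:\mathbb{N}^2\to\mathbb{Z}$ with $\frac{f(m,n)-1}{m}<x_n<\frac{f(m,n)+1}{m}$ for all $m,n$. A sequence of functions $(f_n)$ from a metric space $X$ to $\mathbb{R}$ is uniformly computable if $(f_n(x_m))_{n,m}$ is computable for every computable sequence $(x_m)$ and there is a recursive $\gamma(n,k)$ with $d(x,y)\le2^{-\gamma(n,k)}\Rightarrow|f_n(x)-f_n(y)|\le2^{-k}$; a sequence $(x_n)$ is uniformly computable if $x_n=f(n)$ for a uniformly computable function $f:\mathbb{N}\to\mathbb{R}$ (i.e. the constant sequence $(f,f,\dots)$ is uniformly computable). A basic sequence $Q$ is computable if $(q_n)$ is a computable sequence; it is computably growing if it is infinite in limit and the sequence $\big(\inf\{i:\forall j\ge i,\ q_j\ge n\}\big)_{n\ge1}$ is computable. A linear family of adfs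 $\{f_{m,r}\}$ is explicit if for each $m,r$: (1) $f_{m,r}(q)$ and $\inf\{x\in[0,1]:f_{m,r}(x)=q\}$ are computable reals for every rational $q\in[0,1]$; (2) every discontinuity $t$ of $f_{m,r}$ is a computable real and $f_{m,r}(t)$ is computable; (3) $f_{m,r}$ is continuous, or has finitely many discontinuities, or its set of discontinuities is $\{t_n:n\in\mathbb{N}\}$ for a uniformly computable sequence $(t_n)$.
   Formalization: Added, as the claim is otherwise false or undefined: each p in P is nonconstant with positive leading coefficient; lower adfs are at most upper adfs; in the second part the adf values at rationals and discontinuities are computable uniformly in m, r and the point. Windows have s ≥ 1. *)

theory Defs
  imports "HOL-Analysis.Analysis" "HOL-Computational_Algebra.Polynomial"
begin

text \<open>
  Sequences indexed by the positive integers are functions on \<^typ>\<open>nat\<close> whose value at \<open>0\<close> is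
  irrelevant; every condition on such a sequence is guarded by \<open>n \<ge> 1\<close>.
\<close>

section \<open>Hausdorff dimension\<close>

text \<open>The diameter of an unbounded set is not meaningful in the library, hence the boundedness
  condition on the covering sets. The convention for \<open>s = 0\<close> is \<open>0\<^sup>0 = 1\<close> on nonempty sets.\<close>

definition hausdorff_gauge :: "real \<Rightarrow> 'a::metric_space set \<Rightarrow> ennreal" where
  "hausdorff_gauge s U =
     (if U = {} then 0 else if s = 0 then 1 else ennreal (diameter U powr s))"

definition hausdorff_premeasure :: "real \<Rightarrow> real \<Rightarrow> 'a::metric_space set \<Rightarrow> ennreal" where
  "hausdorff_premeasure s \<delta> A =
     Inf {(\<Sum>i. hausdorff_gauge s (U i)) | U :: nat \<Rightarrow> 'a set.
            A \<subseteq> (\<Union>i. U i) \<and> (\<forall>i. bounded (U i) \<and> diameter (U i) \<le> \<delta>)}"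

definition hausdorff_measure :: "real \<Rightarrow> 'a::metric_space set \<Rightarrow> ennreal" where
  "hausdorff_measure s A = (SUP \<delta>\<in>{0<..}. hausdorff_premeasure s \<delta> A)"

definition hausdorff_dim :: "'a::metric_space set \<Rightarrow> ennreal" where
  "hausdorff_dim A = Inf {ennreal s | s. 0 \<le> s \<and> hausdorff_measure s A = 0}"

section \<open>Cantor series\<close>

definition basic_sequence :: "(nat \<Rightarrow> int) \<Rightarrow> bool" where
  "basic_sequence Q \<longleftrightarrow> (\<forall>n\<ge>1. Q n \<ge> 2)"

definition infinite_in_limit :: "(nat \<Rightarrow> int) \<Rightarrow> bool" where
  "infinite_in_limit Q \<longleftrightarrow> filterlim Q at_top sequentially"

definition is_cantor_expansion :: "(nat \<Rightarrow> int) \<Rightarrow> real \<Rightarrow> (nat \<Rightarrow> int) \<Rightarrow> bool" where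
  "is_cantor_expansion Q x E \<longleftrightarrow>
     E 0 = \<lfloor>x\<rfloor> \<and>
     (\<forall>n\<ge>1. 0 \<le> E n \<and> E n \<le> Q n - 1) \<and>
     infinite {n. n \<ge> 1 \<and> E n \<noteq> Q n - 1} \<and>
     (\<lambda>n. of_int (E (Suc n)) / of_int (\<Prod>i=1..Suc n. Q i)) sums (x - of_int (E 0))"

definition cantor_digit :: "(nat \<Rightarrow> int) \<Rightarrow> real \<Rightarrow> nat \<Rightarrow> int" where
  "cantor_digit Q x = (THE E. is_cantor_expansion Q x E)"

definition cantor_T :: "(nat \<Rightarrow> int) \<Rightarrow> nat \<Rightarrow> real \<Rightarrow> real" where
  "cantor_T Q n x = frac (of_int (\<Prod>i=1..n. Q i) * x)"

section \<open>Asymptotic distribution functions\<close>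

text \<open>The sequences whose distribution is considered are indexed from \<open>0\<close>.\<close>

definition count_in :: "nat \<Rightarrow> real set \<Rightarrow> (nat \<Rightarrow> real) \<Rightarrow> nat" where
  "count_in n I \<omega> = card {i. i < n \<and> \<omega> i \<in> I}"

definition is_adf :: "(real \<Rightarrow> real) \<Rightarrow> bool" where
  "is_adf f \<longleftrightarrow> mono_on {0..1} f \<and> f ` {0..1} \<subseteq> {0..1} \<and> f 0 = 0 \<and> f 1 = 1"

definition has_upper_adf :: "(nat \<Rightarrow> real) \<Rightarrow> (real \<Rightarrow> real) \<Rightarrow> bool" where
  "has_upper_adf \<omega> f \<longleftrightarrow>
     (\<forall>x\<in>{0..1}. limsup (\<lambda>n. ereal (real (count_in n {0..<x} \<omega>) / real n)) = ereal (f x))"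

definition has_lower_adf :: "(nat \<Rightarrow> real) \<Rightarrow> (real \<Rightarrow> real) \<Rightarrow> bool" where
  "has_lower_adf \<omega> f \<longleftrightarrow>
     (\<forall>x\<in>{0..1}. liminf (\<lambda>n. ereal (real (count_in n {0..<x} \<omega>) / real n)) = ereal (f x))"

definition linear_family :: "(nat \<Rightarrow> nat \<Rightarrow> real \<Rightarrow> real) \<Rightarrow> bool" where
  "linear_family f \<longleftrightarrow>
     (\<forall>m\<ge>1. \<forall>r<m. is_adf (f m r)) \<and>
     (\<forall>m\<ge>1. \<forall>r<m. \<forall>d\<ge>1. \<forall>x\<in>{0..1}.
        f m r x = 1 / real d * (\<Sum>i<d. f (m * d) (m * i + r) x))"

section \<open>Sparsely intersecting polynomials\<close>

definition poly_values :: "int poly \<Rightarrow> int set" where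
  "poly_values p = (\<lambda>n. poly p (int n)) ` {1..}"

text \<open>If the denominator vanishes, the quotient is \<open>0\<close>; so windows without values of \<open>q\<close> do not
  contribute to the suprema below.\<close>

definition rel_density :: "int poly \<Rightarrow> int poly \<Rightarrow> int \<Rightarrow> int \<Rightarrow> real" where
  "rel_density p q s n =
     real (card (poly_values p \<inter> poly_values q \<inter> {s..n})) / real (card (poly_values q \<inter> {s..n}))"

text \<open>The windows \<open>{s..n}\<close> are windows of positions in the positive integers, so \<open>s \<ge> 1\<close>. If
  negative \<open>s\<close> were allowed, then for polynomials with positive leading coefficients the
  supremum would see every fixed initial segment of the values, and two distinct polynomials could
  never satisfy \<open>poly_lnsim\<close>: not even \<open>X\<^sup>2\<close> and \<open>X\<close>. With \<open>s \<ge> 1\<close> strictly more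
  sets of such polynomials are sparsely intersecting.\<close>

definition windows :: "nat \<Rightarrow> (int \<times> int) set" where
  "windows L = {(s, n). 1 \<le> s \<and> s < n \<and> int L \<le> n - s}"

definition poly_lesssim :: "int poly \<Rightarrow> int poly \<Rightarrow> bool" where
  "poly_lesssim q p \<longleftrightarrow> lim (\<lambda>L. SUP (s, n)\<in>windows L. rel_density p q s n) > 0"

definition poly_lnsim :: "int poly \<Rightarrow> int poly \<Rightarrow> bool" where
  "poly_lnsim p q \<longleftrightarrow> poly_lesssim p q \<and> \<not> poly_lesssim q p"

definition sparsely_intersecting :: "int poly set \<Rightarrow> bool" where
  "sparsely_intersecting P \<longleftrightarrow>
     (\<forall>p\<in>P. \<forall>q\<in>P. p \<noteq> q \<longrightarrow> poly_lnsim p q \<or> poly_lnsim q p)"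

section \<open>Computability\<close>

text \<open>Total recursive functions of \<open>k\<close> arguments: closure of the basic functions under
  composition, primitive recursion and regular minimisation. Arguments are passed as a list, and
  only the values on lists of length \<open>k\<close> are meaningful.\<close>

inductive total_recursive :: "nat \<Rightarrow> (nat list \<Rightarrow> nat) \<Rightarrow> bool" where
  tr_zero: "total_recursive k (\<lambda>xs. 0)"
| tr_succ: "total_recursive 1 (\<lambda>xs. Suc (xs ! 0))"
| tr_proj: "i < k \<Longrightarrow> total_recursive k (\<lambda>xs. xs ! i)"
| tr_comp: "\<lbrakk>total_recursive (length gs) h; \<And>g. g \<in> set gs \<Longrightarrow> total_recursive k g\<rbrakk>
    \<Longrightarrow> total_recursive k (\<lambda>xs. h (map (\<lambda>g. g xs) gs))"
| tr_primrec: "\<lbrakk>total_recursive k g; total_recursive (k + 2) h\<rbrakk>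
    \<Longrightarrow> total_recursive (Suc k)
          (\<lambda>xs. rec_nat (g (tl xs)) (\<lambda>n v. h (n # v # tl xs)) (hd xs))"
| tr_minim: "\<lbrakk>total_recursive (Suc k) g; \<And>xs. length xs = k \<Longrightarrow> \<exists>y. g (y # xs) = 0\<rbrakk>
    \<Longrightarrow> total_recursive k (\<lambda>xs. LEAST y. g (y # xs) = 0)"

text \<open>Integer-valued recursive functions, an integer being coded as a difference of two naturals.\<close>

definition total_recursive_int :: "nat \<Rightarrow> (nat list \<Rightarrow> int) \<Rightarrow> bool" where
  "total_recursive_int k f \<longleftrightarrow>
     (\<exists>a b. total_recursive k a \<and> total_recursive k b \<and> (\<forall>xs. f xs = int (a xs) - int (b xs)))"

text \<open>Base-\<open>b\<close> digits are those of the fractional part; the integer part is a single datum.\<close>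

definition computable_real :: "real \<Rightarrow> bool" where
  "computable_real x \<longleftrightarrow>
     (\<exists>b::nat. b \<ge> 2 \<and> (\<exists>f. total_recursive 1 f \<and>
        (\<forall>n\<ge>1. int (f [n]) = \<lfloor>real b ^ n * x\<rfloor> mod int b)))"

definition computable_seq :: "(nat \<Rightarrow> real) \<Rightarrow> bool" where
  "computable_seq x \<longleftrightarrow>
     (\<exists>f. total_recursive_int 2 f \<and>
        (\<forall>m\<ge>1. \<forall>n\<ge>1. (real_of_int (f [m, n]) - 1) / real m < x n \<and>
                      x n < (real_of_int (f [m, n]) + 1) / real m))"

definition computable_seq2 :: "(nat \<Rightarrow> nat \<Rightarrow> real) \<Rightarrow> bool" where
  "computable_seq2 x \<longleftrightarrow>
     (\<exists>f. total_recursive_int 3 f \<and>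
        (\<forall>m\<ge>1. \<forall>n\<ge>1. \<forall>k\<ge>1. (real_of_int (f [m, n, k]) - 1) / real m < x n k \<and>
                            x n k < (real_of_int (f [m, n, k]) + 1) / real m))"

text \<open>Uniform computability for functions on the metric space of positive integers.\<close>

definition uniformly_computable_funs :: "(nat \<Rightarrow> nat \<Rightarrow> real) \<Rightarrow> bool" where
  "uniformly_computable_funs f \<longleftrightarrow>
     (\<forall>x::nat \<Rightarrow> nat. (\<forall>m\<ge>1. x m \<ge> 1) \<and> computable_seq (\<lambda>m. real (x m)) \<longrightarrow>
        computable_seq2 (\<lambda>n m. f n (x m))) \<and>
     (\<exists>\<gamma>. total_recursive 2 \<gamma> \<and>
        (\<forall>n\<ge>1. \<forall>k\<ge>1. \<forall>x\<ge>1. \<forall>y\<ge>1.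
           dist x y \<le> 1 / 2 ^ \<gamma> [n, k] \<longrightarrow> \<bar>f n x - f n y\<bar> \<le> 1 / 2 ^ k))"

definition uniformly_computable_seq :: "(nat \<Rightarrow> real) \<Rightarrow> bool" where
  "uniformly_computable_seq x \<longleftrightarrow> uniformly_computable_funs (\<lambda>n. x)"

definition computable_int_seq :: "(nat \<Rightarrow> int) \<Rightarrow> bool" where
  "computable_int_seq a \<longleftrightarrow> computable_seq (\<lambda>n. real_of_int (a n))"

definition computably_growing :: "(nat \<Rightarrow> int) \<Rightarrow> bool" where
  "computably_growing Q \<longleftrightarrow>
     infinite_in_limit Q \<and>
     computable_seq (\<lambda>n. real (Inf {i. i \<ge> 1 \<and> (\<forall>j\<ge>i. Q j \<ge> int n)}))"

definition explicit_sparsely_intersecting :: "int poly set \<Rightarrow> bool" where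
  "explicit_sparsely_intersecting P \<longleftrightarrow>
     sparsely_intersecting P \<and>
     (\<forall>p\<in>P. \<forall>q\<in>P. p \<noteq> q \<longrightarrow>
        (\<exists>N. computable_int_seq N \<and>
           (\<forall>m\<ge>1. \<forall>s n. 1 \<le> s \<and> s < n \<and> n - s > N m \<longrightarrow>
              rel_density p q s n < 1 / real m \<or> rel_density q p s n < 1 / real m)))"

definition discontinuities :: "(real \<Rightarrow> real) \<Rightarrow> real set" where
  "discontinuities f = {t \<in> {0..1}. \<not> continuous (at t within {0..1}) f}"

text \<open>The infimum is required to be computable only if the level set is nonempty.\<close>

definition explicit_adf :: "(real \<Rightarrow> real) \<Rightarrow> bool" where
  "explicit_adf f \<longleftrightarrow>
     (\<forall>q\<in>\<rat> \<inter> {0..1}. computable_real (f q) \<and>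
        ({x \<in> {0..1}. f x = q} \<noteq> {} \<longrightarrow> computable_real (Inf {x \<in> {0..1}. f x = q}))) \<and>
     (\<forall>t\<in>discontinuities f. computable_real t \<and> computable_real (f t)) \<and>
     (continuous_on {0..1} f \<or> finite (discontinuities f) \<or>
      (\<exists>t. uniformly_computable_seq t \<and> discontinuities f = t ` {1..}))"

definition explicit_linear_family :: "(nat \<Rightarrow> nat \<Rightarrow> real \<Rightarrow> real) \<Rightarrow> bool" where
  "explicit_linear_family f \<longleftrightarrow> linear_family f \<and> (\<forall>m\<ge>1. \<forall>r<m. explicit_adf (f m r))"

text \<open>
  The preceding notion asks for the computability of each value separately. This does not suffice
  for computable digit bounds: every increasing bijection of the rationals in \<open>[0,1]\<close> extends to
  a homeomorphism \<open>g\<close> such that the constant family \<open>f m r = g\<close> is explicit, and there are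
  uncountably many such \<open>g\<close>, but only countably many can be the distribution function of digits
  within computable bounds. The following condition makes the values at the rationals and at the
  discontinuities computable uniformly in \<open>m\<close>, \<open>r\<close> and the point; \<open>t\<close> is a joint enumeration
  of these points.
\<close>

definition uniformly_evaluable :: "(nat \<Rightarrow> nat \<Rightarrow> real \<Rightarrow> real) \<Rightarrow> bool" where
  "uniformly_evaluable f \<longleftrightarrow>
     (\<exists>t. computable_seq t \<and>
        t ` {1..} \<subseteq> {0..1} \<and>
        \<rat> \<inter> {0..1} \<subseteq> t ` {1..} \<and>
        (\<forall>m\<ge>1. \<forall>r<m. discontinuities (f m r) \<subseteq> t ` {1..}) \<and>
        (\<exists>h. total_recursive_int 4 h \<and>
           (\<forall>k\<ge>1. \<forall>m\<ge>1. \<forall>r<m. \<forall>n\<ge>1.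
              (real_of_int (h [k, m, r, n]) - 1) / real k < f m r (t n) \<and>
              f m r (t n) < (real_of_int (h [k, m, r, n]) + 1) / real k)))"

section \<open>The set of prescribed distribution\<close>

text \<open>For the polynomials considered, \<open>p (m n + r)\<close> is negative for at most finitely many \<open>n\<close>;
  such an index is read as \<open>0\<close>, which has no influence on upper and lower adfs.\<close>

definition Phi_set :: "(nat \<Rightarrow> int) \<Rightarrow> int poly set \<Rightarrow>
    (int poly \<Rightarrow> nat \<Rightarrow> nat \<Rightarrow> real \<Rightarrow> real) \<Rightarrow> (int poly \<Rightarrow> nat \<Rightarrow> nat \<Rightarrow> real \<Rightarrow> real) \<Rightarrow> real set" where
  "Phi_set Q P fu fl =
     {x \<in> {0..<1}. \<forall>p\<in>P. \<forall>m\<ge>1. \<forall>r<m.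
        has_upper_adf (\<lambda>n. cantor_T Q (nat (poly p (int (m * n + r)))) x) (fu p m r) \<and>
        has_lower_adf (\<lambda>n. cantor_T Q (nat (poly p (int (m * n + r)))) x) (fl p m r)}"

end

theory Submission
  imports Defs
begin

text \<open>
  Two linear polynomials, or two polynomials of degree at least \<open>2\<close>, are never comparable by
  \<^const>\<open>poly_lnsim\<close>, so a sparsely intersecting set consists of at most one polynomial of each kind. The
  digit at position \<open>p j + 1\<close> determines \<open>T (p j)\<close> up to \<open>1 / Q (p j + 1)\<close>. Restricting that digit to a range that
  corresponds to an interval around a suitable quantile, with longer and longer phases for the upper and the
  lower family in alternation, forces the prescribed upper and lower distribution functions; where the
  two polynomials collide, the one of degree at least \<open>2\<close> wins, which changes the linear one on a set of
  density \<open>0\<close> only. Each range contains at least a fraction of the digits that may tend to \<open>0\<close> as slowly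
  as desired, so a Hoelder map onto the unit interval shows that the digit box has dimension \<open>1\<close>. The quantiles
  are found by an unbounded search over approximations of the data, hence the digit bounds are recursive
  if the data are.
\<close>

section \<open>Cantor series\<close>

text \<open>One digit sequence must serve every pair (m, r) at once; this is where linearity enters.
  If m divides M = \<open>fact s\<close>, then f_{m,r} is the average of the f_{M,r'} with r'
  congruent to r modulo m, and every m divides \<open>fact s\<close> from some stage on. So stage s
  only looks at residue classes modulo \<open>fact s\<close>: a chunk visits each class
  \<open>s + 1\<close> times, visit i aims at the quantile of level (i+1)/(s+1), and each class
  count is wrong by a bounded amount out of \<open>s + 1\<close>. All classes change phase together.
  As lower <= upper, every average is asymptotically a mixture of the two families, with one mixing
  weight that comes near both 0 and 1. The number D of cells needed at stage s is beyond control. A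
  stage is therefore postponed until the bases exceed (8 D)^(s+1): keeping one digit in 8 D then
  costs at most the power 1/(s+1) of the base, so the dimension stays 1. The delay also makes a
  chunk negligible against the indices before it, so incomplete chunks do no harm.\<close>

definition cantor_prod :: "(nat \<Rightarrow> int) \<Rightarrow> nat \<Rightarrow> real" where
  "cantor_prod Q n = real_of_int (\<Prod>i=1..n. Q i)"

lemma cantor_prod_0 [simp]: "cantor_prod Q 0 = 1"
  by (simp add: cantor_prod_def)

lemma cantor_prod_Suc: "cantor_prod Q (Suc n) = of_int (Q (Suc n)) * cantor_prod Q n"
  by (simp add: cantor_prod_def prod.nat_ivl_Suc')

lemma cantor_prod_ge_1:
  assumes "\<And>n. n \<ge> 1 \<Longrightarrow> Q n \<ge> 1"
  shows "cantor_prod Q n \<ge> 1"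
proof (induction n)
  case (Suc n)
  have "1 * 1 \<le> real_of_int (Q (Suc n)) * cantor_prod Q n"
    using Suc assms[of "Suc n"] by (intro mult_mono) auto
  then show ?case by (simp add: cantor_prod_Suc)
qed simp

lemma cantor_T_bounds: "0 \<le> cantor_T Q n x" "cantor_T Q n x < 1"
  by (auto simp: cantor_T_def frac_lt_1)

lemma cantor_T_0: "x \<in> {0..<1} \<Longrightarrow> cantor_T Q 0 x = x"
  by (simp add: cantor_T_def frac_eq)

lemma cantor_T_Suc:
  "cantor_T Q (Suc n) x =
     of_int (Q (Suc n)) * cantor_T Q n x - of_int \<lfloor>of_int (Q (Suc n)) * cantor_T Q n x\<rfloor>"
proof -
  define y where "y = real_of_int (\<Prod>i=1..n. Q i) * x"
  have 1: "real_of_int (\<Prod>i=1..Suc n. Q i) * x = of_int (Q (Suc n)) * y"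
    by (simp add: y_def prod.nat_ivl_Suc')
  have "of_int (Q (Suc n)) * y = of_int (Q (Suc n)) * frac y + of_int (Q (Suc n) * \<lfloor>y\<rfloor>)"
    by (simp add: frac_def algebra_simps)
  then have "frac (of_int (Q (Suc n)) * y) = frac (of_int (Q (Suc n)) * frac y)"
    by (simp only: frac_in_Ints_iff frac_add_of_int_right)
  then show ?thesis
    unfolding cantor_T_def 1 y_def[symmetric] by (simp add: frac_def)
qed

locale cantor_base =
  fixes Q :: "nat \<Rightarrow> int"
  assumes Q: "basic_sequence Q"
begin

abbreviation P :: "nat \<Rightarrow> real" where
  "P \<equiv> cantor_prod Q"

lemma Q_ge_2: "n \<ge> 1 \<Longrightarrow> Q n \<ge> 2"
  using Q by (simp add: basic_sequence_def)

lemma P_ge_1: "P n \<ge> 1"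
  by (rule cantor_prod_ge_1) (use Q_ge_2 in fastforce)

lemma P_pos: "P n > 0" "P n \<noteq> 0"
  using P_ge_1[of n] by auto

lemma inverse_P_tendsto_0: "(\<lambda>n. 1 / P n) \<longlonglongrightarrow> 0"
proof (rule tendsto_sandwich[OF _ _ tendsto_const])
  have *: "2 ^ n \<le> P n" for n
  proof (induction n)
    case (Suc n)
    have "real_of_int (Q (Suc n)) \<ge> 2" using Q_ge_2[of "Suc n"] by simp
    then have "2 * 2 ^ n \<le> real_of_int (Q (Suc n)) * P n" using Suc by (intro mult_mono) auto
    then show ?case by (simp add: cantor_prod_Suc)
  qed simp
  show "\<forall>\<^sub>F n in sequentially. 1 / P n \<le> (1/2) ^ n"
    using * P_pos by (intro always_eventually allI) (simp add: power_divide field_simps)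
  show "\<forall>\<^sub>F n in sequentially. 0 \<le> 1 / P n"
    using P_pos by (simp add: less_imp_le)
qed (auto intro!: LIMSEQ_realpow_zero)

text \<open>The tails of a digit series are compared with the telescoping series with terms
  \<open>1 / P n - 1 / P (n + 1) = (Q (n + 1) - 1) / P (n + 1)\<close>.\<close>

lemma digit_series_tail:
  assumes E: "\<And>n. n \<ge> 1 \<Longrightarrow> 0 \<le> E n \<and> E n \<le> Q n - 1"
    and inf: "infinite {n. n \<ge> 1 \<and> E n \<noteq> Q n - 1}"
  shows "\<exists>\<rho>. (\<lambda>i. of_int (E (Suc (i + n))) / P (Suc (i + n))) sums \<rho> \<and> 0 \<le> \<rho> \<and> P n * \<rho> < 1"
proof -
  define e where "e i = of_int (E (Suc (i + n))) / P (Suc (i + n))" for i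
  define d where "d i = 1 / P (i + n) - 1 / P (Suc (i + n)) - e i" for i
  have "(\<lambda>i. 1 / P (i + n)) \<longlonglongrightarrow> 0" using inverse_P_tendsto_0 by (rule LIMSEQ_ignore_initial_segment)
  from telescope_sums'[where f = "\<lambda>i. 1 / P (i + n)", OF this]
  have tel: "(\<lambda>i. 1 / P (i + n) - 1 / P (Suc (i + n))) sums (1 / P n)" by simp
  have e0: "e i \<ge> 0" for i
    using E[of "Suc (i + n)"] P_pos[of "Suc (i + n)"] by (simp add: e_def less_imp_le)
  have d_eq: "d i = of_int (Q (Suc (i + n)) - 1 - E (Suc (i + n))) / P (Suc (i + n))" for i
  proof -
    have "1 / P (i + n) = of_int (Q (Suc (i + n))) / P (Suc (i + n))"
      using P_pos[of "i + n"] Q_ge_2[of "Suc (i + n)"] unfolding cantor_prod_Suc by simp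
    then show ?thesis by (simp add: d_def e_def diff_divide_distrib)
  qed
  have d0: "d i \<ge> 0" for i
    unfolding d_eq using E[of "Suc (i + n)"] P_pos[of "Suc (i + n)"] by (simp add: less_imp_le)
  have "summable e"
    using e0 d0 by (intro summable_comparison_test'[OF sums_summable[OF tel], of 0]) (auto simp: d_def)
  then have esums: "e sums suminf e" by (rule summable_sums)
  have dsums: "d sums (1 / P n - suminf e)" using sums_diff[OF tel esums] by (simp add: d_def[abs_def])
  \<comment> \<open>Equality with the telescoping series would force every later digit to be Q - 1;
    one smaller digit makes the inequality strict.\<close>
  obtain k where k: "k > n" "k \<ge> 1" "E k \<noteq> Q k - 1"
    using inf unfolding infinite_nat_iff_unbounded by auto
  define i where "i = k - n - 1"
  have ki: "k = Suc (i + n)" using k by (simp add: i_def)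
  have "d i > 0" unfolding d_eq using E[of k] P_pos[of k] k by (simp add: ki)
  then have "0 < suminf d" using d0 dsums by (subst suminf_pos_iff) (auto simp: sums_iff)
  then have "suminf e < 1 / P n" using dsums by (simp add: sums_iff)
  then have "P n * suminf e < 1" using P_pos[of n] by (simp add: field_simps)
  moreover have "0 \<le> suminf e" using \<open>summable e\<close> e0 by (intro suminf_nonneg)
  ultimately show ?thesis using esums by (auto simp: e_def[abs_def])
qed

text \<open>Multiplying the expansion by \<open>P n\<close> leaves an integer plus
  \<open>P n\<close> times the tail, which lies in [0, 1). So the scaled tail is
  \<open>cantor_T Q n x\<close>, and a further factor \<open>Q (n + 1)\<close> moves one digit in
  front of the point. Uniqueness of expansions is a consequence.\<close>

lemma expansion_digit:
  assumes E: "is_cantor_expansion Q x E"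
  shows "E (Suc n) = \<lfloor>of_int (Q (Suc n)) * cantor_T Q n x\<rfloor>"
proof -
  define e where "e n = of_int (E (Suc n)) / P (Suc n)" for n
  define \<rho> where "\<rho> n = x - of_int (E 0) - (\<Sum>i<n. e i)" for n
  have sums: "e sums (x - of_int (E 0))"
    using E unfolding is_cantor_expansion_def e_def cantor_prod_def by blast
  have r_bounds: "0 \<le> P n * \<rho> n" "P n * \<rho> n < 1" for n
  proof -
    obtain \<rho>' where \<rho>': "(\<lambda>i. e (i + n)) sums \<rho>'" "0 \<le> \<rho>'" "P n * \<rho>' < 1"
      using digit_series_tail[of E n] E unfolding is_cantor_expansion_def e_def by blast
    moreover have "(\<lambda>i. e (i + n)) sums \<rho> n"
      using sums_split_initial_segment[OF sums, of n] by (simp add: \<rho>_def)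
    ultimately have "\<rho> n = \<rho>'" using sums_unique2 by blast
    then show "0 \<le> P n * \<rho> n" "P n * \<rho> n < 1" using \<rho>' P_pos[of n] by auto
  qed
  have int: "P n * (\<Sum>i<n. e i) \<in> \<int>" for n
  proof (induction n)
    case (Suc n)
    have "P (Suc n) * (\<Sum>i<Suc n. e i) = of_int (Q (Suc n)) * (P n * (\<Sum>i<n. e i)) + of_int (E (Suc n))"
      using P_pos[of "Suc n"] by (simp add: e_def cantor_prod_Suc algebra_simps)
    then show ?case using Suc by simp
  qed simp
  have T: "cantor_T Q n x = P n * \<rho> n" for n
    unfolding cantor_T_def cantor_prod_def[symmetric]
  proof (subst frac_unique_iff, intro conjI r_bounds)
    have eq: "P n * x - P n * \<rho> n = of_int ((\<Prod>i=1..n. Q i) * E 0) + P n * (\<Sum>i<n. e i)"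
      by (simp add: \<rho>_def cantor_prod_def algebra_simps)
    show "P n * x - P n * \<rho> n \<in> \<int>"
      unfolding eq by (intro Ints_add Ints_of_int int)
  qed
  have "of_int (Q (Suc n)) * (P n * \<rho> n) = P (Suc n) * \<rho> (Suc n) + of_int (E (Suc n))"
    using P_pos[of "Suc n"] P_pos[of n] Q_ge_2[of "Suc n"] by (simp add: \<rho>_def e_def cantor_prod_Suc field_simps)
  with r_bounds[of "Suc n"] show ?thesis
    unfolding T by (intro floor_unique[symmetric]) auto
qed

text \<open>Greedy digits: by \<open>cantor_T_Suc\<close> each digit is what the map removes, so the
  partial sums miss the fractional part of x by \<open>cantor_T Q n x / P n\<close>, which tends to
  0.\<close>

lemma expansion_exists:
  "is_cantor_expansion Q x
    (\<lambda>n. if n = 0 then \<lfloor>x\<rfloor> else \<lfloor>of_int (Q n) * cantor_T Q (n - 1) x\<rfloor>)" (is "is_cantor_expansion Q x ?E")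
proof -
  define d where "d n = \<lfloor>of_int (Q (Suc n)) * cantor_T Q n x\<rfloor>" for n
  have E: "?E n = d (n - 1)" if "n \<ge> 1" for n using that by (simp add: d_def)
  have rec: "cantor_T Q (Suc n) x = of_int (Q (Suc n)) * cantor_T Q n x - of_int (d n)" for n
    unfolding d_def by (rule cantor_T_Suc)
  have dig: "0 \<le> d n" "d n \<le> Q (Suc n) - 1" for n
  proof -
    show "0 \<le> d n" using cantor_T_bounds[of Q n x] Q_ge_2[of "Suc n"] by (simp add: d_def)
    have "of_int (Q (Suc n)) * cantor_T Q n x < of_int (Q (Suc n)) * 1"
      using cantor_T_bounds[of Q n x] Q_ge_2[of "Suc n"] by (intro mult_strict_left_mono) auto
    then show "d n \<le> Q (Suc n) - 1" unfolding d_def by linarith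
  qed
  have partial: "(\<Sum>i<n. of_int (d i) / P (Suc i)) = x - of_int \<lfloor>x\<rfloor> - cantor_T Q n x / P n" for n
  proof (induction n)
    case 0 show ?case by (simp add: cantor_T_def frac_def)
  next
    case (Suc n)
    have "cantor_T Q (Suc n) x / P (Suc n) = cantor_T Q n x / P n - of_int (d n) / P (Suc n)"
      using P_pos[of n] Q_ge_2[of "Suc n"] by (simp add: rec cantor_prod_Suc field_simps)
    then show ?case using Suc by simp
  qed
  have "(\<lambda>n. cantor_T Q n x / P n) \<longlonglongrightarrow> 0"
  proof (rule tendsto_sandwich[OF _ _ tendsto_const inverse_P_tendsto_0])
    show "\<forall>\<^sub>F n in sequentially. 0 \<le> cantor_T Q n x / P n"
      using cantor_T_bounds(1) P_pos(1) by (simp add: less_imp_le)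
    show "\<forall>\<^sub>F n in sequentially. cantor_T Q n x / P n \<le> 1 / P n"
      using cantor_T_bounds(2) P_pos(1) by (intro always_eventually allI divide_right_mono) (auto intro: less_imp_le)
  qed
  then have "(\<lambda>n. \<Sum>i<n. of_int (d i) / P (Suc i)) \<longlonglongrightarrow> x - of_int \<lfloor>x\<rfloor> - 0"
    unfolding partial by (intro tendsto_intros)
  then have sums: "(\<lambda>i. of_int (d i) / P (Suc i)) sums (x - of_int \<lfloor>x\<rfloor>)" by (simp add: sums_def)
  have inf: "infinite {n. n \<ge> 1 \<and> d (n - 1) \<noteq> Q n - 1}"
  proof
    assume "finite {n. n \<ge> 1 \<and> d (n - 1) \<noteq> Q n - 1}"
    then obtain k where k: "\<And>n. n \<ge> 1 \<Longrightarrow> d (n - 1) \<noteq> Q n - 1 \<Longrightarrow> n \<le> k"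
      by (auto simp: finite_nat_set_iff_bounded_le)
    \<comment> \<open>If all digits beyond k were maximal, 1 - T would be multiplied by a base >= 2
      at every step, yet it starts positive and stays at most 1.\<close>
    have "1 - cantor_T Q (i + k) x \<ge> 2 ^ i * (1 - cantor_T Q k x)" for i
    proof (induction i)
      case (Suc i)
      have "d (i + k) = Q (Suc (i + k)) - 1" using k[of "Suc (i + k)"] by force
      then have "1 - cantor_T Q (Suc i + k) x = of_int (Q (Suc (i + k))) * (1 - cantor_T Q (i + k) x)"
        by (simp add: rec algebra_simps)
      also have "\<dots> \<ge> 2 * (1 - cantor_T Q (i + k) x)"
        using Q_ge_2[of "Suc (i + k)"] cantor_T_bounds(2)[of Q "i + k" x] by (intro mult_right_mono) auto
      finally show ?case using Suc by simp
    qed simp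
    then have *: "2 ^ i * (1 - cantor_T Q k x) \<le> 1" for i
      by (smt (verit) cantor_T_bounds(1))
    obtain i where "1 / (1 - cantor_T Q k x) < 2 ^ i"
      using real_arch_pow[of 2] by auto
    then have "1 < 2 ^ i * (1 - cantor_T Q k x)"
      using cantor_T_bounds(2)[of Q k x] by (simp add: field_simps)
    with *[of i] show False by simp
  qed
  have "{n. n \<ge> 1 \<and> ?E n \<noteq> Q n - 1} = {n. n \<ge> 1 \<and> d (n - 1) \<noteq> Q n - 1}" using E by auto
  moreover have "0 \<le> ?E n \<and> ?E n \<le> Q n - 1" if "n \<ge> 1" for n
    using dig[of "n - 1"] that unfolding E[OF that] by simp
  ultimately show ?thesis
    unfolding is_cantor_expansion_def using inf sums by (auto simp: d_def cantor_prod_def)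
qed

lemma expansion_cantor_digit: "is_cantor_expansion Q x (cantor_digit Q x)"
proof -
  have "\<exists>!E. is_cantor_expansion Q x E"
  proof (rule ex1I, rule expansion_exists)
    fix E assume E: "is_cantor_expansion Q x E"
    show "E = (\<lambda>n. if n = 0 then \<lfloor>x\<rfloor> else \<lfloor>of_int (Q n) * cantor_T Q (n - 1) x\<rfloor>)"
    proof
      fix n
      show "E n = (if n = 0 then \<lfloor>x\<rfloor> else \<lfloor>of_int (Q n) * cantor_T Q (n - 1) x\<rfloor>)"
        using E expansion_digit[OF E, of "n - 1"] by (cases n) (auto simp: is_cantor_expansion_def)
    qed
  qed
  then show ?thesis unfolding cantor_digit_def by (rule theI')
qed

lemma digit_Suc: "cantor_digit Q x (Suc n) = \<lfloor>of_int (Q (Suc n)) * cantor_T Q n x\<rfloor>"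
  using expansion_digit expansion_cantor_digit by blast

lemma digit_unique:
  assumes "is_cantor_expansion Q x E"
  shows "cantor_digit Q x = E"
proof
  fix n
  show "cantor_digit Q x n = E n"
    using expansion_digit[OF assms, of "n - 1"] digit_Suc[of x "n - 1"] assms expansion_cantor_digit[of x]
    by (cases n) (auto simp: is_cantor_expansion_def)
qed

lemma expansion_of_digits:
  assumes "E 0 = 0" and E: "\<And>n. n \<ge> 1 \<Longrightarrow> 0 \<le> E n \<and> E n \<le> Q n - 1"
    and inf: "infinite {n. n \<ge> 1 \<and> E n \<noteq> Q n - 1}"
  shows "\<exists>x\<in>{0..<1}. is_cantor_expansion Q x E"
proof -
  obtain x where x: "(\<lambda>i. of_int (E (Suc i)) / P (Suc i)) sums x" "0 \<le> x" "x < 1"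
    using digit_series_tail[OF E inf, of 0] by auto
  then have "is_cantor_expansion Q x E"
    unfolding is_cantor_expansion_def using assms by (auto simp: cantor_prod_def floor_eq_iff)
  then show ?thesis using x by auto
qed

end

section \<open>Hausdorff dimension of digit boxes\<close>

text \<open>For s > 1 the \<open>n + 1\<close> intervals of length 1/(n+1) have total gauge
  (n+1)^(1-s), which tends to 0.\<close>

lemma hausdorff_dim_le_1:
  fixes A :: "real set"
  assumes "A \<subseteq> {0..<1}"
  shows "hausdorff_dim A \<le> 1"
proof -
  have meas: "hausdorff_measure s A = 0" if s: "s > 1" for s
  proof -
    have "hausdorff_premeasure s \<delta> A \<le> 0" if \<delta>: "\<delta> > 0" for \<delta>
    proof -
      define B where "B n = ennreal (real (Suc n) powr (1 - s))" for n
      have "(\<lambda>n. real (Suc n) powr (1 - s)) \<longlonglongrightarrow> 0"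
        using s by (intro tendsto_neg_powr filterlim_compose[OF filterlim_real_sequentially filterlim_Suc]) auto
      then have lim: "B \<longlonglongrightarrow> 0"
        unfolding B_def using tendsto_ennrealI by fastforce
      obtain k where k: "1 / \<delta> < real k" using reals_Archimedean2 by blast
      have "hausdorff_premeasure s \<delta> A \<le> B n" if n: "n \<ge> k" for n
      proof -
        define U :: "nat \<Rightarrow> real set" where
          "U i = (if i < Suc n then {real i / real (Suc n) .. (real i + 1) / real (Suc n)} else {})" for i
        have diam: "diameter (U i) = 1 / real (Suc n)" if "i < Suc n" for i
          using that divide_right_mono[of "real i" "real i + 1" "real (Suc n)"]
          by (simp add: U_def diff_divide_distrib[symmetric] del: of_nat_Suc)
        have cover: "A \<subseteq> (\<Union>i. U i)"
        proof
          fix x assume "x \<in> A"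
          then have x: "0 \<le> x" "x < 1" using assms by auto
          define i where "i = nat \<lfloor>x * real (Suc n)\<rfloor>"
          have fl: "real i \<le> x * real (Suc n)" "x * real (Suc n) < real i + 1"
            using x by (auto simp: i_def)
          have "x * real (Suc n) < real (Suc n)" using x by simp
          then have "i < Suc n" using fl by linarith
          moreover have "x \<in> U i" using \<open>i < Suc n\<close> fl by (simp add: U_def field_simps)
          ultimately show "x \<in> (\<Union>i. U i)" by blast
        qed
        have small: "1 / real (Suc n) \<le> \<delta>"
        proof -
          have "1 / \<delta> \<le> real (Suc n)" using k n by linarith
          then show ?thesis using \<delta> by (simp add: field_simps)
        qed
        have ok: "bounded (U i) \<and> diameter (U i) \<le> \<delta>" for i
          using diam[of i] small \<delta> by (cases "i < Suc n") (auto simp: U_def)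
        have g: "hausdorff_gauge s (U i) = (if i < Suc n then ennreal ((1 / real (Suc n)) powr s) else 0)" for i
        proof (cases "i < Suc n")
          case True
          then have "U i \<noteq> {}" by (simp add: U_def divide_right_mono)
          then show ?thesis using True s diam[OF True] by (simp add: hausdorff_gauge_def)
        qed (simp add: hausdorff_gauge_def U_def)
        have "(\<Sum>i. hausdorff_gauge s (U i)) = (\<Sum>i<Suc n. ennreal ((1 / real (Suc n)) powr s))"
          unfolding g by (subst suminf_finite[of "{..<Suc n}"]) auto
        also have "\<dots> = ennreal (real (Suc n) * (1 / real (Suc n)) powr s)"
          by (simp add: ennreal_mult' ennreal_of_nat_eq_real_of_nat del: of_nat_Suc)
        also have "real (Suc n) * (1 / real (Suc n)) powr s = real (Suc n) powr (1 - s)"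
          by (simp add: powr_diff powr_divide del: of_nat_Suc)
        finally have "(\<Sum>i. hausdorff_gauge s (U i)) = B n" by (simp add: B_def)
        moreover have "hausdorff_premeasure s \<delta> A \<le> (\<Sum>i. hausdorff_gauge s (U i))"
          unfolding hausdorff_premeasure_def using cover ok by (intro Inf_lower) auto
        ultimately show ?thesis by simp
      qed
      then show ?thesis by (intro LIMSEQ_le_const[OF lim]) blast
    qed
    then show ?thesis unfolding hausdorff_measure_def by (simp add: SUP_eq_const bot_ennreal)
  qed
  show ?thesis
  proof (rule ennreal_le_epsilon)
    fix e :: real assume e: "0 < e"
    have "hausdorff_dim A \<le> ennreal (1 + e)"
      unfolding hausdorff_dim_def using meas[of "1 + e"] e
      by (intro Inf_lower CollectI exI[of _ "1 + e"] conjI refl) auto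
    then show "hausdorff_dim A \<le> 1 + ennreal e" using e by (simp add: ennreal_plus)
  qed
qed

lemma hausdorff_dim_mono: "A \<subseteq> B \<Longrightarrow> hausdorff_dim A \<le> hausdorff_dim B"
proof -
  assume AB: "A \<subseteq> B"
  have "hausdorff_premeasure s \<delta> A \<le> hausdorff_premeasure s \<delta> B" for s \<delta>
    unfolding hausdorff_premeasure_def using AB by (intro Inf_superset_mono) auto
  then have "hausdorff_measure s A \<le> hausdorff_measure s B" for s
    unfolding hausdorff_measure_def by (intro SUP_mono) auto
  then have "hausdorff_measure s B = 0 \<Longrightarrow> hausdorff_measure s A = 0" for s
    by (metis le_zero_eq)
  then show ?thesis unfolding hausdorff_dim_def by (intro Inf_superset_mono) auto
qed

text \<open>The preimages under \<open>X\<close> of the sets of a cover of \<open>A\<close> are a cover of the unit interval by sets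
  contained in intervals of controlled length.\<close>

lemma hausdorff_dim_ge_1:
  fixes A :: "real set" and X :: "real \<Rightarrow> real"
  assumes X: "\<And>z. z \<in> {0..<1} \<Longrightarrow> X z \<in> A"
    and H: "\<And>s. 0 < s \<Longrightarrow> s < 1 \<Longrightarrow>
      \<exists>C>0. \<forall>z\<in>{0..<1}. \<forall>z'\<in>{0..<1}. \<bar>z - z'\<bar> \<le> C * \<bar>X z - X z'\<bar> powr s"
  shows "hausdorff_dim A \<ge> 1"
  unfolding hausdorff_dim_def
proof (rule Inf_greatest, clarify)
  fix s0 :: real assume s0: "0 \<le> s0" and meas: "hausdorff_measure s0 A = 0"
  show "1 \<le> ennreal s0"
  proof (rule ccontr)
    assume "\<not> 1 \<le> ennreal s0"
    then have "s0 < 1" using s0 by (metis ennreal_1 ennreal_leI linorder_not_less)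
    \<comment> \<open>An exponent strictly between s0 and 1, positive even if s0 = 0: the Hoelder
      estimate is available for it, and diameters <= 1 satisfy diam^s <= diam^s0.\<close>
    define s where "s = (s0 + 1) / 2"
    have s: "0 < s" "s < 1" "s0 < s" using s0 \<open>s0 < 1\<close> by (auto simp: s_def)
    obtain C where C: "C > 0"
      and hol: "\<And>z z'. z \<in> {0..<1} \<Longrightarrow> z' \<in> {0..<1} \<Longrightarrow> \<bar>z - z'\<bar> \<le> C * \<bar>X z - X z'\<bar> powr s"
      using H[OF s(1,2)] by blast
    have "hausdorff_premeasure s0 1 A \<le> hausdorff_measure s0 A"
      unfolding hausdorff_measure_def by (intro SUP_upper) auto
    \<comment> \<open>Each covering set contributes an interval of length 2 C diam^s, so a total
      gauge below 1/(2 C) gives a total length below that of the unit interval.\<close>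
    with meas have "hausdorff_premeasure s0 1 A < ennreal (1 / (2 * C))"
      using C by (simp add: zero_less_iff_neq_zero[symmetric])
    then obtain U :: "nat \<Rightarrow> real set" where cover: "A \<subseteq> (\<Union>i. U i)"
      and U: "\<And>i. bounded (U i) \<and> diameter (U i) \<le> 1"
      and small: "(\<Sum>i. hausdorff_gauge s0 (U i)) < ennreal (1 / (2 * C))"
      unfolding hausdorff_premeasure_def Inf_less_iff by auto
    define V where "V i = {z \<in> {0..<1}. X z \<in> U i}" for i
    define c where "c i = (SOME z. z \<in> V i)" for i
    define r where "r i = C * diameter (U i) powr s" for i
    define I where "I i = (if V i = {} then {} else {c i - r i .. c i + r i})" for i
    have r0: "r i \<ge> 0" for i using C by (simp add: r_def)
    have VI: "V i \<subseteq> I i" for i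
    proof
      fix z assume z: "z \<in> V i"
      then have ci: "c i \<in> V i" unfolding c_def by (rule someI)
      have "\<bar>X z - X (c i)\<bar> \<le> diameter (U i)"
        using z ci U[of i] diameter_bounded_bound[of "U i" "X z" "X (c i)"] by (auto simp: V_def dist_real_def)
      then have "C * \<bar>X z - X (c i)\<bar> powr s \<le> r i"
        unfolding r_def using C s by (intro mult_left_mono powr_mono2) auto
      then have "\<bar>z - c i\<bar> \<le> r i"
        using hol[of z "c i"] z ci by (auto simp: V_def)
      then show "z \<in> I i" using z by (auto simp: I_def)
    qed
    have "{0..<1} \<subseteq> (\<Union>i. V i)" using X cover by (fastforce simp: V_def)
    then have "{0..<1} \<subseteq> (\<Union>i. I i)" using VI by blast
    then have "emeasure lborel {0..<1::real} \<le> emeasure lborel (\<Union>i. I i)"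
      by (intro emeasure_mono) (auto simp: I_def)
    also have "\<dots> \<le> (\<Sum>i. emeasure lborel (I i))"
      by (intro emeasure_subadditive_countably) (auto simp: I_def)
    also have "\<dots> \<le> (\<Sum>i. ennreal (2 * C) * hausdorff_gauge s0 (U i))"
    proof (intro suminf_le allI)
      fix i
      show "emeasure lborel (I i) \<le> ennreal (2 * C) * hausdorff_gauge s0 (U i)"
      proof (cases "V i = {}")
        case False
        then have ne: "U i \<noteq> {}" by (auto simp: V_def)
        have d: "0 \<le> diameter (U i)" "diameter (U i) \<le> 1" using U[of i] by (auto intro: diameter_ge_0)
        have "emeasure lborel (I i) = ennreal (2 * C * diameter (U i) powr s)"
          using False r0[of i] by (simp add: I_def r_def)
        also have "\<dots> = ennreal (2 * C) * ennreal (diameter (U i) powr s)"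
          using C by (simp add: ennreal_mult)
        also have "ennreal (diameter (U i) powr s) \<le> hausdorff_gauge s0 (U i)"
        proof (cases "s0 = 0")
          case True
          have "diameter (U i) powr s \<le> 1" using d s by (simp add: powr_le1)
          then show ?thesis using True ne by (simp add: hausdorff_gauge_def)
        next
          case False
          have "diameter (U i) powr s \<le> diameter (U i) powr s0"
            using d s by (intro powr_mono') auto
          then show ?thesis using False ne by (simp add: hausdorff_gauge_def ennreal_leI)
        qed
        finally show ?thesis by (simp add: mult_left_mono)
      qed (simp add: I_def)
    qed auto
    also have "\<dots> = ennreal (2 * C) * (\<Sum>i. hausdorff_gauge s0 (U i))" by simp
    also have "\<dots> < ennreal (2 * C) * ennreal (1 / (2 * C))"
      using small C by (intro ennreal_mult_strict_left_mono) auto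
    also have "\<dots> = 1" using C by (simp flip: ennreal_mult)
    finally show False by simp
  qed
qed

definition digit_box :: "(nat \<Rightarrow> int) \<Rightarrow> (nat \<Rightarrow> int) \<Rightarrow> (nat \<Rightarrow> int) \<Rightarrow> real set" where
  "digit_box Q \<alpha> \<beta> = {x \<in> {0..<1}. \<forall>n\<ge>1. \<alpha> n \<le> cantor_digit Q x n \<and> cantor_digit Q x n \<le> \<beta> n}"

text \<open>Read z in the mixed base N of the numbers of admissible digits and shift its digits by
  \<alpha>: this gives the point X z of the box. If z and z' first differ at digit n + 1, then |z -
  z'| is at most |X z - X z'| times the product of Q/N up to position n + 2 (one more, because the
  next digit separates the tails), while |X z - X z'| is only bounded by 1 / P n. Hence the growth
  hypothesis compares the ratio at n + 2 with the base at n.\<close>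

lemma hausdorff_dim_digit_box:
  assumes Q: "basic_sequence Q"
    and ab: "\<And>n. n \<ge> 1 \<Longrightarrow> 0 \<le> \<alpha> n \<and> \<alpha> n \<le> \<beta> n \<and> \<beta> n \<le> Q n - 1"
    and ab': "\<And>n. n \<ge> n0 \<Longrightarrow> 1 \<le> \<alpha> n \<and> \<alpha> n < \<beta> n \<and> \<beta> n \<le> Q n - 2"
    and growth: "\<And>\<epsilon>. \<epsilon> > 0 \<Longrightarrow> \<forall>\<^sub>F n in sequentially.
      of_int (Q (n + 2)) / of_int (\<beta> (n + 2) - \<alpha> (n + 2) + 1) \<le> real_of_int (Q n) powr \<epsilon>"
  shows "hausdorff_dim (digit_box Q \<alpha> \<beta>) = 1"
proof (rule antisym)
  show "hausdorff_dim (digit_box Q \<alpha> \<beta>) \<le> 1"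
    by (rule hausdorff_dim_le_1) (auto simp: digit_box_def)
  interpret cantor_base Q by (rule cantor_base.intro[OF Q])
  \<comment> \<open>Below n0 only the single digit \<alpha> n is used. There N is 1, so N is not a
    basic sequence, but its maps \<open>cantor_T N\<close> still obey
    \<open>cantor_T_Suc\<close>.\<close>
  define N where "N n = (if n < n0 then 1 else \<beta> n - \<alpha> n + 1)" for n
  define PN where "PN = cantor_prod N"
  define S where "S z n = cantor_T N n z" for z n
  define c where "c z n = (if n = 0 then 0 else \<lfloor>of_int (N n) * S z (n - 1)\<rfloor>)" for z n
  define d where "d z n = (if n = 0 then 0 else \<alpha> n + c z n)" for z n
  have N1: "N n \<ge> 1" if "n \<ge> 1" for n using ab[OF that] by (simp add: N_def)
  have N2: "N n \<ge> 2" if "n \<ge> n0" for n using ab'[OF that] that by (simp add: N_def)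
  have PN1: "PN n \<ge> 1" for n unfolding PN_def by (rule cantor_prod_ge_1[OF N1])
  then have PN0: "PN n > 0" for n using less_le_trans zero_less_one by blast
  have PNSuc: "PN (Suc n) = of_int (N (Suc n)) * PN n" for n by (simp add: PN_def cantor_prod_Suc)
  have S_bounds: "0 \<le> S z n" "S z n < 1" for z n by (auto simp: S_def cantor_T_bounds)
  have S0: "S z 0 = z" if "z \<in> {0..<1}" for z
    using that by (simp only: S_def cantor_T_0)
  have S_Suc: "S z (Suc n) = of_int (N (Suc n)) * S z n - of_int (c z (Suc n))" for z n
    by (simp add: S_def c_def cantor_T_Suc)
  have c: "0 \<le> c z n \<and> c z n \<le> N n - 1" if n1: "n \<ge> 1" for z n
  proof -
    obtain m where m: "n = Suc m" using n1 by (cases n) auto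
    have "0 \<le> of_int (N n) * S z m" using N1[OF n1] S_bounds by simp
    moreover have "of_int (N n) * S z m < of_int (N n) * 1"
      using N1[OF n1] S_bounds by (intro mult_strict_left_mono) auto
    ultimately show ?thesis unfolding c_def m by simp linarith
  qed
  have d: "\<alpha> n \<le> d z n \<and> d z n \<le> \<beta> n" if "n \<ge> 1" for z n
    using c[OF that, of z] ab[OF that] that by (auto simp: d_def N_def split: if_splits)
  have ex: "\<exists>x\<in>{0..<1}. is_cantor_expansion Q x (d z)" for z
  proof (rule expansion_of_digits)
    show "d z 0 = 0" by (simp add: d_def)
    show "0 \<le> d z n \<and> d z n \<le> Q n - 1" if "n \<ge> 1" for n using d[OF that, of z] ab[OF that] by auto
    have "{max 1 n0..} \<subseteq> {n. n \<ge> 1 \<and> d z n \<noteq> Q n - 1}"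
      using d[of _ z] ab' by force
    then show "infinite {n. n \<ge> 1 \<and> d z n \<noteq> Q n - 1}"
      using infinite_Ici infinite_super by blast
  qed
  then obtain X where X: "\<And>z. X z \<in> {0..<1}" "\<And>z. is_cantor_expansion Q (X z) (d z)" by metis
  have dig: "cantor_digit Q (X z) = d z" for z by (rule digit_unique[OF X(2)])
  define T where "T z n = cantor_T Q n (X z)" for z n
  have T_bounds: "0 \<le> T z n" "T z n < 1" for z n by (auto simp: T_def cantor_T_bounds)
  have T0: "T z 0 = X z" for z using X(1)[of z] by (simp only: T_def cantor_T_0)
  have T_Suc: "T z (Suc n) = of_int (Q (Suc n)) * T z n - of_int (d z (Suc n))" for z n
    by (simp add: T_def cantor_T_Suc digit_Suc[symmetric] dig)
  define K where "K n = real_of_int (Q n) / of_int (N n)" for n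
  have K1: "K n \<ge> 1" if "n \<ge> 1" for n
    using ab[OF that] N1[OF that] Q_ge_2[OF that] by (auto simp: K_def N_def)
  have S_le: "S z n \<le> K (Suc n) * T z n" if "Suc n \<ge> n0" for z n
  proof -
    have "of_int (N (Suc n)) * S z n \<le> of_int (Q (Suc n)) * T z n"
      using S_Suc[of z n] T_Suc[of z n] S_bounds(2)[of z "Suc n"] T_bounds(1)[of z "Suc n"] ab'[OF that]
      by (simp add: d_def)
    then show ?thesis using N2[OF that] by (simp add: K_def field_simps)
  qed
  have S_le': "1 - S z n \<le> K (Suc n) * (1 - T z n)" if "Suc n \<ge> n0" for z n
  proof -
    have "of_int (N (Suc n)) * (1 - S z n) = of_int (N (Suc n) - c z (Suc n)) - S z (Suc n)"
      using S_Suc[of z n] by (simp add: algebra_simps)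
    also have "\<dots> \<le> of_int (N (Suc n) - c z (Suc n))" using S_bounds by simp
    also have "\<dots> \<le> of_int (Q (Suc n) - 1 - d z (Suc n))"
      unfolding of_int_le_iff using that ab'[OF that] by (simp add: d_def N_def)
    also have "\<dots> \<le> of_int (Q (Suc n)) * (1 - T z n)"
      using T_Suc[of z n] T_bounds(2)[of z "Suc n"] by (simp add: algebra_simps)
    finally show ?thesis using N2[OF that] by (simp add: K_def field_simps)
  qed
  text \<open>At the first differing digit, the margins \<open>\<alpha> \<ge> 1\<close> and \<open>\<beta> \<le> Q - 2\<close> bound the tails of the \<open>N\<close>-expansion
    (and their distances to \<open>1\<close>) by multiples of those of the \<open>Q\<close>-expansion.\<close>
  have key: "\<exists>n. \<bar>z - z'\<bar> \<le> K (n + 2) * (P (n + 1) / PN (n + 1)) * \<bar>X z - X z'\<bar>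
      \<and> P n * \<bar>X z - X z'\<bar> \<le> 1 \<and> n + 1 \<ge> n0"
    if z: "z \<in> {0..<1}" and z': "z' \<in> {0..<1}" and ne: "z \<noteq> z'" for z z'
  proof -
    have agreeS: "S z n - S z' n = PN n * (z - z')" if "\<forall>i\<le>n. c z i = c z' i" for n
      using that
    proof (induction n)
      case 0 then show ?case by (simp add: S0[OF z] S0[OF z'] PN_def)
    next
      case (Suc n)
      then have "S z (Suc n) - S z' (Suc n) = of_int (N (Suc n)) * (S z n - S z' n)"
        by (simp add: S_Suc algebra_simps)
      then show ?case using Suc by (simp add: PNSuc)
    qed
    have agreeT: "T z n - T z' n = P n * (X z - X z')" if "\<forall>i\<le>n. c z i = c z' i" for n
      using that
    proof (induction n)
      case 0 then show ?case by (simp add: T0 cantor_prod_0)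
    next
      case (Suc n)
      then have "T z (Suc n) - T z' (Suc n) = of_int (Q (Suc n)) * (T z n - T z' n)"
        by (simp add: T_Suc d_def algebra_simps)
      then show ?case using Suc by (simp add: cantor_prod_Suc)
    qed
    \<comment> \<open>Equal digits keep S z n - S z' n equal to PN n (z - z'), which is at most 1 in
      absolute value although PN grows geometrically beyond n0.\<close>
    have "\<exists>n. c z n \<noteq> c z' n"
    proof (rule ccontr)
      assume all: "\<not> (\<exists>n. c z n \<noteq> c z' n)"
      have eq: "PN n * \<bar>z - z'\<bar> \<le> 1" for n
      proof -
        have "PN n * \<bar>z - z'\<bar> = \<bar>S z n - S z' n\<bar>"
          using all PN0[of n] by (subst agreeS) (auto simp: abs_mult)
        then show ?thesis using S_bounds[of z n] S_bounds[of z' n] by linarith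
      qed
      have "PN (i + n0) \<ge> 2 ^ i" for i
      proof (induction i)
        case 0 show ?case using PN1 by simp
      next
        case (Suc i)
        have "real_of_int (N (Suc (i + n0))) \<ge> 2" using N2[of "Suc (i + n0)"] by linarith
        then have "2 * 2 ^ i \<le> real_of_int (N (Suc (i + n0))) * PN (i + n0)"
          using Suc by (intro mult_mono) auto
        then show ?case by (simp add: PNSuc)
      qed
      then have *: "2 ^ i * \<bar>z - z'\<bar> \<le> 1" for i
        using eq[of "i + n0"] by (meson abs_ge_zero mult_right_mono order_trans)
      obtain i where "1 / \<bar>z - z'\<bar> < 2 ^ i" using real_arch_pow[of 2] by auto
      then have "1 < 2 ^ i * \<bar>z - z'\<bar>" using ne by (simp add: field_simps)
      with *[of i] show False by simp
    qed
    define k where "k = (LEAST n. c z n \<noteq> c z' n)"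
    have k: "c z k \<noteq> c z' k" unfolding k_def using \<open>\<exists>n. c z n \<noteq> c z' n\<close> by (rule LeastI_ex)
    have less: "c z i = c z' i" if "i < k" for i using not_less_Least[OF that[unfolded k_def]] by auto
    have "k \<noteq> 0" using k by (intro notI) (simp add: c_def)
    then obtain n where n: "k = Suc n" by (cases k) auto
    have "k \<ge> n0"
    proof (rule ccontr)
      assume "\<not> k \<ge> n0"
      then have "N k = 1" by (simp add: N_def)
      then show False using k c[of k z] c[of k z'] n by auto
    qed
    have agree: "\<forall>i\<le>n. c z i = c z' i" using less n by auto
    have eqS: "PN k * (z - z') = of_int (c z k - c z' k) + S z k - S z' k"
    proof -
      have "PN k * (z - z') = of_int (N (Suc n)) * (S z n - S z' n)"
        unfolding agreeS[OF agree] by (simp add: n PNSuc)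
      then show ?thesis by (simp add: n S_Suc algebra_simps)
    qed
    have eqT: "P k * (X z - X z') = of_int (c z k - c z' k) + T z k - T z' k"
    proof -
      have "P k * (X z - X z') = of_int (Q (Suc n)) * (T z n - T z' n)"
        unfolding agreeT[OF agree] by (simp add: n cantor_prod_Suc)
      then show ?thesis by (simp add: n T_Suc d_def algebra_simps)
    qed
    have Sk: "S w k \<le> K (Suc k) * T w k" "1 - S w k \<le> K (Suc k) * (1 - T w k)" for w
      using S_le[of k w] S_le'[of k w] \<open>k \<ge> n0\<close> by auto
    have main: "PN k * (z - z') \<le> K (Suc k) * (P k * (X z - X z')) \<and> 0 \<le> X z - X z' \<and> 0 \<le> z - z'"
      if gt: "c z k > c z' k" and eqS: "PN k * (z - z') = of_int (c z k - c z' k) + S z k - S z' k"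
        and eqT: "P k * (X z - X z') = of_int (c z k - c z' k) + T z k - T z' k" for z z'
    proof -
      \<comment> \<open>The digit difference is \<delta> + 1, and the 1 is absorbed into 1 - S z' k
        and 1 - T z' k. Both sides then consist of nonnegative terms that can be compared one by one
        with the factor K.\<close>
      define \<delta> where "\<delta> = real_of_int (c z k - c z' k - 1)"
      have \<delta>: "\<delta> \<ge> 0" using gt by (simp add: \<delta>_def)
      have "PN k * (z - z') = \<delta> + S z k + (1 - S z' k)" unfolding eqS \<delta>_def by simp
      also have "\<dots> \<le> K (Suc k) * \<delta> + K (Suc k) * T z k + K (Suc k) * (1 - T z' k)"
        using Sk(1)[of z] Sk(2)[of z'] \<delta> K1[of "Suc k"] mult_right_mono[of 1 "K (Suc k)" \<delta>] by simp
      also have "\<dots> = K (Suc k) * (\<delta> + T z k + (1 - T z' k))" by (simp add: algebra_simps)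
      also have "\<delta> + T z k + (1 - T z' k) = P k * (X z - X z')" unfolding eqT \<delta>_def by simp
      finally have 1: "PN k * (z - z') \<le> K (Suc k) * (P k * (X z - X z'))" .
      have "P k * (X z - X z') \<ge> 0" unfolding eqT using \<delta> T_bounds(1)[of z k] T_bounds(2)[of z' k]
        by (simp add: \<delta>_def)
      then have 2: "0 \<le> X z - X z'" using P_pos(1)[of k] by (simp add: zero_le_mult_iff)
      have "PN k * (z - z') \<ge> 0" unfolding eqS using \<delta> S_bounds(1)[of z k] S_bounds(2)[of z' k]
        by (simp add: \<delta>_def)
      then have "0 \<le> z - z'" using PN0[of k] by (simp add: zero_le_mult_iff)
      with 1 2 show ?thesis by simp
    qed
    have "PN k * \<bar>z - z'\<bar> \<le> K (Suc k) * (P k * \<bar>X z - X z'\<bar>)"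
    proof (cases "c z k > c z' k")
      case True
      then show ?thesis using main[OF True eqS eqT] by simp
    next
      case False
      then have lt: "c z' k > c z k" using k by simp
      have "PN k * (z' - z) = of_int (c z' k - c z k) + S z' k - S z k"
        "P k * (X z' - X z) = of_int (c z' k - c z k) + T z' k - T z k"
        using eqS eqT by (simp_all add: algebra_simps)
      from main[OF lt this] show ?thesis by simp
    qed
    then have "\<bar>z - z'\<bar> \<le> K (n + 2) * (P (n + 1) / PN (n + 1)) * \<bar>X z - X z'\<bar>"
      using PN0[of "Suc n"] by (simp add: n field_simps)
    moreover have "P n * \<bar>X z - X z'\<bar> \<le> 1"
    proof -
      have "P n * \<bar>X z - X z'\<bar> = \<bar>T z n - T z' n\<bar>"
        unfolding agreeT[OF agree] using P_pos(1)[of n] by (simp add: abs_mult)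
      also have "\<dots> \<le> 1" using T_bounds[of z n] T_bounds[of z' n] by linarith
      finally show ?thesis .
    qed
    ultimately show ?thesis using \<open>k \<ge> n0\<close> n by (intro exI[of _ n]) auto
  qed
  have prod_growth: "\<exists>C>0. \<forall>n. K (n + 2) * (P (n + 1) / PN (n + 1)) \<le> C * P n powr \<epsilon>" if \<epsilon>: "\<epsilon> > 0" for \<epsilon>
  proof -
    define R where "R n = K (n + 2) * (P (n + 1) / PN (n + 1))" for n
    have R0: "R n > 0" for n
      using K1[of "n + 2"] P_pos(1)[of "n + 1"] PN0[of "n + 1"] by (auto simp: R_def intro!: mult_pos_pos divide_pos_pos)
    have R_Suc: "R (Suc n) = K (Suc n + 2) * R n" for n
      by (simp add: R_def K_def cantor_prod_Suc PNSuc numeral_2_eq_2)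
    obtain L where L: "\<And>n. n \<ge> L \<Longrightarrow> of_int (Q (n + 2)) / of_int (\<beta> (n + 2) - \<alpha> (n + 2) + 1) \<le> of_int (Q n) powr \<epsilon>"
      using growth[OF \<epsilon>] unfolding eventually_sequentially by blast
    define L' where "L' = max L n0"
    \<comment> \<open>C covers the finitely many n before the growth bound starts. From there on a
      step multiplies R by at most Q^\<epsilon> and P^\<epsilon> by exactly Q^\<epsilon>.\<close>
    define C where "C = (\<Sum>n\<le>L'. R n)"
    have "C \<ge> R 0" unfolding C_def using R0 by (intro member_le_sum) (auto intro: less_imp_le)
    then have C0: "C > 0" using R0[of 0] by linarith
    have small: "R n \<le> C * P n powr \<epsilon>" if "n \<le> L'" for n
    proof -
      have "R n \<le> C" unfolding C_def using R0 that by (intro member_le_sum) (auto intro: less_imp_le)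
      also have "C * 1 \<le> C * P n powr \<epsilon>"
        using C0 P_ge_1[of n] \<epsilon> by (intro mult_left_mono ge_one_powr_ge_zero) auto
      finally show ?thesis by simp
    qed
    have large: "R n \<le> C * P n powr \<epsilon>" if "n \<ge> L'" for n using that
    proof (induction n rule: dec_induct)
      case base show ?case using small by simp
    next
      case (step n)
      have "K (Suc n + 2) \<le> of_int (Q (Suc n)) powr \<epsilon>"
        using L[of "Suc n"] step by (simp add: K_def N_def L'_def)
      then have "R (Suc n) \<le> of_int (Q (Suc n)) powr \<epsilon> * (C * P n powr \<epsilon>)"
        unfolding R_Suc using step R0[of n] by (intro mult_mono) (auto intro: less_imp_le)
      also have "\<dots> = C * P (Suc n) powr \<epsilon>"
        using P_pos(1)[of n] Q_ge_2[of "Suc n"] by (simp add: cantor_prod_Suc powr_mult)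
      finally show ?case .
    qed
    show ?thesis using C0 small large unfolding R_def by (metis nle_le)
  qed
  show "1 \<le> hausdorff_dim (digit_box Q \<alpha> \<beta>)"
  proof (rule hausdorff_dim_ge_1[where X = X])
    fix z :: real assume "z \<in> {0..<1}"
    show "X z \<in> digit_box Q \<alpha> \<beta>" using X(1) d by (simp add: dig digit_box_def)
  next
    fix s :: real assume s: "0 < s" "s < 1"
    obtain C where C: "C > 0"
      and CR: "\<And>n. K (n + 2) * (P (n + 1) / PN (n + 1)) \<le> C * P n powr (1 - s)"
      using prod_growth[of "1 - s"] s by auto
    have "\<bar>z - z'\<bar> \<le> C * \<bar>X z - X z'\<bar> powr s" if z: "z \<in> {0..<1}" "z' \<in> {0..<1}" for z z'
    proof (cases "z = z'")
      case True then show ?thesis using C by simp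
    next
      case False
      define y where "y = \<bar>X z - X z'\<bar>"
      obtain n where n: "\<bar>z - z'\<bar> \<le> K (n + 2) * (P (n + 1) / PN (n + 1)) * y" "P n * y \<le> 1"
        using key[OF z False] by (auto simp: y_def)
      have "y \<noteq> 0" using n(1) False by auto
      then have y: "y > 0" by (simp add: y_def)
      have "\<bar>z - z'\<bar> \<le> C * P n powr (1 - s) * y"
        using n(1) mult_right_mono[OF CR[of n], of y] y by linarith
      \<comment> \<open>\<open>P n * y <= 1\<close> trades the power of \<open>P n\<close> for a
        negative power of the distance y itself, which leaves the exponent s.\<close>
      also have "\<dots> \<le> C * (1 / y) powr (1 - s) * y"
        using C y n(2) P_pos(1)[of n] s by (intro mult_right_mono mult_left_mono powr_mono2) (auto simp: field_simps)
      also have "\<dots> = C * y powr s"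
        using y by (simp add: powr_divide powr_diff)
      finally show ?thesis by (simp add: y_def)
    qed
    then show "\<exists>C>0. \<forall>z\<in>{0..<1}. \<forall>z'\<in>{0..<1}. \<bar>z - z'\<bar> \<le> C * \<bar>X z - X z'\<bar> powr s"
      using C by blast
  qed
qed

section \<open>Sparsely intersecting polynomials\<close>

lemma int_poly_eventually_ge:
  fixes p :: "int poly"
  assumes "degree p > 0" "lead_coeff p > 0"
  shows "\<forall>\<^sub>F j in sequentially. poly p (int j) \<ge> L"
  using assms
proof (induction p arbitrary: L)
  case (pCons a r)
  have "r \<noteq> 0" using pCons.prems by auto
  have lr: "lead_coeff r > 0" using pCons.prems \<open>r \<noteq> 0\<close> by simp
  have "\<forall>\<^sub>F j in sequentially. poly r (int j) \<ge> 1"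
  proof (cases "degree r = 0")
    case True
    then obtain c where "r = [:c:]" by (metis degree_eq_zeroE)
    then show ?thesis using lr by simp
  qed (use pCons.IH[of 1] lr in auto)
  moreover have "\<forall>\<^sub>F j in sequentially. int j \<ge> \<bar>L - a\<bar>"
    using eventually_ge_at_top[of "nat \<bar>L - a\<bar>"] by eventually_elim auto
  ultimately show ?case
  proof eventually_elim
    case (elim j)
    have "\<bar>L - a\<bar> * 1 \<le> int j * poly r (int j)" using elim by (intro mult_mono) auto
    then show ?case by simp
  qed
qed simp

text \<open>For p = a + X r the difference at j is j times the difference of r plus r(j + 1). The
  first summand is eventually nonnegative by induction, the second unbounded unless r is constant;
  so the gaps are unbounded from degree 2 on, which is the dividing line between the two kinds of
  polynomials.\<close>

lemma int_poly_eventually_diff_ge: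
  fixes p :: "int poly"
  assumes "degree p > 0" "lead_coeff p > 0"
  shows "\<forall>\<^sub>F j in sequentially. poly p (int (Suc j)) - poly p (int j) \<ge> 1"
    and "degree p \<ge> 2 \<Longrightarrow> \<forall>\<^sub>F j in sequentially. poly p (int (Suc j)) - poly p (int j) \<ge> L"
proof -
  have "(\<forall>\<^sub>F j in sequentially. poly p (int (Suc j)) - poly p (int j) \<ge> 1) \<and>
    (degree p \<ge> 2 \<longrightarrow> (\<forall>\<^sub>F j in sequentially. poly p (int (Suc j)) - poly p (int j) \<ge> L))"
    using assms
  proof (induction p arbitrary: L)
    case (pCons a r)
    have "r \<noteq> 0" using pCons.prems by auto
    have lr: "lead_coeff r > 0" using pCons.prems \<open>r \<noteq> 0\<close> by simp
    have diff: "poly (pCons a r) (int (Suc j)) - poly (pCons a r) (int j) =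
        int j * (poly r (int (Suc j)) - poly r (int j)) + poly r (int (Suc j))" for j
      by (simp add: algebra_simps)
    show ?case
    proof (cases "degree r = 0")
      case True
      then obtain c where c: "r = [:c:]" by (metis degree_eq_zeroE)
      then show ?thesis using lr by (simp add: algebra_simps)
    next
      case False
      have *: "\<forall>\<^sub>F j in sequentially. poly (pCons a r) (int (Suc j)) - poly (pCons a r) (int j) \<ge> M" for M
      proof -
        have "\<forall>\<^sub>F j in sequentially. poly r (int (Suc j)) \<ge> M"
          using int_poly_eventually_ge[of r M] False lr
          by (subst eventually_sequentially_Suc[where P = "\<lambda>j. poly r (int j) \<ge> M"]) simp
        moreover have "\<forall>\<^sub>F j in sequentially. poly r (int (Suc j)) - poly r (int j) \<ge> 1"
          using pCons.IH False lr by blast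
        ultimately show ?thesis
        proof eventually_elim
          case (elim j)
          have "0 \<le> int j * (poly r (int (Suc j)) - poly r (int j))"
            using elim by (intro mult_nonneg_nonneg) auto
          with elim show ?case unfolding diff by linarith
        qed
      qed
      then show ?thesis by blast
    qed
  qed simp
  then show "\<forall>\<^sub>F j in sequentially. poly p (int (Suc j)) - poly p (int j) \<ge> 1"
    and "degree p \<ge> 2 \<Longrightarrow> \<forall>\<^sub>F j in sequentially. poly p (int (Suc j)) - poly p (int j) \<ge> L"
    by blast+
qed

lemma int_poly_gap_growth:
  fixes p :: "int poly"
  assumes "\<And>j. j \<ge> J \<Longrightarrow> poly p (int (Suc j)) - poly p (int j) \<ge> G" "i \<le> j" "J \<le> i"
  shows "poly p (int j) \<ge> poly p (int i) + G * int (j - i)"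
  using assms(2)
proof (induction j rule: dec_induct)
  case (step n)
  then show ?case using assms(1)[of n] assms(3) by (simp add: Suc_diff_le algebra_simps)
qed simp

section \<open>Relative densities and the relation \<open>poly_lesssim\<close>\<close>

lemma rel_density_bounds: "0 \<le> rel_density p q s n" "rel_density p q s n \<le> 1"
proof -
  have "real a / real b \<le> 1" if "a \<le> b" for a b :: nat using that by (cases "b = 0") auto
  moreover have "card (poly_values p \<inter> poly_values q \<inter> {s..n}) \<le> card (poly_values q \<inter> {s..n})"
    by (intro card_mono) auto
  ultimately show "0 \<le> rel_density p q s n" "rel_density p q s n \<le> 1"
    by (auto simp: rel_density_def)
qed

lemma windows_nonempty: "windows L \<noteq> {}"
proof -
  have "(1, int L + 2) \<in> windows L" by (simp add: windows_def)
  then show ?thesis by blast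
qed

lemma bdd_above_rel_density: "bdd_above ((\<lambda>(s, n). rel_density p q s n) ` windows L)"
  by (rule bdd_aboveI[of _ 1]) (auto simp: rel_density_bounds)

text \<open>\<open>lim\<close> says nothing about divergent sequences, so convergence comes first:
  the windows shrink with L, hence the suprema decrease, and they are nonnegative.\<close>

lemma SUP_rel_density_tendsto:
  "(\<lambda>L. SUP (s, n)\<in>windows L. rel_density p q s n) \<longlonglongrightarrow> lim (\<lambda>L. SUP (s, n)\<in>windows L. rel_density p q s n)"
proof -
  let ?D = "\<lambda>L. SUP (s, n)\<in>windows L. rel_density p q s n"
  have "antimono ?D"
  proof (rule antimonoI)
    fix L M :: nat assume "L \<le> M"
    then have "windows M \<subseteq> windows L" by (auto simp: windows_def)
    then show "?D M \<le> ?D L"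
      by (intro cSUP_subset_mono windows_nonempty bdd_above_rel_density) auto
  qed
  moreover have "?D L \<ge> 0" for L
  proof -
    obtain w where w: "w \<in> windows L" using windows_nonempty by blast
    have "0 \<le> (case w of (s, n) \<Rightarrow> rel_density p q s n)" by (auto simp: rel_density_bounds split: prod.split)
    also have "\<dots> \<le> ?D L" by (intro cSUP_upper w bdd_above_rel_density)
    finally show ?thesis .
  qed
  ultimately have "convergent ?D" using decseq_convergent[of ?D 0] by (metis convergentI)
  then show ?thesis by (simp add: convergent_LIMSEQ_iff)
qed

lemma poly_lesssimI:
  assumes "c > 0" "\<And>L. \<exists>(s, n)\<in>windows L. rel_density p q s n \<ge> c"
  shows "poly_lesssim q p"
proof -
  have "c \<le> (SUP (s, n)\<in>windows L. rel_density p q s n)" for L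
  proof -
    obtain w where w: "w \<in> windows L" "c \<le> (case w of (s, n) \<Rightarrow> rel_density p q s n)"
      using assms(2)[of L] by auto
    note w(2)
    also have "\<dots> \<le> (SUP (s, n)\<in>windows L. rel_density p q s n)"
      by (intro cSUP_upper w(1) bdd_above_rel_density)
    finally show ?thesis .
  qed
  then have "c \<le> lim (\<lambda>L. SUP (s, n)\<in>windows L. rel_density p q s n)"
    by (intro LIMSEQ_le_const[OF SUP_rel_density_tendsto]) auto
  then show ?thesis using assms(1) by (simp add: poly_lesssim_def)
qed

lemma not_poly_lesssimI:
  assumes "\<And>\<epsilon>. \<epsilon> > 0 \<Longrightarrow> \<exists>L0. \<forall>(s, n)\<in>windows L0. rel_density p q s n \<le> \<epsilon>"
  shows "\<not> poly_lesssim q p"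
proof -
  have "lim (\<lambda>L. SUP (s, n)\<in>windows L. rel_density p q s n) \<le> 0 + \<epsilon>" if \<epsilon>: "\<epsilon> > 0" for \<epsilon>
  proof -
    obtain L0 where L0: "\<And>s n. (s, n) \<in> windows L0 \<Longrightarrow> rel_density p q s n \<le> \<epsilon>"
      using assms[OF \<epsilon>] by auto
    have "(SUP (s, n)\<in>windows L. rel_density p q s n) \<le> \<epsilon>" if "L \<ge> L0" for L
    proof -
      have "windows L \<subseteq> windows L0" using that by (auto simp: windows_def)
      then show ?thesis using L0 by (intro cSUP_least windows_nonempty) auto
    qed
    then show ?thesis by (intro LIMSEQ_le_const2[OF SUP_rel_density_tendsto]) auto
  qed
  then have "lim (\<lambda>L. SUP (s, n)\<in>windows L. rel_density p q s n) \<le> 0" by (rule field_le_epsilon)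
  then show ?thesis by (simp add: poly_lesssim_def)
qed

lemma infinite_poly_values_Ici:
  assumes "degree p > 0" "lead_coeff p > 0"
  shows "infinite (poly_values p \<inter> {v..})"
proof
  assume "finite (poly_values p \<inter> {v..})"
  then obtain B where B: "\<And>w. w \<in> poly_values p \<inter> {v..} \<Longrightarrow> w \<le> B"
    by (meson bdd_above.unfold bdd_above_finite)
  have "\<forall>\<^sub>F j in sequentially. poly p (int j) \<ge> max v (B + 1) \<and> j \<ge> 1"
    using int_poly_eventually_ge[OF assms, of "max v (B + 1)"] eventually_ge_at_top[of 1]
    by eventually_elim auto
  then obtain j where j: "poly p (int j) \<ge> max v (B + 1)" "j \<ge> 1"
    using eventually_happens' sequentially_bot by blast
  then have "poly p (int j) \<in> poly_values p \<inter> {v..}" by (auto simp: poly_values_def)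
  then show False using B[of "poly p (int j)"] j by auto
qed

lemma finite_poly_values_atMost:
  assumes "degree p > 0" "lead_coeff p > 0"
  shows "finite (poly_values p \<inter> {..v})"
proof -
  obtain J where J: "\<And>j. j \<ge> J \<Longrightarrow> poly p (int j) \<ge> v + 1"
    using int_poly_eventually_ge[OF assms] unfolding eventually_sequentially by blast
  have "poly_values p \<inter> {..v} \<subseteq> (\<lambda>j. poly p (int j)) ` {..<J}"
  proof clarsimp
    fix w assume "w \<in> poly_values p" "w \<le> v"
    then obtain j where "w = poly p (int j)" by (auto simp: poly_values_def)
    then show "w \<in> (\<lambda>j. poly p (int j)) ` {..<J}" using J[of j] \<open>w \<le> v\<close> by force
  qed
  then show ?thesis by (rule finite_subset) simp
qed

lemma large_common_value:
  assumes "degree q > 0" "lead_coeff q > 0" "infinite (poly_values p \<inter> poly_values q)"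
  obtains v where "v \<in> poly_values p" "v \<in> poly_values q" "v > B"
proof -
  have "\<not> poly_values p \<inter> poly_values q \<subseteq> poly_values q \<inter> {..B}"
    using finite_poly_values_atMost[OF assms(1,2), of B] assms(3) finite_subset by blast
  then show ?thesis using that by force
qed

text \<open>A window with a common value starts at or below the bound B of the common values. If it
  is long as well, it contains \<open>K + 1\<close> fixed values of q beyond B, against at most C
  common values.\<close>

lemma not_poly_lesssim_finite_Int:
  assumes q: "degree q > 0" "lead_coeff q > 0" and fin: "finite (poly_values p \<inter> poly_values q)"
  shows "\<not> poly_lesssim q p"
proof (rule not_poly_lesssimI)
  fix \<epsilon> :: real assume \<epsilon>: "\<epsilon> > 0"
  define C where "C = card (poly_values p \<inter> poly_values q)"
  obtain B where B: "\<And>w. w \<in> poly_values p \<inter> poly_values q \<Longrightarrow> w \<le> B"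
    using fin by (meson bdd_above.unfold bdd_above_finite)
  obtain K :: nat where K: "real C / \<epsilon> < real K" using reals_Archimedean2 by blast
  obtain F where F: "finite F" "card F = Suc K" "F \<subseteq> poly_values q \<inter> {B..}"
    using infinite_arbitrarily_large[OF infinite_poly_values_Ici[OF q]] by blast
  define L0 where "L0 = nat (Max F)"
  show "\<exists>L0. \<forall>(s, n)\<in>windows L0. rel_density p q s n \<le> \<epsilon>"
  proof (intro exI[of _ L0] ballI, clarify)
    fix s n assume w: "(s, n) \<in> windows L0"
    show "rel_density p q s n \<le> \<epsilon>"
    proof (cases "poly_values p \<inter> poly_values q \<inter> {s..n} = {}")
      case True
      then show ?thesis using \<epsilon> by (simp add: rel_density_def)
    next
      case False
      then have "s \<le> B" using B by fastforce
      moreover have "Max F \<le> n" using w by (auto simp: windows_def L0_def split: if_splits)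
      ultimately have "F \<subseteq> poly_values q \<inter> {s..n}"
        using F(3) order_trans[OF Max_ge[OF F(1)], of _ n] by auto
      then have "Suc K \<le> card (poly_values q \<inter> {s..n})"
        using card_mono[of "poly_values q \<inter> {s..n}" F] F(2) by auto
      then have den: "real K < real (card (poly_values q \<inter> {s..n}))" by simp
      have num: "card (poly_values p \<inter> poly_values q \<inter> {s..n}) \<le> C"
        unfolding C_def by (intro card_mono fin) auto
      have "real C \<le> \<epsilon> * real K" using K \<epsilon> by (simp add: field_simps)
      also have "\<dots> \<le> \<epsilon> * real (card (poly_values q \<inter> {s..n}))"
        using den \<epsilon> by (intro mult_left_mono) auto
      finally show ?thesis
        unfolding rel_density_def using num den by (subst pos_divide_le_eq) auto
    qed
  qed
qed

text \<open>The gaps of q eventually exceed any given window length, so the window starting at a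
  large common value contains no other value of q: its relative density is 1.\<close>

lemma poly_lesssim_infinite_Int:
  assumes q: "degree q \<ge> 2" "lead_coeff q > 0" and inf: "infinite (poly_values p \<inter> poly_values q)"
  shows "poly_lesssim q p"
proof (rule poly_lesssimI[of 1])
  fix L
  have "degree q > 0" using q by auto
  note ev = int_poly_eventually_diff_ge(2)[OF \<open>degree q > 0\<close> q(2,1), of "int L + 2"]
  obtain J where J: "\<And>j. j \<ge> J \<Longrightarrow> poly q (int (Suc j)) - poly q (int j) \<ge> int L + 2"
    using ev unfolding eventually_sequentially by blast
  \<comment> \<open>Nothing is known about gaps before J, and a value above B is taken only beyond
    J. B >= 0 makes the window start at a positive position.\<close>
  define B where "B = Max (insert 0 ((\<lambda>i. poly q (int i)) ` {..J}))"
  have B: "0 \<le> B" "\<And>i. i \<le> J \<Longrightarrow> poly q (int i) \<le> B" 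
    unfolding B_def by (rule Max_ge; simp)+
  have gap: "poly q (int j) \<ge> poly q (int i) + (int L + 2) * int (j - i)" if "J \<le> i" "i \<le> j" for i j
    using int_poly_gap_growth[OF J that(2,1)] by blast
  obtain v where v: "v \<in> poly_values p" "v \<in> poly_values q" "v > B"
    using large_common_value[OF \<open>degree q > 0\<close> q(2) inf] by blast
  obtain j where j: "v = poly q (int j)" using v(2) by (auto simp: poly_values_def)
  have jJ: "j > J" using B(2)[of j] v(3) j by (cases "j \<le> J") auto
  have only: "poly_values q \<inter> {v..v + int L + 1} = {v}"
  proof (intro equalityI subsetI)
    fix w assume w: "w \<in> poly_values q \<inter> {v..v + int L + 1}"
    then obtain i where i: "w = poly q (int i)" by (auto simp: poly_values_def)
    have "i > J" using B(2)[of i] w v(3) i by (cases "i \<le> J") auto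
    consider "i < j" | "i = j" | "i > j" by linarith
    then show "w \<in> {v}"
    proof cases
      case 1
      have "poly q (int i) < poly q (int i) + (int L + 2) * 1" by simp
      also have "\<dots> \<le> poly q (int i) + (int L + 2) * int (j - i)"
        using 1 by (intro add_left_mono mult_left_mono) auto
      also have "\<dots> \<le> v" unfolding j by (rule gap) (use 1 \<open>i > J\<close> in auto)
      finally have "poly q (int i) < v" .
      then show ?thesis using w i by auto
    next
      case 3
      have "v + (int L + 2) * 1 \<le> v + (int L + 2) * int (i - j)"
        using 3 by (intro add_left_mono mult_left_mono) auto
      also have "\<dots> \<le> poly q (int i)" unfolding j by (rule gap) (use 3 jJ in auto)
      finally have "poly q (int i) \<ge> v + int L + 2" by simp
      then show ?thesis using w i by auto
    qed (use i j in simp)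
  qed (use v in auto)
  have "poly_values p \<inter> poly_values q \<inter> {v..v + int L + 1} = {v}" using only v(1) by blast
  then have "rel_density p q v (v + int L + 1) = 1" by (simp add: rel_density_def only)
  moreover have "(v, v + int L + 1) \<in> windows L" using v B by (simp add: windows_def)
  ultimately show "\<exists>(s, n)\<in>windows L. rel_density p q s n \<ge> 1" by force
qed simp

text \<open>One common value generates a progression of common values whose difference e c is the
  product of the slopes, so about one in e c positions is common.\<close>

lemma poly_lesssim_linear_Int:
  assumes p: "degree p = 1" "lead_coeff p > 0" and q: "degree q = 1" "lead_coeff q > 0"
    and inf: "infinite (poly_values p \<inter> poly_values q)"
  shows "poly_lesssim q p"
proof -
  obtain a e where pe: "p = [:a, e:]" using p(1) degree1_coeffs by blast
  obtain b c where qc: "q = [:b, c:]" using q(1) degree1_coeffs by blast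
  have e: "e > 0" and c: "c > 0" using p q pe qc by auto
  have "degree q > 0" using q by simp
  then obtain v where v: "v \<in> poly_values p" "v \<in> poly_values q" "v > 0"
    using large_common_value[OF _ q(2) inf] by blast
  have prog: "v + e * c * int k \<in> poly_values p \<inter> poly_values q" for k
  proof -
    obtain i where i: "i \<ge> 1" "v = poly p (int i)" using v(1) by (auto simp: poly_values_def)
    obtain j where j: "j \<ge> 1" "v = poly q (int j)" using v(2) by (auto simp: poly_values_def)
    have 1: "v + e * c * int k = poly p (int (i + nat c * k))"
      using c by (simp add: i(2) pe algebra_simps)
    have 2: "v + e * c * int k = poly q (int (j + nat e * k))"
      using e by (simp add: j(2) qc algebra_simps)
    have "i + nat c * k \<in> {1..}" "j + nat e * k \<in> {1..}" using i(1) j(1) by auto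
    then show ?thesis unfolding poly_values_def using 1 2 by blast
  qed
  have ec: "e * c \<ge> 1" using e c by (metis int_one_le_iff_zero_less zero_less_mult_iff)
  show ?thesis
  proof (rule poly_lesssimI)
    show "1 / real_of_int (e * c) > 0" using ec by (simp del: of_int_mult)
    fix L
    define n where "n = v + e * c * int (Suc L)"
    have "(\<lambda>k. v + e * c * int k) ` {..Suc L} \<subseteq> poly_values p \<inter> poly_values q \<inter> {v..n}"
    proof (clarify, intro IntI)
      fix k assume "k \<le> Suc L"
      show "v + e * c * int k \<in> poly_values p" "v + e * c * int k \<in> poly_values q" using prog by auto
      have "e * c * int k \<le> e * c * int (Suc L)" using \<open>k \<le> Suc L\<close> ec by (intro mult_left_mono) auto
      then show "v + e * c * int k \<in> {v..n}" using ec by (simp add: n_def)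
    qed
    then have "card ((\<lambda>k. v + e * c * int k) ` {..Suc L}) \<le> card (poly_values p \<inter> poly_values q \<inter> {v..n})"
      by (intro card_mono) auto
    also have "card ((\<lambda>k. v + e * c * int k) ` {..Suc L}) = Suc (Suc L)"
      using ec by (subst card_image) (auto simp: inj_on_def)
    finally have num: "Suc (Suc L) \<le> card (poly_values p \<inter> poly_values q \<inter> {v..n})" .
    also have "\<dots> \<le> card (poly_values q \<inter> {v..n})" by (intro card_mono) auto
    finally have pos: "0 < card (poly_values q \<inter> {v..n})" by simp
    have "card (poly_values q \<inter> {v..n}) \<le> card {v..n}" by (intro card_mono) auto
    also have "\<dots> = nat (e * c * int (Suc L) + 1)" using ec by (simp add: n_def)
    finally have "int (card (poly_values q \<inter> {v..n})) \<le> e * c * int (Suc L) + 1"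
      using ec by (simp add: nat_le_iff le_nat_iff)
    also have "\<dots> \<le> e * c * int (Suc (Suc L))" using ec by (simp add: algebra_simps)
    also have "\<dots> \<le> e * c * int (card (poly_values p \<inter> poly_values q \<inter> {v..n}))"
      using num ec by (intro mult_left_mono) auto
    finally have "real (card (poly_values q \<inter> {v..n})) \<le>
        real_of_int (e * c) * real (card (poly_values p \<inter> poly_values q \<inter> {v..n}))"
      by (metis of_int_le_iff of_int_mult of_int_of_nat_eq)
    then have "1 / real_of_int (e * c) \<le> rel_density p q v n"
      unfolding rel_density_def using ec pos by (simp add: field_simps del: of_int_mult)
    moreover have "(v, n) \<in> windows L"
    proof -
      have "1 * int (Suc L) \<le> e * c * int (Suc L)" using ec by (intro mult_right_mono) auto
      then have "int L < e * c * int (Suc L)" by (rule less_le_trans[rotated]) simp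
      then show ?thesis using v(3) by (simp add: windows_def n_def)
    qed
    ultimately show "\<exists>(s, n)\<in>windows L. rel_density p q s n \<ge> 1 / real_of_int (e * c)" by force
  qed
qed

text \<open>Within a degree class (\<open>1\<close>, or at least \<open>2\<close>) the relation \<^const>\<open>poly_lesssim\<close> is symmetric, hence
  a sparsely intersecting set has at most one member in each class.\<close>

lemma sparsely_intersecting_subset_pair:
  assumes P: "sparsely_intersecting P" and pos: "\<forall>p\<in>P. degree p > 0 \<and> lead_coeff p > 0"
  shows "\<exists>p l. degree p \<ge> 2 \<and> lead_coeff p > 0 \<and> degree l = 1 \<and> lead_coeff l > 0 \<and> P \<subseteq> {p, l}"
proof -
  have no: "\<not> poly_lnsim p q"
    if "p \<in> P" "q \<in> P" "degree p = 1 \<and> degree q = 1 \<or> degree p \<ge> 2 \<and> degree q \<ge> 2" for p q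
  proof (cases "finite (poly_values p \<inter> poly_values q)")
    case True
    then have "finite (poly_values q \<inter> poly_values p)" by (simp add: Int_commute)
    then have "\<not> poly_lesssim p q" using not_poly_lesssim_finite_Int[of p q] pos that by auto
    then show ?thesis by (simp add: poly_lnsim_def)
  next
    case False
    have "poly_lesssim q p"
      using that(3)
    proof
      assume "degree p = 1 \<and> degree q = 1"
      then show ?thesis using poly_lesssim_linear_Int[of p q] pos that False by blast
    next
      assume "degree p \<ge> 2 \<and> degree q \<ge> 2"
      then show ?thesis using poly_lesssim_infinite_Int[of q p] pos that False by blast
    qed
    then show ?thesis by (simp add: poly_lnsim_def)
  qed
  have eq: "p = q"
    if "p \<in> P" "q \<in> P" "degree p = 1 \<and> degree q = 1 \<or> degree p \<ge> 2 \<and> degree q \<ge> 2" for p q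
  proof (rule ccontr)
    assume "p \<noteq> q"
    then have "poly_lnsim p q \<or> poly_lnsim q p"
      using P that unfolding sparsely_intersecting_def by blast
    then show False using no[OF that] no[OF that(2,1)] that(3) by blast
  qed
  \<comment> \<open>If P has no member of a class, the monomial X^2 or X stands in, so that later
    there are always two sequences of positions to control.\<close>
  define p where "p = (if \<exists>p\<in>P. degree p \<ge> 2 then SOME p. p \<in> P \<and> degree p \<ge> 2 else monom 1 2)"
  define l where "l = (if \<exists>l\<in>P. degree l = 1 then SOME l. l \<in> P \<and> degree l = 1 else monom 1 1)"
  have p: "p \<in> P \<and> degree p \<ge> 2" if ex: "\<exists>p\<in>P. degree p \<ge> 2"
  proof -
    have "p = (SOME p. p \<in> P \<and> degree p \<ge> 2)" using ex by (simp only: p_def if_True)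
    then show ?thesis using someI_ex[of "\<lambda>p. p \<in> P \<and> degree p \<ge> 2"] ex by blast
  qed
  have l: "l \<in> P \<and> degree l = 1" if ex: "\<exists>l\<in>P. degree l = 1"
  proof -
    have "l = (SOME l. l \<in> P \<and> degree l = 1)" using ex by (simp only: l_def if_True)
    then show ?thesis using someI_ex[of "\<lambda>l. l \<in> P \<and> degree l = 1"] ex by blast
  qed
  have "r \<in> {p, l}" if r: "r \<in> P" for r
  proof (cases "degree r = 1")
    case True
    then show ?thesis using l r eq[of r l] by blast
  next
    case False
    moreover have "degree r > 0" using pos r by blast
    ultimately have "degree r \<ge> 2" by linarith
    then show ?thesis using p r eq[of r p] by blast
  qed
  moreover have "degree p \<ge> 2 \<and> lead_coeff p > 0"
  proof (cases "\<exists>p\<in>P. degree p \<ge> 2")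
    case True then show ?thesis using p pos by auto
  next
    case False then show ?thesis by (simp add: p_def degree_monom_eq)
  qed
  moreover have "degree l = 1 \<and> lead_coeff l > 0"
  proof (cases "\<exists>l\<in>P. degree l = 1")
    case True then show ?thesis using l pos by auto
  next
    case False then show ?thesis by (simp add: l_def degree_monom_eq)
  qed
  ultimately show ?thesis by blast
qed

section \<open>Collisions of the two polynomials have density zero\<close>

definition density_zero :: "nat set \<Rightarrow> bool" where
  "density_zero Z \<longleftrightarrow> (\<lambda>n. real (card {j. j < n \<and> j \<in> Z}) / real n) \<longlonglongrightarrow> 0"

text \<open>A collision u j = v i with J <= j < n forces v i <= C n. As v outgrows every linear
  function G i, only about C n / G indices i remain, and beyond J each i accounts for at most one
  j.\<close>

lemma density_zero_collisions:
  fixes u v :: "nat \<Rightarrow> nat"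
  assumes inj: "inj_on u {J..}" and u: "\<And>j. u j \<le> C * Suc j"
    and v: "\<And>G. \<exists>J. \<forall>i. G * (i - J) \<le> v i"
  shows "density_zero {j. \<exists>i. u j = v i}" (is "density_zero ?Z")
proof -
  define K where "K n = card {j. j < n \<and> j \<in> ?Z}" for n
  have bound: "\<exists>B. \<forall>n. K n \<le> B + C * n div G" if G: "G \<ge> 1" for G
  proof -
    obtain J' where J': "\<And>i. G * (i - J') \<le> v i" using v by blast
    have "K n \<le> J + J' + 1 + C * n div G" for n
    proof -
      define A where "A = {j. J \<le> j \<and> j < n \<and> j \<in> ?Z}"
      define f where "f j = (SOME i. u j = v i)" for j
      have f: "u j = v (f j)" if "j \<in> A" for j
        unfolding f_def by (rule someI_ex) (use that in \<open>auto simp: A_def\<close>)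
      have "inj_on f A"
      proof (rule inj_onI)
        fix j k assume jk: "j \<in> A" "k \<in> A" "f j = f k"
        then have "u j = u k" by (simp add: f)
        then show "j = k" using inj jk by (auto simp: inj_on_def A_def)
      qed
      moreover have "f ` A \<subseteq> {..<J' + 1 + C * n div G}"
      proof (rule image_subsetI)
        fix j assume j: "j \<in> A"
        have "G * (f j - J') \<le> u j" unfolding f[OF j] by (rule J')
        also have "\<dots> \<le> C * Suc j" by (rule u)
        also have "\<dots> \<le> C * n" using j by (intro mult_left_mono) (auto simp: A_def)
        finally have "f j - J' \<le> C * n div G"
          using G by (subst less_eq_div_iff_mult_less_eq) (auto simp: mult.commute)
        then show "f j \<in> {..<J' + 1 + C * n div G}" by simp
      qed
      ultimately have "card A \<le> J' + 1 + C * n div G"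
        using card_inj_on_le[of f A "{..<J' + 1 + C * n div G}"] by simp
      moreover have "K n \<le> card ({..<J} \<union> A)"
        unfolding K_def by (intro card_mono) (auto simp: A_def)
      ultimately show ?thesis using card_Un_le[of "{..<J}" A] by simp
    qed
    then show ?thesis by blast
  qed
  have "(\<lambda>n. real (K n) / real n) \<longlonglongrightarrow> 0"
  proof (rule LIMSEQ_I)
    fix \<epsilon> :: real assume \<epsilon>: "\<epsilon> > 0"
    obtain G :: nat where G: "2 * real C / \<epsilon> < real G" using reals_Archimedean2 by blast
    have "0 \<le> 2 * real C / \<epsilon>" using \<epsilon> by simp
    then have G1: "G \<ge> 1" using G by (cases G) auto
    obtain B where B: "\<And>n. K n \<le> B + C * n div G" using bound[OF G1] by blast
    obtain M :: nat where M: "2 * real B / \<epsilon> < real M" using reals_Archimedean2 by blast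
    show "\<exists>no. \<forall>n\<ge>no. norm (real (K n) / real n - 0) < \<epsilon>"
    proof (intro exI[of _ "Suc M"] allI impI)
      fix n assume n: "n \<ge> Suc M"
      have "real (K n) \<le> real B + real (C * n div G)" using B[of n] by linarith
      also have "real (C * n div G) \<le> real (C * n) / real G"
        by (rule of_nat_div_le_of_nat)
      also have "\<dots> = real n * (real C / real G)" by simp
      also have "\<dots> \<le> real n * (\<epsilon> / 2)"
        using G \<epsilon> G1 by (intro mult_left_mono) (auto simp: field_simps)
      finally have 1: "real (K n) \<le> real B + real n * (\<epsilon> / 2)" by simp
      have "2 * real B < \<epsilon> * real M" using M \<epsilon> by (simp add: field_simps)
      also have "\<dots> \<le> \<epsilon> * real n" using n \<epsilon> by (intro mult_left_mono) auto
      finally have "real (K n) < \<epsilon> * real n" using 1 by (simp add: algebra_simps)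
      then show "norm (real (K n) / real n - 0) < \<epsilon>" using n by (simp add: field_simps)
    qed
  qed
  then show ?thesis by (simp add: K_def density_zero_def)
qed

lemma density_zero_poly_collisions:
  fixes p l :: "int poly"
  assumes p: "degree p \<ge> 2" "lead_coeff p > 0" and l: "degree l = 1" "lead_coeff l > 0"
  shows "density_zero {j. \<exists>i. nat (poly l (int j)) = nat (poly p (int i))}"
proof -
  obtain b c where lb: "l = [:b, c:]" using l(1) degree1_coeffs by blast
  have c: "c > 0" using l lb by auto
  have "degree p > 0" "degree l > 0" using p l by auto
  obtain J where J: "\<And>j. j \<ge> J \<Longrightarrow> poly l (int j) \<ge> 1"
    using int_poly_eventually_ge[OF \<open>degree l > 0\<close> l(2), of 1] unfolding eventually_sequentially by blast
  show ?thesis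
  proof (rule density_zero_collisions)
    show "inj_on (\<lambda>j. nat (poly l (int j))) {J..}"
    proof (rule inj_onI)
      fix j k assume "j \<in> {J..}" "k \<in> {J..}" "nat (poly l (int j)) = nat (poly l (int k))"
      then have "poly l (int j) = poly l (int k)" using J[of j] J[of k] by auto
      then show "j = k" using c by (simp add: lb)
    qed
    fix j :: nat
    have "poly l (int j) \<le> (\<bar>b\<bar> + c) * int (Suc j)"
    proof -
      have "\<bar>b\<bar> * 1 \<le> \<bar>b\<bar> * int (Suc j)" by (rule mult_left_mono) auto
      moreover have "c * int j \<le> c * int (Suc j)" using c by (intro mult_left_mono) auto
      moreover have "poly l (int j) = b + c * int j" by (simp add: lb)
      ultimately show ?thesis unfolding distrib_right by linarith
    qed
    then have "nat (poly l (int j)) \<le> nat ((\<bar>b\<bar> + c) * int (Suc j))" by (rule nat_mono)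
    also have "\<dots> = nat (\<bar>b\<bar> + c) * Suc j" using c by (simp only: nat_mult_distrib[of "\<bar>b\<bar> + c"] nat_int)
    finally show "nat (poly l (int j)) \<le> nat (\<bar>b\<bar> + c) * Suc j" .
  next
    fix G
    have "\<forall>\<^sub>F j in sequentially. poly p (int (Suc j)) - poly p (int j) \<ge> int G \<and> poly p (int j) \<ge> 0"
      using int_poly_eventually_diff_ge(2)[OF \<open>degree p > 0\<close> p(2,1), of "int G"]
        int_poly_eventually_ge[OF \<open>degree p > 0\<close> p(2), of 0] by eventually_elim auto
    then obtain J' where J': "\<And>j. j \<ge> J' \<Longrightarrow> poly p (int (Suc j)) - poly p (int j) \<ge> int G"
      "\<And>j. j \<ge> J' \<Longrightarrow> poly p (int j) \<ge> 0"
      unfolding eventually_sequentially by blast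
    have "G * (i - J') \<le> nat (poly p (int i))" for i
    proof (cases "i \<le> J'")
      case False
      have "poly p (int i) \<ge> poly p (int J') + int G * int (i - J')"
        by (rule int_poly_gap_growth[of J']) (use J'(1) False in auto)
      then have "int (G * (i - J')) \<le> poly p (int i)" using J'(2)[of J'] by simp
      then show ?thesis by (simp only: le_nat_iff)
    qed simp
    then show "\<exists>J. \<forall>i. G * (i - J) \<le> nat (poly p (int i))" by blast
  qed
qed

section \<open>Upper and lower limits of averages\<close>

lemma limsup_ereal_eqI:
  fixes u :: "nat \<Rightarrow> real"
  assumes "\<And>\<epsilon>. \<epsilon> > 0 \<Longrightarrow> \<forall>\<^sub>F n in sequentially. u n \<le> F + \<epsilon>"
    and "\<And>\<epsilon>. \<epsilon> > 0 \<Longrightarrow> \<exists>\<^sub>F n in sequentially. u n \<ge> F - \<epsilon>"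
  shows "limsup (\<lambda>n. ereal (u n)) = ereal F"
proof (rule antisym)
  show "limsup (\<lambda>n. ereal (u n)) \<le> ereal F"
  proof (rule ereal_le_epsilon2)
    fix e :: real assume "0 < e"
    then have "limsup (\<lambda>n. ereal (u n)) \<le> ereal (F + e)"
      by (intro Limsup_bounded eventually_mono[OF assms(1)]) auto
    then show "limsup (\<lambda>n. ereal (u n)) \<le> ereal F + ereal e" by simp
  qed
  show "ereal F \<le> limsup (\<lambda>n. ereal (u n))"
  proof (rule ereal_le_epsilon2)
    fix e :: real assume e: "0 < e"
    have "ereal (F - e) \<le> limsup (\<lambda>n. ereal (u n))"
    proof (rule ccontr)
      assume "\<not> ?thesis"
      then have "limsup (\<lambda>n. ereal (u n)) < ereal (F - e)" by simp
      from Limsup_lessD[OF this] have "\<forall>\<^sub>F n in sequentially. \<not> u n \<ge> F - e"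
        by (auto elim!: eventually_mono)
      then show False using assms(2)[OF e] by (simp add: frequently_def)
    qed
    then show "ereal F \<le> limsup (\<lambda>n. ereal (u n)) + ereal e"
      by (cases "limsup (\<lambda>n. ereal (u n))") auto
  qed
qed

text \<open>u is close to the mixture \<Theta> F + (1 - \<Theta>) (F - d): it stays below F up to
  o(1) and comes near F whenever \<Theta> comes near 1. Lower limits will follow by applying this to
  -u.\<close>

lemma limsup_mixture:
  fixes u \<Theta> :: "nat \<Rightarrow> real"
  assumes \<Theta>: "\<And>n. 0 \<le> \<Theta> n \<and> \<Theta> n \<le> 1" and d: "0 \<le> d" "d \<le> 1"
    and close: "\<And>\<epsilon>. \<epsilon> > 0 \<Longrightarrow> \<forall>\<^sub>F n in sequentially. \<bar>u n - (F - (1 - \<Theta> n) * d)\<bar> \<le> \<epsilon>"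
    and freq: "\<And>\<epsilon>. \<epsilon> > 0 \<Longrightarrow> \<exists>\<^sub>F n in sequentially. \<bar>\<Theta> n - 1\<bar> \<le> \<epsilon>"
  shows "limsup (\<lambda>n. ereal (u n)) = ereal F"
proof (rule limsup_ereal_eqI)
  fix \<epsilon> :: real assume \<epsilon>: "\<epsilon> > 0"
  have bounds: "0 \<le> (1 - \<Theta> n) * d" "(1 - \<Theta> n) * d \<le> \<bar>\<Theta> n - 1\<bar>" for n
    using \<Theta>[of n] d mult_left_mono[of d 1 "1 - \<Theta> n"] by auto
  show "\<forall>\<^sub>F n in sequentially. u n \<le> F + \<epsilon>"
    using close[OF \<epsilon>]
  proof eventually_elim
    case (elim n)
    then show ?case using bounds(1)[of n] by linarith
  qed
  have "\<epsilon> / 2 > 0" using \<epsilon> by simp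
  from frequently_eventually_frequently[OF freq[OF this] close[OF this]]
  show "\<exists>\<^sub>F n in sequentially. F - \<epsilon> \<le> u n"
  proof (rule frequently_elim1, elim conjE)
    fix n assume "\<bar>\<Theta> n - 1\<bar> \<le> \<epsilon> / 2" "\<bar>u n - (F - (1 - \<Theta> n) * d)\<bar> \<le> \<epsilon> / 2"
    then show "F - \<epsilon> \<le> u n" using bounds(2)[of n] by linarith
  qed
qed

lemma liminf_ereal_eq_uminus_limsup:
  fixes u :: "nat \<Rightarrow> real"
  assumes "limsup (\<lambda>n. ereal (- u n)) = ereal (- F)"
  shows "liminf (\<lambda>n. ereal (u n)) = ereal F"
proof -
  have "limsup (\<lambda>n. - ereal (u n)) = - ereal F" using assms by simp
  then show ?thesis unfolding ereal_Limsup_uminus by (metis ereal_uminus_eq_iff)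
qed

text \<open>Complete chunks contribute little by hypothesis, and the one incomplete chunk at the end
  is short compared with what precedes it.\<close>

lemma average_tendsto_0_of_chunks:
  fixes e :: "nat \<Rightarrow> real" and a len :: "nat \<Rightarrow> nat"
  assumes bound: "\<And>j. \<bar>e j\<bar> \<le> C"
    and a: "\<And>l. a (Suc l) = a l + len l" "\<And>l. len l > 0"
    and chunk: "\<And>\<eta>. \<eta> > 0 \<Longrightarrow> \<forall>\<^sub>F l in sequentially. \<bar>\<Sum>j=a l..<a (Suc l). e j\<bar> \<le> \<eta> * real (len l)"
    and short: "\<And>\<eta>. \<eta> > 0 \<Longrightarrow> \<forall>\<^sub>F l in sequentially. real (len l) \<le> \<eta> * real (a l)"
  shows "(\<lambda>n. (\<Sum>j<n. e j) / real n) \<longlonglongrightarrow> 0"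
proof (rule LIMSEQ_I)
  fix \<epsilon> :: real assume \<epsilon>: "\<epsilon> > 0"
  have C: "C \<ge> 0" using bound[of 0] by linarith
  \<comment> \<open>Complete chunks and the incomplete one get \<epsilon>/4 each, the fixed initial
    error D the remaining half. C + 1 in place of C avoids division by 0.\<close>
  define \<eta> where "\<eta> = \<epsilon> / 4"
  define \<eta>' where "\<eta>' = \<epsilon> / (4 * (C + 1))"
  have \<eta>: "\<eta> > 0" "\<eta>' > 0" using \<epsilon> C by (auto simp: \<eta>_def \<eta>'_def)
  have "\<forall>\<^sub>F l in sequentially. \<bar>\<Sum>j=a l..<a (Suc l). e j\<bar> \<le> \<eta> * real (len l) \<and> real (len l) \<le> \<eta>' * real (a l)"
    using chunk[OF \<eta>(1)] short[OF \<eta>(2)] by (rule eventually_conj)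
  then obtain L where L: "\<And>l. l \<ge> L \<Longrightarrow> \<bar>\<Sum>j=a l..<a (Suc l). e j\<bar> \<le> \<eta> * real (len l)"
    "\<And>l. l \<ge> L \<Longrightarrow> real (len l) \<le> \<eta>' * real (a l)"
    unfolding eventually_sequentially by blast
  define D where "D = \<bar>\<Sum>j<a L. e j\<bar>"
  have split: "(\<Sum>j<n. e j) = (\<Sum>j<k. e j) + (\<Sum>j=k..<n. e j)" if "k \<le> n" for k n
    using sum.union_disjoint[of "{..<k}" "{k..<n}" e] that by (simp add: ivl_disj_un ivl_disj_int)
  have mono: "a l \<le> a (Suc l)" for l using a by simp
  have starts: "\<bar>\<Sum>j<a l. e j\<bar> \<le> D + \<eta> * real (a l)" if "l \<ge> L" for l
    using that
  proof (induction l rule: dec_induct)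
    case base
    show ?case using \<eta> by (simp add: D_def)
  next
    case (step l)
    have "\<bar>\<Sum>j<a (Suc l). e j\<bar> \<le> \<bar>\<Sum>j<a l. e j\<bar> + \<bar>\<Sum>j=a l..<a (Suc l). e j\<bar>"
      unfolding split[OF mono] by linarith
    also have "\<dots> \<le> D + \<eta> * real (a l) + \<eta> * real (len l)" using step L(1)[of l] by linarith
    finally show ?case by (simp add: a algebra_simps)
  qed
  have "a l \<ge> l" for l by (induction l) (use a in \<open>auto simp: Suc_le_eq intro: le_less_trans less_le_trans\<close>)
  obtain M :: nat where M: "2 * D / \<epsilon> < real M" using reals_Archimedean2 by blast
  show "\<exists>no. \<forall>n\<ge>no. norm ((\<Sum>j<n. e j) / real n - 0) < \<epsilon>"
  proof (intro exI[of _ "Suc (M + a L)"] allI impI)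
    fix n assume n: "n \<ge> Suc (M + a L)"
    define l where "l = (LEAST l. n < a (Suc l))"
    have "n < a (Suc n)" using \<open>\<And>l. a l \<ge> l\<close>[of "Suc n"] by simp
    then have nl: "n < a (Suc l)" unfolding l_def by (rule LeastI)
    have lL: "l \<ge> L"
    proof (rule ccontr)
      assume "\<not> l \<ge> L"
      then have "a (Suc l) \<le> a L" using lift_Suc_mono_le[of a "Suc l" L] mono by simp
      then show False using nl n by simp
    qed
    have aln: "a l \<le> n"
    proof (cases "l = L")
      case False
      then obtain k where k: "l = Suc k" using lL by (cases l) auto
      have "\<not> n < a (Suc k)" using not_less_Least[of k "\<lambda>l. n < a (Suc l)"] k l_def by simp
      then show ?thesis using k by simp
    qed (use n in simp)
    have "\<bar>\<Sum>j=a l..<n. e j\<bar> \<le> (\<Sum>j=a l..<n. \<bar>e j\<bar>)" by (rule sum_abs)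
    also have "\<dots> \<le> (\<Sum>j=a l..<n. C)" by (intro sum_mono bound)
    also have "\<dots> = real (n - a l) * C" by simp
    also have "\<dots> \<le> real (len l) * C" using nl a C by (intro mult_right_mono) auto
    also have "\<dots> \<le> \<eta>' * real (a l) * C" using L(2)[OF lL] C by (intro mult_right_mono) auto
    also have "\<dots> \<le> \<eta>' * real n * (C + 1)" using aln C \<eta> by (intro mult_mono) auto
    also have "\<dots> = \<eta> * real n" using C by (simp add: \<eta>_def \<eta>'_def divide_simps)
    finally have tail: "\<bar>\<Sum>j=a l..<n. e j\<bar> \<le> \<eta> * real n" .
    have "\<bar>\<Sum>j<n. e j\<bar> \<le> D + \<eta> * real (a l) + \<eta> * real n"
      unfolding split[OF aln] using starts[OF lL] tail by linarith
    also have "\<eta> * real (a l) \<le> \<eta> * real n" using aln \<eta> by (intro mult_left_mono) auto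
    finally have 1: "\<bar>\<Sum>j<n. e j\<bar> \<le> D + \<epsilon> / 2 * real n" by (simp add: \<eta>_def)
    have "2 * D < \<epsilon> * real M" using M \<epsilon> by (simp add: field_simps)
    also have "\<dots> \<le> \<epsilon> * real n" using n \<epsilon> by (intro mult_left_mono) auto
    finally have "\<bar>\<Sum>j<n. e j\<bar> < \<epsilon> * real n" using 1 by linarith
    then show "norm ((\<Sum>j<n. e j) / real n - 0) < \<epsilon>" using n by (simp add: field_simps)
  qed
qed

section \<open>Approximating a linear family by digit intervals\<close>

text \<open>All approximated values are nonnegative, so natural numbers suffice. No computability is assumed
  here: every linear family has such an enumeration \<open>t\<close> and such approximations.\<close>

locale evaluable_family =
  fixes f :: "nat \<Rightarrow> nat \<Rightarrow> real \<Rightarrow> real" and t :: "nat \<Rightarrow> real"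
    and ft :: "nat \<Rightarrow> nat \<Rightarrow> nat" and h :: "nat \<Rightarrow> nat \<Rightarrow> nat \<Rightarrow> nat \<Rightarrow> nat"
  assumes linear: "linear_family f"
    and t_range: "n \<ge> 1 \<Longrightarrow> t n \<in> {0..1}"
    and rationals: "\<rat> \<inter> {0..1} \<subseteq> t ` {1..}"
    and discont: "m \<ge> 1 \<Longrightarrow> r < m \<Longrightarrow> discontinuities (f m r) \<subseteq> t ` {1..}"
    and ft: "k \<ge> 1 \<Longrightarrow> n \<ge> 1 \<Longrightarrow> real (ft k n) - 1 < real k * t n \<and> real k * t n < real (ft k n) + 1"
    and h: "k \<ge> 1 \<Longrightarrow> m \<ge> 1 \<Longrightarrow> r < m \<Longrightarrow> n \<ge> 1 \<Longrightarrow>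
      real (h k m r n) - 1 < real k * f m r (t n) \<and> real k * f m r (t n) < real (h k m r n) + 1"

text \<open>As far as the first \<open>s\<close> points can tell, \<open>[a/D, (a+1)/D]\<close> is an approximate \<open>(i+1)/(s+1)\<close>-quantile
  of \<open>f (fact s) r\<close>. Since each point lies strictly on one side of the interval and the values are only
  compared up to an error, a search with increasing \<open>D\<close> succeeds although real numbers cannot be compared
  effectively.\<close>

definition quantile_test ::
    "(nat \<Rightarrow> nat \<Rightarrow> nat) \<Rightarrow> (nat \<Rightarrow> nat \<Rightarrow> nat \<Rightarrow> nat \<Rightarrow> nat) \<Rightarrow> nat \<Rightarrow> nat \<Rightarrow> nat \<Rightarrow> nat \<Rightarrow> nat \<Rightarrow> bool" where
  "quantile_test ft h s r i D a \<longleftrightarrow> (\<forall>n<s.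
     (a + 1 < ft D (Suc n) \<and> i \<le> h (Suc s) (fact s) r (Suc n)) \<or>
     (ft D (Suc n) < a \<and> h (Suc s) (fact s) r (Suc n) \<le> i + 1))"

text \<open>With weight \<open>m\<close>, averages over all indices are averages along the indices \<open>m n + r\<close>.\<close>

definition hit_weight :: "nat \<Rightarrow> nat \<Rightarrow> real \<Rightarrow> (nat \<Rightarrow> real) \<Rightarrow> nat \<Rightarrow> real" where
  "hit_weight m r y w j = (if j mod m = r \<and> w j < y then real m else 0)"

context evaluable_family
begin

lemma adf: "m \<ge> 1 \<Longrightarrow> r < m \<Longrightarrow> is_adf (f m r)"
  using linear by (simp add: linear_family_def)

lemma adf_mono: "m \<ge> 1 \<Longrightarrow> r < m \<Longrightarrow> 0 \<le> x \<Longrightarrow> x \<le> y \<Longrightarrow> y \<le> 1 \<Longrightarrow> f m r x \<le> f m r y"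
  using adf[of m r] by (auto simp: is_adf_def mono_on_def)

lemma adf_range: "m \<ge> 1 \<Longrightarrow> r < m \<Longrightarrow> 0 \<le> x \<Longrightarrow> x \<le> 1 \<Longrightarrow> 0 \<le> f m r x \<and> f m r x \<le> 1"
  using adf[of m r] unfolding is_adf_def by (meson atLeastAtMost_iff image_subset_iff)

lemma adf_0_1: "m \<ge> 1 \<Longrightarrow> r < m \<Longrightarrow> f m r 0 = 0 \<and> f m r 1 = 1"
  using adf[of m r] by (auto simp: is_adf_def)

text \<open>Take the last point of X whose value lies below u and the first whose value is at least
  u. No tested point lies strictly between them, so a cell well inside this gap passes, and every
  fine enough D provides one.\<close>

lemma quantile_test_ex:
  assumes r: "r < fact s" and i: "i \<le> s"
  shows "\<forall>\<^sub>F D in sequentially. \<exists>a<D. quantile_test ft h s r i D a"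
proof -
  define F where "F = f (fact s) r"
  define u where "u = real (Suc i) / real (Suc s)"
  have u: "0 < u" "u \<le> 1" using i by (auto simp: u_def)
  \<comment> \<open>0 and 1 are added because F 0 = 0 < u <= 1 = F 1, which makes both of the
    following sets nonempty.\<close>
  define X where "X = insert 0 (insert 1 (t ` {1..s}))"
  define lo where "lo = Max {x \<in> X. F x < u}"
  define hi where "hi = Min {x \<in> X. F x \<ge> u}"
  have fs: "(fact s :: nat) \<ge> 1" by simp
  have F01: "F 0 = 0" "F 1 = 1" using adf_0_1[OF fs r] by (auto simp: F_def)
  have X01: "x \<in> X \<Longrightarrow> 0 \<le> x \<and> x \<le> 1" for x using t_range by (auto simp: X_def)
  have finX: "finite X" by (simp add: X_def)
  have lo_in: "lo \<in> {x \<in> X. F x < u}" unfolding lo_def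
    by (rule Max_in) (use finX F01 u in \<open>auto simp: X_def\<close>)
  have hi_in: "hi \<in> {x \<in> X. F x \<ge> u}" unfolding hi_def
    by (rule Min_in) (use finX F01 u in \<open>auto simp: X_def\<close>)
  have lohi: "lo < hi"
  proof (rule ccontr)
    assume "\<not> lo < hi"
    then have "F hi \<le> F lo" unfolding F_def
      using X01[of lo] X01[of hi] lo_in hi_in by (intro adf_mono[OF fs r]) auto
    then show False using lo_in hi_in by auto
  qed
  obtain K :: nat where K: "8 / (hi - lo) < real K" using reals_Archimedean2 by blast
  have main: "\<exists>a<D. quantile_test ft h s r i D a" if D: "D \<ge> Suc K" for D
  proof -
    \<comment> \<open>\<open>ft\<close> is wrong by less than 1. A cell that starts at least 2 and
      ends at most 4 above D lo clears the approximations on the left, which stay below D lo + 1,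
      and those on the right, which exceed D hi - 1 > D lo + 7.\<close>
    define a where "a = nat \<lfloor>real D * lo\<rfloor> + 3"
    have D1: "D \<ge> 1" using D by simp
    have "0 \<le> real D * lo" using X01[of lo] lo_in by simp
    then have a: "real D * lo + 2 \<le> real a" "real a \<le> real D * lo + 3"
    proof -
      have "real a = of_int \<lfloor>real D * lo\<rfloor> + 3" using \<open>0 \<le> real D * lo\<close> by (simp add: a_def)
      then show "real D * lo + 2 \<le> real a" "real a \<le> real D * lo + 3" by linarith+
    qed
    have "8 < real K * (hi - lo)" using K lohi by (simp add: field_simps)
    also have "\<dots> \<le> real D * (hi - lo)" using D lohi by (intro mult_right_mono) auto
    finally have gap: "real D * lo + 8 < real D * hi" by (simp add: algebra_simps)
    have "real D * hi \<le> real D * 1" using X01[of hi] hi_in by (intro mult_left_mono) auto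
    then have "real a < real D" using a gap by simp
    then have "a < D" by simp
    moreover have "quantile_test ft h s r i D a"
      unfolding quantile_test_def
    proof (intro allI impI)
      fix n assume n: "n < s"
      define x where "x = t (Suc n)"
      define H where "H = h (Suc s) (fact s) r (Suc n)"
      have xX: "x \<in> X" using n by (auto simp: X_def x_def)
      have ftx: "real (ft D (Suc n)) - 1 < real D * x" "real D * x < real (ft D (Suc n)) + 1"
        using ft[OF D1, of "Suc n"] by (auto simp: x_def)
      have Hx: "real H - 1 < real (Suc s) * F x" "real (Suc s) * F x < real H + 1"
        using h[of "Suc s" "fact s" r "Suc n"] r by (auto simp: H_def F_def x_def)
      have us: "real (Suc s) * u = real (Suc i)" by (simp add: u_def)
      show "(a + 1 < ft D (Suc n) \<and> i \<le> h (Suc s) (fact s) r (Suc n)) \<or>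
         (ft D (Suc n) < a \<and> h (Suc s) (fact s) r (Suc n) \<le> i + 1)"
      proof (cases "F x < u")
        case True
        then have "x \<le> lo" unfolding lo_def using xX finX by (intro Max_ge) auto
        then have "real D * x \<le> real D * lo" by (intro mult_left_mono) auto
        then have "ft D (Suc n) < a" using ftx a by linarith
        moreover have "real (Suc s) * F x < real (Suc s) * u" using True by simp
        then have "H \<le> i + 1" using us Hx by linarith
        ultimately show ?thesis by (simp add: H_def)
      next
        case False
        then have "hi \<le> x" unfolding hi_def using xX finX by (intro Min_le) auto
        then have "real D * hi \<le> real D * x" by (intro mult_left_mono) auto
        then have "a + 1 < ft D (Suc n)" using ftx a gap by linarith
        moreover have "real (Suc s) * u \<le> real (Suc s) * F x" using False by (intro mult_left_mono) auto
        then have "i \<le> H" using us Hx by linarith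
        ultimately show ?thesis by (simp add: H_def)
      qed
    qed
    ultimately show ?thesis by blast
  qed
  show ?thesis unfolding eventually_sequentially using main by blast
qed

text \<open>This puts the test into the form that \<open>threshold_count\<close> expects: visit i
  lands below t n essentially when i is below (s+1) times the value there, with slack for the errors
  of \<open>h\<close>.\<close>

lemma quantile_test_sound:
  assumes test: "quantile_test ft h s r i D a" and r: "r < fact s" and n: "1 \<le> n" "n \<le> s" and D: "D \<ge> 1"
    and z: "real a / real D < z" "z < real (Suc a) / real D"
  shows "z < t n \<and> real i < real (Suc s) * f (fact s) r (t n) + 1 \<or>
    z > t n \<and> real (Suc s) * f (fact s) r (t n) < real i + 2"
proof -
  define H where "H = h (Suc s) (fact s) r n"
  have "n - 1 < s" "Suc (n - 1) = n" using n by auto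
  then have T: "(a + 1 < ft D n \<and> i \<le> H) \<or> (ft D n < a \<and> H \<le> i + 1)"
    using test unfolding quantile_test_def H_def by metis
  have ftn: "real (ft D n) - 1 < real D * t n" "real D * t n < real (ft D n) + 1" using ft[OF D n(1)] by auto
  have Hn: "real H - 1 < real (Suc s) * f (fact s) r (t n)" "real (Suc s) * f (fact s) r (t n) < real H + 1"
    using h[of "Suc s" "fact s" r n] r n by (auto simp: H_def)
  have zD: "real a < real D * z" "real D * z < real (Suc a)" using z D by (auto simp: field_simps)
  from T show ?thesis
  proof
    assume "a + 1 < ft D n \<and> i \<le> H"
    then have "real D * z < real D * t n" "real i < real (Suc s) * f (fact s) r (t n) + 1"
      using ftn Hn zD by linarith+
    then show ?thesis using D by simp
  next
    assume "ft D n < a \<and> H \<le> i + 1"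
    then have "real D * t n < real D * z" "real (Suc s) * f (fact s) r (t n) < real i + 2"
      using ftn Hn zD by linarith+
    then show ?thesis using D by simp
  qed
qed

end

section \<open>Counting along residue classes\<close>

lemma sum_mod_shift:
  fixes \<phi> :: "nat \<Rightarrow> real"
  assumes "M > 0"
  shows "(\<Sum>k<M. \<phi> ((x + k) mod M)) = (\<Sum>r<M. \<phi> r)"
proof (induction x)
  case (Suc x)
  define \<psi> where "\<psi> k = \<phi> ((x + k) mod M)" for k
  have "(\<Sum>k<M. \<phi> ((Suc x + k) mod M)) = (\<Sum>k<M. \<psi> (Suc k))" by (simp add: \<psi>_def)
  also have "\<dots> = (\<Sum>k<Suc M. \<psi> k) - \<psi> 0" by (simp only: sum.lessThan_Suc_shift)
  also have "\<dots> = (\<Sum>k<M. \<psi> k)" by (simp add: \<psi>_def)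
  also have "\<dots> = (\<Sum>r<M. \<phi> r)" using Suc by (simp add: \<psi>_def)
  finally show ?case .
qed simp

lemma sum_residue_class:
  fixes G :: "nat \<Rightarrow> real"
  assumes "r < m"
  shows "(\<Sum>k<m * d. if k mod m = r then G k else 0) = (\<Sum>i<d. G (m * i + r))"
proof -
  have "(\<Sum>k<m * d. if k mod m = r then G k else 0) =
      (\<Sum>i<d. \<Sum>k=i * m..<i * m + m. if k mod m = r then G k else 0)"
    by (simp add: sum.nat_group mult.commute)
  also have "\<dots> = (\<Sum>i<d. G (m * i + r))"
  proof (rule sum.cong[OF refl])
    fix i
    have "(\<Sum>k=i * m..<i * m + m. if k mod m = r then G k else 0) =
        (\<Sum>k=0..<m. if k = r then G (i * m + k) else 0)"
      by (subst sum.atLeastLessThan_shift_0) (auto intro!: sum.cong)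
    also have "\<dots> = G (m * i + r)" using assms by (simp add: sum.delta mult.commute)
    finally show "(\<Sum>k=i * m..<i * m + m. if k mod m = r then G k else 0) = G (m * i + r)" .
  qed
  finally show ?thesis .
qed

text \<open>Every i with i + 2 <= c is a hit, and every hit satisfies i < c + 1, so the number of
  hits lies between c - 2 and c + 2.\<close>

lemma threshold_count:
  fixes c :: real
  assumes c: "0 \<le> c" "c \<le> real N"
    and p: "\<And>i. i < N \<Longrightarrow> p i \<and> real i < c + 1 \<or> \<not> p i \<and> c < real i + 2"
  shows "\<bar>(\<Sum>i<N. if p i then 1 else 0) - c\<bar> \<le> 3"
proof -
  have "(\<Sum>i<N. if p i then 1 else (0::real)) = real (card {i. i < N \<and> p i})"
    by (simp add: sum.If_cases Int_def)
  moreover have "card {i. i < N \<and> p i} \<le> card {..nat \<lfloor>c + 1\<rfloor>}"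
  proof (intro card_mono subsetI)
    fix i assume "i \<in> {i. i < N \<and> p i}"
    then have "real i < c + 1" using p[of i] by auto
    then show "i \<in> {..nat \<lfloor>c + 1\<rfloor>}" using c by (simp add: le_nat_iff) linarith
  qed auto
  then have "real (card {i. i < N \<and> p i}) \<le> c + 2" using c by simp linarith
  moreover have "card {..<nat (\<lfloor>c\<rfloor> - 1)} \<le> card {i. i < N \<and> p i}"
  proof (rule card_mono)
    show "{..<nat (\<lfloor>c\<rfloor> - 1)} \<subseteq> {i. i < N \<and> p i}"
    proof
      fix i assume "i \<in> {..<nat (\<lfloor>c\<rfloor> - 1)}"
      then have "int i < \<lfloor>c\<rfloor> - 1" by simp
      then have "real i + 2 \<le> c" by linarith
      then show "i \<in> {i. i < N \<and> p i}" using p[of i] c by auto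
    qed
  qed auto
  then have "c - 2 \<le> real (card {i. i < N \<and> p i})" by simp linarith
  ultimately show ?thesis by linarith
qed

context evaluable_family
begin

text \<open>\<open>(j - x) div fact s\<close> numbers the visits to each residue class from 0 to s.
  The cell is existentially quantified, which keeps the counting independent of how cells are
  found.\<close>

definition quantile_chunk :: "nat \<Rightarrow> nat \<Rightarrow> (nat \<Rightarrow> real) \<Rightarrow> bool" where
  "quantile_chunk s x w \<longleftrightarrow> (\<forall>j. x \<le> j \<and> j < x + fact s * Suc s \<longrightarrow>
     (\<exists>D a. D \<ge> 1 \<and> quantile_test ft h s (j mod fact s) ((j - x) div fact s) D a \<and>
        real a / real D < w j \<and> w j < real (Suc a) / real D))"

text \<open>Each class r' modulo s! contributes (s + 1) f_{s!,r'}(t n) hits up to 3. There are s!/m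
  classes congruent to r modulo m; with the weight m their errors add up to 3 s!, and linearity
  turns the main terms into a multiple of f_{m,r}(t n).\<close>

lemma chunk_sum_at_point:
  assumes m: "1 \<le> m" "m \<le> s" and r: "r < m" and n: "1 \<le> n" "n \<le> s"
    and w: "quantile_chunk s x w"
  shows "\<bar>(\<Sum>j=x..<x + fact s * Suc s. hit_weight m r (t n) w j)
      - real (fact s * Suc s) * f m r (t n)\<bar> \<le> 3 * real (fact s)"
proof -
  define M where "M = (fact s :: nat)"
  define N where "N = Suc s"
  define y where "y = t n"
  have M: "M > 0" by (simp add: M_def)
  have y01: "0 \<le> y" "y \<le> 1" using t_range[OF n(1)] by (auto simp: y_def)
  have "m dvd M" unfolding M_def using m by (intro dvd_fact) auto
  then obtain d where d: "M = m * d" by blast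
  have d1: "d \<ge> 1" using M d by (cases d) auto
  have fam: "(\<Sum>i<d. f M (m * i + r) y) = real d * f m r y"
  proof -
    have "f m r y = 1 / real d * (\<Sum>i<d. f (m * d) (m * i + r) y)"
      using linear m(1) r d1 y01 unfolding linear_family_def by auto
    then show ?thesis using d1 by (simp add: d)
  qed
  define g where "g j = hit_weight m r y w j" for j
  define \<phi> where "\<phi> r' = (if r' mod m = r then real m * (real N * f M r' y) else 0)" for r'
  define \<kappa> where "\<kappa> r' = (if r' mod m = r then 3 * real m else 0)" for r'
  have col: "\<bar>(\<Sum>i<N. g (x + i * M + k)) - \<phi> ((x + k) mod M)\<bar> \<le> \<kappa> ((x + k) mod M)" if k: "k < M" for k
  proof -
    define r' where "r' = (x + k) mod M"
    have r'M: "r' < M" using M by (simp add: r'_def)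
    have modM: "(x + i * M + k) mod M = r'" for i
    proof -
      have "x + i * M + k = x + k + i * M" by simp
      then show ?thesis unfolding r'_def by (metis mod_mult_self1)
    qed
    have modm: "(x + i * M + k) mod m = r' mod m" for i
      unfolding modM[of i, symmetric] using \<open>m dvd M\<close> by (simp add: mod_mod_cancel)
    show ?thesis
    proof (cases "r' mod m = r")
      case False
      then show ?thesis using modm by (simp add: g_def hit_weight_def \<phi>_def \<kappa>_def r'_def[symmetric])
    next
      case True
      have f01: "0 \<le> f M r' y" "f M r' y \<le> 1" using adf_range[of M r' y] r'M M y01 by auto
      have "\<bar>(\<Sum>i<N. if w (x + i * M + k) < y then 1 else 0) - real N * f M r' y\<bar> \<le> 3"
      proof (rule threshold_count)
        show "0 \<le> real N * f M r' y" using f01 by simp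
        show "real N * f M r' y \<le> real N" using f01 by (simp add: mult_left_le)
        fix i assume i: "i < N"
        have "i * M + k < Suc i * M" using k by simp
        also have "\<dots> \<le> N * M" using i by (intro mult_right_mono) auto
        finally have in_chunk: "x + i * M + k < x + fact s * Suc s" by (simp add: M_def N_def mult.commute)
        have "(x + i * M + k - x) div fact s = i" using k by (simp add: M_def)
        then obtain D a where Da: "D \<ge> 1" "quantile_test ft h s r' i D a"
          "real a / real D < w (x + i * M + k)" "w (x + i * M + k) < real (Suc a) / real D"
          using w[unfolded quantile_chunk_def] in_chunk modM[of i] unfolding M_def
          by (metis le_add1 add.assoc)
        from quantile_test_sound[OF Da(2) _ n Da(1,3,4)] r'M
        show "w (x + i * M + k) < y \<and> real i < real N * f M r' y + 1 \<or>
            \<not> w (x + i * M + k) < y \<and> real N * f M r' y < real i + 2"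
          unfolding y_def N_def M_def by auto
      qed
      then have "real m * \<bar>(\<Sum>i<N. if w (x + i * M + k) < y then 1 else 0) - real N * f M r' y\<bar> \<le> real m * 3"
        by (intro mult_left_mono) auto
      moreover have "(\<Sum>i<N. g (x + i * M + k)) = real m * (\<Sum>i<N. if w (x + i * M + k) < y then 1 else 0)"
        unfolding sum_distrib_left using True modm by (intro sum.cong) (auto simp: g_def hit_weight_def)
      ultimately show ?thesis using True
        by (simp add: \<phi>_def \<kappa>_def r'_def[symmetric] abs_mult mult.commute flip: right_diff_distrib)
    qed
  qed
  have "(\<Sum>j=x..<x + M * N. g j) = (\<Sum>k<N * M. g (x + k))"
    by (subst sum.atLeastLessThan_shift_0) (simp add: mult.commute atLeast0LessThan)
  also have "\<dots> = (\<Sum>i<N. \<Sum>k=i * M..<i * M + M. g (x + k))"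
    by (simp add: sum.nat_group)
  also have "\<dots> = (\<Sum>i<N. \<Sum>k<M. g (x + i * M + k))"
  proof (rule sum.cong[OF refl])
    fix i
    show "(\<Sum>k=i * M..<i * M + M. g (x + k)) = (\<Sum>k<M. g (x + i * M + k))"
      by (subst sum.atLeastLessThan_shift_0) (simp add: atLeast0LessThan add.assoc)
  qed
  also have "\<dots> = (\<Sum>k<M. \<Sum>i<N. g (x + i * M + k))" by (rule sum.swap)
  finally have S: "(\<Sum>j=x..<x + M * N. g j) = (\<Sum>k<M. \<Sum>i<N. g (x + i * M + k))" .
  have "\<bar>(\<Sum>j=x..<x + M * N. g j) - (\<Sum>k<M. \<phi> ((x + k) mod M))\<bar> \<le> (\<Sum>k<M. \<kappa> ((x + k) mod M))"
    unfolding S sum_subtractf[symmetric] using col by (intro order_trans[OF sum_abs] sum_mono) auto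
  moreover have "(\<Sum>k<M. \<phi> ((x + k) mod M)) = real (M * N) * f m r y"
  proof -
    have "(\<Sum>k<M. \<phi> ((x + k) mod M)) = (\<Sum>k<m * d. if k mod m = r then real m * (real N * f M k y) else 0)"
      unfolding sum_mod_shift[OF M] by (simp add: \<phi>_def d)
    also have "\<dots> = real m * (real N * (\<Sum>i<d. f M (m * i + r) y))"
      unfolding sum_residue_class[OF r] by (simp add: sum_distrib_left)
    finally show ?thesis unfolding fam by (simp add: d)
  qed
  moreover have "(\<Sum>k<M. \<kappa> ((x + k) mod M)) = 3 * real M"
  proof -
    have "(\<Sum>k<M. \<kappa> ((x + k) mod M)) = (\<Sum>k<m * d. if k mod m = r then 3 * real m else 0)"
      unfolding sum_mod_shift[OF M] by (simp add: \<kappa>_def d)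
    also have "\<dots> = 3 * real M" unfolding sum_residue_class[OF r] by (simp add: d)
    finally show ?thesis .
  qed
  ultimately show ?thesis by (simp add: g_def y_def M_def N_def)
qed

text \<open>Uniform in x and w: chunks of one stage occur at many places, so the bound may depend on
  the stage only.\<close>

definition chunk_close :: "nat \<Rightarrow> nat \<Rightarrow> real \<Rightarrow> real \<Rightarrow> nat \<Rightarrow> bool" where
  "chunk_close m r y \<eta> s \<longleftrightarrow> (\<forall>x w. quantile_chunk s x w \<longrightarrow>
    \<bar>(\<Sum>j=x..<x + fact s * Suc s. hit_weight m r y w j) - real (fact s * Suc s) * f m r y\<bar>
      \<le> \<eta> * real (fact s * Suc s))"

text \<open>At enumerated points the error 3 s! is negligible against s! (s + 1). Any other y is a
  point of continuity, since all discontinuities are enumerated, and is enclosed between two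
  rationals; hit counts are monotone in y.\<close>

lemma eventually_chunk_close:
  assumes m: "1 \<le> m" and r: "r < m" and y: "y \<in> {0..1}" and \<eta>: "\<eta> > 0"
  shows "\<forall>\<^sub>F s in sequentially. chunk_close m r y \<eta> s"
proof -
  have point: "\<forall>\<^sub>F s in sequentially. chunk_close m r (t n) \<eta> s" if n: "n \<ge> 1" and \<eta>: "\<eta> > 0" for n \<eta>
  proof -
    obtain K :: nat where K: "3 / \<eta> < real K" using reals_Archimedean2 by blast
    show ?thesis
      unfolding chunk_close_def
    proof (rule eventually_sequentiallyI[of "max K (max m n)"], intro allI impI)
      fix s x w assume s: "max K (max m n) \<le> s" and w: "quantile_chunk s x w"
      have "3 < \<eta> * real K" using K \<eta> by (simp add: field_simps)
      also have "\<dots> \<le> \<eta> * real (Suc s)" using s \<eta> by (intro mult_left_mono) auto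
      finally have "3 * real (fact s) \<le> \<eta> * real (Suc s) * real (fact s)"
        by (intro mult_right_mono) auto
      then have "3 * real (fact s) \<le> \<eta> * real (fact s * Suc s)"
        unfolding of_nat_mult by (simp only: mult_ac)
      then show "\<bar>(\<Sum>j=x..<x + fact s * Suc s. hit_weight m r (t n) w j) - real (fact s * Suc s) * f m r (t n)\<bar>
          \<le> \<eta> * real (fact s * Suc s)"
        using chunk_sum_at_point[OF m _ r n _ w] s by force
    qed
  qed
  show ?thesis
  proof (cases "y \<in> t ` {1..}")
    case True
    then show ?thesis using point \<eta> by auto
  next
    case False
    have "y \<notin> discontinuities (f m r)" using discont[OF m r] False by blast
    then have cont: "continuous (at y within {0..1}) (f m r)" using y by (simp add: discontinuities_def)
    have "y \<noteq> 0" "y \<noteq> 1" using False rationals by auto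
    then have y01: "0 < y" "y < 1" using y by auto
    obtain \<delta> where \<delta>: "\<delta> > 0" "\<And>z. z \<in> {0..1} \<Longrightarrow> dist z y < \<delta> \<Longrightarrow> dist (f m r z) (f m r y) < \<eta> / 2"
      using cont \<eta> unfolding continuous_within_eps_delta by (meson half_gt_zero)
    obtain q1 where q1: "q1 \<in> \<rat>" "max 0 (y - \<delta>) < q1" "q1 < y"
      using Rats_dense_in_real[of "max 0 (y - \<delta>)" y] \<delta> y01 by auto
    obtain q2 where q2: "q2 \<in> \<rat>" "y < q2" "q2 < min 1 (y + \<delta>)"
      using Rats_dense_in_real[of y "min 1 (y + \<delta>)"] \<delta> y01 by auto
    obtain n1 where n1: "n1 \<ge> 1" "q1 = t n1" using q1 y01 rationals by fastforce
    obtain n2 where n2: "n2 \<ge> 1" "q2 = t n2" using q2 y01 rationals by fastforce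
    have f1: "f m r y - \<eta> / 2 \<le> f m r q1"
    proof -
      have "dist (f m r q1) (f m r y) < \<eta> / 2" by (rule \<delta>(2)) (use q1 y01 in \<open>auto simp: dist_real_def\<close>)
      then show ?thesis unfolding dist_real_def by linarith
    qed
    have f2: "f m r q2 \<le> f m r y + \<eta> / 2"
    proof -
      have "dist (f m r q2) (f m r y) < \<eta> / 2" by (rule \<delta>(2)) (use q2 y01 in \<open>auto simp: dist_real_def\<close>)
      then show ?thesis unfolding dist_real_def by linarith
    qed
    have "\<eta> / 2 > 0" using \<eta> by simp
    show ?thesis
      using point[OF n1(1) \<open>\<eta> / 2 > 0\<close>] point[OF n2(1) \<open>\<eta> / 2 > 0\<close>]
    proof eventually_elim
      case (elim s)
      show ?case
        unfolding chunk_close_def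
      proof (intro allI impI)
        fix x w assume w: "quantile_chunk s x w"
        define \<Lambda> where "\<Lambda> = real (fact s * Suc s)"
        define S where "S z = (\<Sum>j=x..<x + fact s * Suc s. hit_weight m r z w j)" for z
        have 1: "\<bar>S q1 - \<Lambda> * f m r q1\<bar> \<le> \<eta> / 2 * \<Lambda>" "\<bar>S q2 - \<Lambda> * f m r q2\<bar> \<le> \<eta> / 2 * \<Lambda>"
          using elim w n1(2) n2(2) unfolding S_def \<Lambda>_def chunk_close_def by auto
        have 2: "S q1 \<le> S y" "S y \<le> S q2"
          unfolding S_def using q1 q2 by (auto intro!: sum_mono simp: hit_weight_def)
        have "\<Lambda> * (f m r y - \<eta> / 2) \<le> \<Lambda> * f m r q1" "\<Lambda> * f m r q2 \<le> \<Lambda> * (f m r y + \<eta> / 2)"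
          using f1 f2 by (auto intro!: mult_left_mono simp: \<Lambda>_def)
        then have "\<bar>S y - \<Lambda> * f m r y\<bar> \<le> \<eta> * \<Lambda>" using 1 2 unfolding ring_distribs by argo
        then show "\<bar>(\<Sum>j=x..<x + fact s * Suc s. hit_weight m r y w j) - real (fact s * Suc s) * f m r y\<bar>
          \<le> \<eta> * real (fact s * Suc s)" by (simp only: S_def \<Lambda>_def)
      qed
    qed
  qed
qed

end

section \<open>Alternating between two linear families\<close>

lemma fact_gt_self_arg: "\<exists>e. x < (fact e :: nat)"
proof
  have "Suc x \<le> fact (Suc x)" by (rule fact_ge_self)
  then show "x < fact (Suc x)" by simp
qed

text \<open>Ratios of consecutive factorials tend to infinity, so almost all indices below a large
  factorial belong to the last level. The parity of the level becomes the phase.\<close>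

definition fact_level :: "nat \<Rightarrow> nat" where
  "fact_level x = (LEAST e. x < fact e)"

lemma fact_level_eq:
  assumes "fact e \<le> x" "x < fact (Suc e)"
  shows "fact_level x = Suc e"
  unfolding fact_level_def
proof (rule Least_equality)
  fix e' assume x: "x < (fact e' :: nat)"
  show "Suc e \<le> e'"
  proof (rule ccontr)
    assume "\<not> Suc e \<le> e'"
    then have "(fact e' :: nat) \<le> fact e" by (intro fact_mono_nat) simp
    then show False using x assms by simp
  qed
qed (use assms in simp)

text \<open>\<open>True\<close> stands for the upper and \<open>False\<close> for the lower family;
  \<open>J\<close> will be an index from which the controlled positions increase.\<close>

locale controller =
  fixes f :: "bool \<Rightarrow> nat \<Rightarrow> nat \<Rightarrow> real \<Rightarrow> real" and t :: "bool \<Rightarrow> nat \<Rightarrow> real"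
    and ft :: "bool \<Rightarrow> nat \<Rightarrow> nat \<Rightarrow> nat" and h :: "bool \<Rightarrow> nat \<Rightarrow> nat \<Rightarrow> nat \<Rightarrow> nat \<Rightarrow> nat"
    and g :: "nat \<Rightarrow> nat" and J :: nat
  assumes family: "evaluable_family (f b) (t b) (ft b) (h b)"
begin

text \<open>One denominator for both families and all quantiles of a stage, so that the demand on
  the bases does not depend on the phase. Writing out the two families keeps the predicate visibly
  recursive.\<close>

definition resolves :: "nat \<Rightarrow> nat \<Rightarrow> bool" where
  "resolves s D \<longleftrightarrow> D \<ge> 1 \<and> (\<forall>r<fact s. \<forall>i<Suc s.
     (\<exists>a<D. quantile_test (ft True) (h True) s r i D a) \<and>
     (\<exists>a<D. quantile_test (ft False) (h False) s r i D a))"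

definition resolution :: "nat \<Rightarrow> nat" where
  "resolution s = (LEAST D. resolves s D)"

text \<open>The first alternative bounds the search, so that it ends for all arguments, as
  minimisation in \<open>total_recursive\<close> requires.\<close>

definition quantile :: "bool \<Rightarrow> nat \<Rightarrow> nat \<Rightarrow> nat \<Rightarrow> nat" where
  "quantile b s r i = (LEAST a. a \<ge> resolution s \<or> quantile_test (ft b) (h b) s r i (resolution s) a)"

definition chunk_length :: "nat \<Rightarrow> nat" where
  "chunk_length s = fact s * Suc s"

text \<open>8 D is the base that \<open>digit_range\<close> asks for; the exponent makes the loss
  factor 8 D at most the (s+1)-th root of the available base.\<close>

definition required_base :: "nat \<Rightarrow> nat" where
  "required_base s = (8 * resolution s) ^ Suc s"

text \<open>Stage \<open>s\<close> may be used from index \<open>threshold s\<close> on: the bases at the controlled positions are then at least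
  \<open>required_base s\<close> (if \<open>g n\<close> bounds the last position with a base below \<open>n\<close>), and chunks are short
  compared with the index at which they start.\<close>

definition threshold :: "nat \<Rightarrow> nat" where
  "threshold s = g (required_base s) + J + 3 + Suc s * chunk_length s"

text \<open>\<open>threshold\<close> may fail to increase; by minimality
  \<open>threshold (stage x) <= x\<close> holds nevertheless, once x has reached
  \<open>threshold 0\<close>.\<close>

definition stage :: "nat \<Rightarrow> nat" where
  "stage x = (LEAST s. x < threshold (Suc s))"

definition chunk_start :: "nat \<Rightarrow> nat" where
  "chunk_start l = rec_nat (threshold 0) (\<lambda>_ x. x + chunk_length (stage x)) l"

definition chunk_index :: "nat \<Rightarrow> nat" where
  "chunk_index j = (LEAST l. j < chunk_start (Suc l))"

definition origin :: "nat \<Rightarrow> nat" where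
  "origin j = chunk_start (chunk_index j)"

text \<open>Evaluated at origins of chunks only, so that a chunk is never split between the two
  families.\<close>

definition upper_phase :: "nat \<Rightarrow> bool" where
  "upper_phase x \<longleftrightarrow> fact_level x mod 2 = 0"

definition den :: "nat \<Rightarrow> nat" where
  "den j = resolution (stage (origin j))"

definition num :: "nat \<Rightarrow> nat" where
  "num j = quantile (upper_phase (origin j)) (stage (origin j)) (j mod fact (stage (origin j)))
     ((j - origin j) div fact (stage (origin j)))"

lemma resolution_ex: "\<exists>D. resolves s D"
proof -
  have "\<forall>\<^sub>F D in sequentially. \<forall>b\<in>UNIV. \<forall>r\<in>{..<fact s}. \<forall>i\<in>{..<Suc s}. \<exists>a<D. quantile_test (ft b) (h b) s r i D a"
    by (intro eventually_ball_finite ballI evaluable_family.quantile_test_ex[OF family]) auto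
  with eventually_ge_at_top[of 1] have "\<forall>\<^sub>F D in sequentially. resolves s D"
    by eventually_elim (auto simp: resolves_def)
  then show ?thesis using eventually_happens' sequentially_bot by blast
qed

lemma resolution_props:
  shows "resolution s \<ge> 1"
    and "r < fact s \<Longrightarrow> i \<le> s \<Longrightarrow> \<exists>a<resolution s. quantile_test (ft b) (h b) s r i (resolution s) a"
proof -
  have *: "resolves s (resolution s)" unfolding resolution_def by (rule LeastI_ex[OF resolution_ex])
  then show "resolution s \<ge> 1" by (simp add: resolves_def)
  show "\<exists>a<resolution s. quantile_test (ft b) (h b) s r i (resolution s) a" if "r < fact s" "i \<le> s"
    using * that by (cases b) (auto simp: resolves_def)
qed

lemma quantile_props:
  assumes "r < fact s" "i \<le> s"
  shows "quantile b s r i < resolution s"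
    "quantile_test (ft b) (h b) s r i (resolution s) (quantile b s r i)"
proof -
  obtain a where a: "a < resolution s" "quantile_test (ft b) (h b) s r i (resolution s) a"
    using resolution_props(2)[OF assms] by blast
  then have "quantile b s r i \<le> a" unfolding quantile_def by (intro Least_le) simp
  then show 1: "quantile b s r i < resolution s" using a by simp
  have "quantile b s r i \<ge> resolution s \<or>
      quantile_test (ft b) (h b) s r i (resolution s) (quantile b s r i)"
    unfolding quantile_def by (rule LeastI[of _ a]) (use a in simp)
  with 1 show "quantile_test (ft b) (h b) s r i (resolution s) (quantile b s r i)" by simp
qed

lemma chunk_length_pos: "chunk_length s > 0"
  by (simp add: chunk_length_def)

lemma threshold_gt: "s < threshold s"
proof -
  have "Suc s * 1 \<le> Suc s * chunk_length s" using chunk_length_pos[of s] by (intro mult_left_mono) auto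
  then show ?thesis by (simp add: threshold_def)
qed

lemma stage_ex: "\<exists>s. x < threshold (Suc s)"
  using threshold_gt[of "Suc x"] by (intro exI[of _ x]) simp

lemma stage_less: "x < threshold (Suc (stage x))"
  unfolding stage_def using stage_ex by (rule LeastI_ex)

lemma threshold_stage:
  assumes "x \<ge> threshold 0"
  shows "threshold (stage x) \<le> x"
proof (cases "stage x")
  case (Suc s)
  have "\<not> x < threshold (Suc s)"
    using not_less_Least[of s "\<lambda>s. x < threshold (Suc s)"] Suc by (simp add: stage_def)
  then show ?thesis using Suc by simp
qed (use assms in simp)

lemma stage_unbounded: "\<exists>X. \<forall>x\<ge>X. stage x \<ge> S"
proof (intro exI allI impI)
  \<comment> \<open>The sum dominates all thresholds up to S, whatever their order.\<close>
  fix x assume x: "(\<Sum>s\<le>S. threshold s) \<le> x"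
  show "stage x \<ge> S"
  proof (rule ccontr)
    assume "\<not> stage x \<ge> S"
    then have "threshold (Suc (stage x)) \<le> (\<Sum>s\<le>S. threshold s)" by (intro member_le_sum) auto
    then show False using x stage_less[of x] by simp
  qed
qed

lemma chunk_start_simps:
  "chunk_start 0 = threshold 0"
  "chunk_start (Suc l) = chunk_start l + chunk_length (stage (chunk_start l))"
  by (simp_all add: chunk_start_def)

lemma chunk_start_ge: "chunk_start l \<ge> threshold 0 + l"
proof (induction l)
  case (Suc l)
  then show ?case using chunk_length_pos[of "stage (chunk_start l)"] by (simp add: chunk_start_simps)
qed (simp add: chunk_start_simps)

lemma chunk_start_mono: "k \<le> l \<Longrightarrow> chunk_start k \<le> chunk_start l"
  by (rule lift_Suc_mono_le) (simp_all add: chunk_start_simps)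

lemma chunk_index_ex: "\<exists>l. j < chunk_start (Suc l)"
  using chunk_start_ge[of "Suc j"] by (intro exI[of _ j]) simp

lemma origin_bounds:
  assumes "j \<ge> threshold 0"
  shows "origin j \<le> j" "j < origin j + chunk_length (stage (origin j))" "threshold 0 \<le> origin j"
proof -
  show "threshold 0 \<le> origin j" using chunk_start_ge[of "chunk_index j"] by (simp add: origin_def)
  have "j < chunk_start (Suc (chunk_index j))"
    unfolding chunk_index_def using chunk_index_ex by (rule LeastI_ex)
  then show "j < origin j + chunk_length (stage (origin j))" by (simp add: chunk_start_simps origin_def)
  show "origin j \<le> j"
  proof (cases "chunk_index j")
    case 0 then show ?thesis using assms by (simp add: origin_def chunk_start_simps)
  next
    case (Suc l)
    then have "\<not> j < chunk_start (Suc l)"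
      using not_less_Least[of l "\<lambda>l. j < chunk_start (Suc l)"] by (simp add: chunk_index_def)
    then show ?thesis using Suc by (simp add: origin_def)
  qed
qed

lemma origin_eq:
  assumes "chunk_start l \<le> j" "j < chunk_start (Suc l)"
  shows "origin j = chunk_start l"
proof -
  have "chunk_index j = l" unfolding chunk_index_def
  proof (rule Least_equality)
    fix k assume "j < chunk_start (Suc k)"
    then show "l \<le> k" using assms(1) chunk_start_mono[of "Suc k" l] by (cases "l \<le> k") auto
  qed (rule assms)
  then show ?thesis by (simp add: origin_def)
qed

lemma origin_threshold: "j \<ge> threshold 0 \<Longrightarrow> threshold (stage (origin j)) \<le> origin j"
  using origin_bounds(3) threshold_stage by blast

lemma chunk_length_le: "j \<ge> threshold 0 \<Longrightarrow>
    Suc (stage (origin j)) * chunk_length (stage (origin j)) \<le> origin j"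
  using origin_threshold[of j] by (simp add: threshold_def)

text \<open>A chunk is at most as long as its origin. This bound lets statements about origins be
  used for indices.\<close>

lemma origin_ge_half:
  assumes "j \<ge> threshold 0"
  shows "j < 2 * origin j"
proof -
  have "1 * chunk_length (stage (origin j)) \<le> Suc (stage (origin j)) * chunk_length (stage (origin j))"
    by (intro mult_right_mono) auto
  then have "chunk_length (stage (origin j)) \<le> origin j" using chunk_length_le[OF assms] by linarith
  then show ?thesis using origin_bounds(2)[OF assms] by linarith
qed

lemma stage_origin_unbounded: "\<exists>X. \<forall>j\<ge>X. stage (origin j) \<ge> S"
proof -
  obtain X where X: "\<And>x. x \<ge> X \<Longrightarrow> stage x \<ge> S" using stage_unbounded by blast
  show ?thesis
  proof (intro exI allI impI)
    fix j assume "j \<ge> 2 * X + threshold 0"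
    then show "stage (origin j) \<ge> S" using origin_ge_half[of j] by (intro X) auto
  qed
qed

lemma num_less_den: "j \<ge> threshold 0 \<Longrightarrow> num j < den j"
  and num_test: "j \<ge> threshold 0 \<Longrightarrow>
    quantile_test (ft (upper_phase (origin j))) (h (upper_phase (origin j))) (stage (origin j))
      (j mod fact (stage (origin j))) ((j - origin j) div fact (stage (origin j))) (den j) (num j)"
proof -
  assume j: "j \<ge> threshold 0"
  define s where "s = stage (origin j)"
  have "j - origin j < Suc s * fact s"
    using origin_bounds[OF j] by (simp add: chunk_length_def s_def mult.commute)
  then have "(j - origin j) div fact s < Suc s" by (simp only: less_mult_imp_div_less)
  then have i: "(j - origin j) div fact s \<le> s" by simp
  have r: "j mod fact s < fact s" by simp
  show "num j < den j" unfolding num_def den_def s_def[symmetric] by (rule quantile_props(1)[OF r i])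
  show "quantile_test (ft (upper_phase (origin j))) (h (upper_phase (origin j))) (stage (origin j))
      (j mod fact (stage (origin j))) ((j - origin j) div fact (stage (origin j))) (den j) (num j)"
    unfolding num_def den_def s_def[symmetric] by (rule quantile_props(2)[OF r i])
qed

definition phase_weight :: "nat \<Rightarrow> real" where
  "phase_weight j = of_bool (upper_phase (origin j))"

definition phase_average :: "nat \<Rightarrow> nat \<Rightarrow> real" where
  "phase_average m n = (\<Sum>j<m * n. phase_weight j) / real (m * n)"

lemma phase_sum_bounds: "0 \<le> (\<Sum>j<n. phase_weight j)" "(\<Sum>j<n. phase_weight j) \<le> real n"
proof -
  show "0 \<le> (\<Sum>j<n. phase_weight j)" by (rule sum_nonneg) (simp add: phase_weight_def)
  have "(\<Sum>j<n. phase_weight j) \<le> (\<Sum>j<n. 1)" by (rule sum_mono) (simp add: phase_weight_def)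
  then show "(\<Sum>j<n. phase_weight j) \<le> real n" by simp
qed

lemma phase_average_bounds: "0 \<le> phase_average m n \<and> phase_average m n \<le> 1"
  using phase_sum_bounds[of "m * n"] by (cases "m * n = 0") (auto simp: phase_average_def divide_le_eq_1)

text \<open>A run of equal phases covers almost all of the indices below a factorial.\<close>

lemma frequently_phase_average_close:
  assumes m: "m \<ge> 1" and \<epsilon>: "\<epsilon> > 0"
  shows "\<exists>\<^sub>F n in sequentially. \<bar>phase_average m n - of_bool b\<bar> \<le> \<epsilon>"
  unfolding frequently_sequentially
proof
  fix N
  obtain K :: nat where K: "2 / \<epsilon> < real K" using reals_Archimedean2 by blast
  define k where "k = N + m + K + threshold 0 + 1"
  \<comment> \<open>The run has level \<open>Suc e\<close>, and upper phases have even level, so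
    they need odd e.\<close>
  define e where "e = 2 * k + (if b then 1 else 0)"
  have ek: "e \<ge> k" "e \<ge> 1" by (auto simp: e_def k_def)
  define n where "n = fact (Suc e) div m"
  have "m dvd fact (Suc e)" using m ek by (intro dvd_fact) (auto simp: k_def)
  then have mn: "m * n = fact (Suc e)" by (simp add: n_def)
  have en: "fact e \<le> n"
  proof -
    have "m * fact e \<le> Suc e * fact e" using ek by (intro mult_right_mono) (auto simp: k_def)
    then have "m * fact e \<le> m * n" by (simp add: mn)
    then show ?thesis using m by simp
  qed
  have "e \<le> fact e" by (rule fact_ge_self)
  have "n \<ge> N" using en \<open>e \<le> fact e\<close> ek by (simp add: k_def)
  define X where "X = (fact (Suc e) :: nat)"
  \<comment> \<open>From twice \<open>fact e\<close> on, the origin of the chunk has passed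
    \<open>fact e\<close>, and not only the index itself.\<close>
  define Y where "Y = 2 * (fact e :: nat)"
  define c where "c = (of_bool b :: real)"
  have YX: "Y \<le> X" using ek unfolding X_def Y_def fact_Suc by (intro mult_right_mono) auto
  have phase: "phase_weight j = c" if "j \<in> {Y..<X}" for j
  proof -
    have j: "2 * fact e \<le> j" "j < fact (Suc e)" using that by (auto simp: X_def Y_def)
    have jt: "j \<ge> threshold 0" using j \<open>e \<le> fact e\<close> ek by (simp add: k_def)
    have "fact_level (origin j) = Suc e"
      using origin_ge_half[OF jt] origin_bounds(1)[OF jt] j by (intro fact_level_eq) linarith+
    then show ?thesis by (simp add: phase_weight_def upper_phase_def e_def c_def)
  qed
  have "(\<Sum>j<X. phase_weight j) = (\<Sum>j<Y. phase_weight j) + (\<Sum>j=Y..<X. phase_weight j)"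
    using sum.union_disjoint[of "{..<Y}" "{Y..<X}" phase_weight] YX by (simp add: ivl_disj_un ivl_disj_int)
  also have "(\<Sum>j=Y..<X. phase_weight j) = (\<Sum>j=Y..<X. c)" using phase by (intro sum.cong) auto
  also have "\<dots> = real X * c - real Y * c" using YX by (simp add: of_nat_diff algebra_simps)
  finally have eq: "(\<Sum>j<X. phase_weight j) - real X * c = (\<Sum>j<Y. phase_weight j) - real Y * c" by simp
  have "0 \<le> real Y * c" "real Y * c \<le> real Y" by (auto simp: c_def)
  then have "\<bar>(\<Sum>j<X. phase_weight j) - real X * c\<bar> \<le> real Y"
    unfolding eq using phase_sum_bounds[of Y] by linarith
  also have "real Y \<le> \<epsilon> * real X"
  proof -
    have "2 < \<epsilon> * real K" using K \<epsilon> by (simp add: field_simps)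
    also have "\<dots> \<le> \<epsilon> * real (Suc e)" using ek \<epsilon> by (intro mult_left_mono) (auto simp: k_def)
    finally have "2 * fact e \<le> \<epsilon> * real (Suc e) * fact e" by (intro mult_right_mono) auto
    then show ?thesis by (simp add: X_def Y_def algebra_simps)
  qed
  finally have "\<bar>(\<Sum>j<X. phase_weight j) - real X * c\<bar> \<le> \<epsilon> * real X" .
  moreover have X0: "real X > 0" unfolding X_def of_nat_0_less_iff by (rule fact_gt_zero)
  have "phase_average m n - c = ((\<Sum>j<X. phase_weight j) - real X * c) / real X"
    using X0 unfolding phase_average_def mn X_def[symmetric] by (simp add: field_simps)
  ultimately have "\<bar>phase_average m n - c\<bar> \<le> \<epsilon>"
    using X0 by (simp add: abs_divide pos_divide_le_eq)
  then show "\<exists>n\<ge>N. \<bar>phase_average m n - of_bool b\<bar> \<le> \<epsilon>" using \<open>n \<ge> N\<close> by (auto simp: c_def)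
qed

end

definition has_adfs :: "(nat \<Rightarrow> real) \<Rightarrow> (nat \<Rightarrow> nat \<Rightarrow> real \<Rightarrow> real) \<Rightarrow> (nat \<Rightarrow> nat \<Rightarrow> real \<Rightarrow> real) \<Rightarrow> bool" where
  "has_adfs w fu fl \<longleftrightarrow> (\<forall>m\<ge>1. \<forall>r<m.
     has_upper_adf (\<lambda>n. w (m * n + r)) (fu m r) \<and> has_lower_adf (\<lambda>n. w (m * n + r)) (fl m r))"

context controller
begin

text \<open>Z holds the indices at which another sequence decides the digit. Changing w there and
  below \<open>threshold 0\<close> alters the averages by o(1); afterwards all chunks are controlled
  and \<open>average_tendsto_0_of_chunks\<close> applies.\<close>

lemma hit_average:
  assumes w: "\<And>j. j \<ge> threshold 0 \<Longrightarrow> j \<notin> Z \<Longrightarrow>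
      real (num j) / real (den j) < w j \<and> w j < real (Suc (num j)) / real (den j)"
    and Z: "density_zero Z"
    and m: "m \<ge> 1" "r < m" and y: "y \<in> {0..1}"
  shows "(\<lambda>n. (\<Sum>j<n. hit_weight m r y w j - f (upper_phase (origin j)) m r y) / real n) \<longlonglongrightarrow> 0"
proof -
  have den0: "den j > 0" for j using resolution_props(1)[of "stage (origin j)"] by (simp add: den_def)
  \<comment> \<open>Uncontrolled indices receive the midpoint of the prescribed cell, which makes
    every chunk a quantile chunk.\<close>
  define w' where "w' j = (if j \<ge> threshold 0 \<and> j \<notin> Z then w j else (real (num j) + 1 / 2) / real (den j))" for j
  define e where "e j = hit_weight m r y w' j - f (upper_phase (origin j)) m r y" for j
  have w': "real (num j) / real (den j) < w' j \<and> w' j < real (Suc (num j)) / real (den j)" for j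
    using w[of j] den0[of j] by (auto simp: w'_def divide_strict_right_mono)
  have f01: "0 \<le> f b m r y \<and> f b m r y \<le> 1" for b
    using evaluable_family.adf_range[OF family m] y by auto
  have chunk: "evaluable_family.quantile_chunk (ft (upper_phase (chunk_start l))) (h (upper_phase (chunk_start l)))
      (stage (chunk_start l)) (chunk_start l) w'" for l
    unfolding evaluable_family.quantile_chunk_def[OF family]
  proof (intro allI impI)
    fix j assume j: "chunk_start l \<le> j \<and> j < chunk_start l + fact (stage (chunk_start l)) * Suc (stage (chunk_start l))"
    then have org: "origin j = chunk_start l"
      by (intro origin_eq) (simp_all add: chunk_start_simps chunk_length_def)
    have "j \<ge> threshold 0" using chunk_start_ge[of l] j by simp
    from num_test[OF this] w'[of j] den0[of j]
    show "\<exists>D a. D \<ge> 1 \<and> quantile_test (ft (upper_phase (chunk_start l))) (h (upper_phase (chunk_start l)))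
        (stage (chunk_start l)) (j mod fact (stage (chunk_start l)))
        ((j - chunk_start l) div fact (stage (chunk_start l))) D a \<and>
        real a / real D < w' j \<and> w' j < real (Suc a) / real D"
      unfolding org by (intro exI[of _ "den j"] exI[of _ "num j"]) auto
  qed
  have starts_unbounded: "\<forall>\<^sub>F l in sequentially. P (stage (chunk_start l))"
    if P: "\<forall>\<^sub>F s in sequentially. P s" for P
  proof -
    obtain S where S: "\<And>s. s \<ge> S \<Longrightarrow> P s" using P unfolding eventually_sequentially by blast
    obtain X where X: "\<And>x. x \<ge> X \<Longrightarrow> stage x \<ge> S" using stage_unbounded by blast
    show ?thesis
    proof (rule eventually_sequentiallyI[of X])
      fix l assume "X \<le> l"
      then have "X \<le> chunk_start l" using chunk_start_ge[of l] by simp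
      then show "P (stage (chunk_start l))" using S X by blast
    qed
  qed
  have "(\<lambda>n. (\<Sum>j<n. e j) / real n) \<longlonglongrightarrow> 0"
  proof (rule average_tendsto_0_of_chunks)
    show "\<bar>e j\<bar> \<le> real m + 1" for j
      using f01[of "upper_phase (origin j)"] by (auto simp: e_def hit_weight_def)
    show "chunk_start (Suc l) = chunk_start l + chunk_length (stage (chunk_start l))" for l
      by (rule chunk_start_simps)
    show "chunk_length (stage (chunk_start l)) > 0" for l by (rule chunk_length_pos)
  next
    fix \<eta> :: real assume \<eta>: "\<eta> > 0"
    have "\<forall>\<^sub>F s in sequentially. \<forall>b\<in>UNIV. evaluable_family.chunk_close (f b) (ft b) (h b) m r y \<eta> s"
      by (intro eventually_ball_finite ballI evaluable_family.eventually_chunk_close[OF family m y \<eta>]) simp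
    from starts_unbounded[OF this]
    show "\<forall>\<^sub>F l in sequentially. \<bar>\<Sum>j=chunk_start l..<chunk_start (Suc l). e j\<bar>
        \<le> \<eta> * real (chunk_length (stage (chunk_start l)))"
    proof eventually_elim
      case (elim l)
      define b where "b = upper_phase (chunk_start l)"
      have "(\<Sum>j=chunk_start l..<chunk_start (Suc l). f (upper_phase (origin j)) m r y)
        = (\<Sum>j=chunk_start l..<chunk_start (Suc l). f b m r y)"
        by (intro sum.cong refl) (simp add: origin_eq[of l] b_def)
      also have "\<dots> = real (chunk_length (stage (chunk_start l))) * f b m r y"
        by (simp add: chunk_start_simps)
      finally show ?case
        using elim[rule_format, unfolded evaluable_family.chunk_close_def[OF family], OF UNIV_I, rule_format, OF chunk]
        by (simp add: e_def sum_subtractf b_def chunk_start_simps chunk_length_def)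
    qed
    \<comment> \<open>By the last summand of \<open>threshold\<close>, a chunk of stage s is at most
      1/(s + 1) of its starting index.\<close>
    obtain K :: nat where K: "1 / \<eta> < real K" using reals_Archimedean2 by blast
    have "\<forall>\<^sub>F l in sequentially. stage (chunk_start l) \<ge> K"
      by (rule starts_unbounded) (rule eventually_ge_at_top)
    then show "\<forall>\<^sub>F l in sequentially. real (chunk_length (stage (chunk_start l))) \<le> \<eta> * real (chunk_start l)"
    proof eventually_elim
      case (elim l)
      define s where "s = stage (chunk_start l)"
      have "threshold 0 \<le> chunk_start l" using chunk_start_ge[of l] by simp
      then have "threshold s \<le> chunk_start l" unfolding s_def by (rule threshold_stage)
      then have "Suc s * chunk_length s \<le> chunk_start l" by (simp add: threshold_def)
      then have "real (Suc s) * real (chunk_length s) \<le> real (chunk_start l)"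
        unfolding of_nat_mult[symmetric] of_nat_le_iff .
      then have 1: "\<eta> * (real (Suc s) * real (chunk_length s)) \<le> \<eta> * real (chunk_start l)"
        using \<eta> by (intro mult_left_mono) auto
      have "1 < \<eta> * real K" using K \<eta> by (simp add: field_simps)
      also have "\<dots> \<le> \<eta> * real (Suc s)" using elim \<eta> by (intro mult_left_mono) (auto simp: s_def)
      finally have "1 * real (chunk_length s) \<le> \<eta> * real (Suc s) * real (chunk_length s)"
        by (intro mult_right_mono) auto
      then show ?case using 1 by (simp add: s_def mult.assoc)
    qed
  qed
  moreover have "(\<lambda>n. (\<Sum>j<n. hit_weight m r y w j - hit_weight m r y w' j) / real n) \<longlonglongrightarrow> 0"
  proof (rule Lim_null_comparison)
    have lim: "(\<lambda>n. real m * (real (threshold 0) * (1 / real n) + real (card {j. j < n \<and> j \<in> Z}) / real n))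
        \<longlonglongrightarrow> real m * (real (threshold 0) * 0 + 0)"
      by (intro tendsto_intros Z[unfolded density_zero_def] lim_1_over_n)
    then show "(\<lambda>n. real m * (real (threshold 0) * (1 / real n) + real (card {j. j < n \<and> j \<in> Z}) / real n)) \<longlonglongrightarrow> 0"
      by simp
    show "\<forall>\<^sub>F n in sequentially. norm ((\<Sum>j<n. hit_weight m r y w j - hit_weight m r y w' j) / real n)
        \<le> real m * (real (threshold 0) * (1 / real n) + real (card {j. j < n \<and> j \<in> Z}) / real n)"
    proof (intro always_eventually allI)
      fix n
      have "\<bar>\<Sum>j<n. hit_weight m r y w j - hit_weight m r y w' j\<bar>
          \<le> (\<Sum>j<n. \<bar>hit_weight m r y w j - hit_weight m r y w' j\<bar>)" by (rule sum_abs)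
      also have "\<dots> \<le> (\<Sum>j<n. (if j < threshold 0 then real m else 0) + (if j \<in> Z then real m else 0))"
        by (intro sum_mono) (auto simp: hit_weight_def w'_def)
      also have "\<dots> = real m * real (card ({..<n} \<inter> {..<threshold 0})) + real m * real (card {j. j < n \<and> j \<in> Z})"
        by (simp add: sum.distrib sum.If_cases lessThan_def Int_def mult.commute)
      also have "\<dots> \<le> real m * real (threshold 0) + real m * real (card {j. j < n \<and> j \<in> Z})"
        using card_mono[of "{..<threshold 0}" "{..<n} \<inter> {..<threshold 0}"]
        by (intro add_right_mono mult_left_mono) auto
      finally have "\<bar>\<Sum>j<n. hit_weight m r y w j - hit_weight m r y w' j\<bar> / real n \<le>
          (real m * real (threshold 0) + real m * real (card {j. j < n \<and> j \<in> Z})) / real n"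
        by (intro divide_right_mono) auto
      then show "norm ((\<Sum>j<n. hit_weight m r y w j - hit_weight m r y w' j) / real n)
        \<le> real m * (real (threshold 0) * (1 / real n) + real (card {j. j < n \<and> j \<in> Z}) / real n)"
        by (simp add: add_divide_distrib distrib_left)
    qed
  qed
  ultimately have "(\<lambda>n. (\<Sum>j<n. e j) / real n + (\<Sum>j<n. hit_weight m r y w j - hit_weight m r y w' j) / real n) \<longlonglongrightarrow> 0 + 0"
    by (rule tendsto_add)
  then show ?thesis
    by (simp add: e_def add_divide_distrib[symmetric] sum.distrib[symmetric])
qed

text \<open>The average up to m n is asymptotically a mixture of the two families, weighted by the
  fraction \<Theta> of upper phases. \<Theta> does not depend on y and comes near 1 and 0 infinitely
  often, so with lower <= upper the extreme limits are the prescribed ones.\<close>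

lemma controlled_adfs:
  assumes w: "\<And>j. j \<ge> threshold 0 \<Longrightarrow> j \<notin> Z \<Longrightarrow>
      real (num j) / real (den j) < w j \<and> w j < real (Suc (num j)) / real (den j)"
    and Z: "density_zero Z"
    and w0: "\<And>j. 0 \<le> w j"
    and le: "\<And>m r x. m \<ge> 1 \<Longrightarrow> r < m \<Longrightarrow> x \<in> {0..1} \<Longrightarrow> f False m r x \<le> f True m r x"
  shows "has_adfs w (f True) (f False)"
  unfolding has_adfs_def
proof (intro allI impI conjI)
  fix m r :: nat assume m: "m \<ge> 1" "r < m"
  define u where "u y n = real (count_in n {0..<y} (\<lambda>n. w (m * n + r))) / real n" for y n
  define \<Theta> where "\<Theta> = phase_average m"
  have u_eq: "u y n = (\<Sum>j<m * n. hit_weight m r y w j) / real (m * n)" for y n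
  proof -
    have "(\<Sum>j<m * n. hit_weight m r y w j) = (\<Sum>j<m * n. if j mod m = r then (if w j < y then real m else 0) else 0)"
      by (intro sum.cong) (auto simp: hit_weight_def)
    also have "\<dots> = (\<Sum>i<n. if w (m * i + r) < y then real m else 0)"
      by (rule sum_residue_class[OF m(2)])
    also have "\<dots> = real m * real (count_in n {0..<y} (\<lambda>n. w (m * n + r)))"
      using w0 by (simp add: sum.If_cases count_in_def lessThan_def Int_def mult.commute)
    finally show ?thesis using m by (simp add: u_def)
  qed
  have \<Theta>01: "0 \<le> \<Theta> n \<and> \<Theta> n \<le> 1" for n unfolding \<Theta>_def by (rule phase_average_bounds)
  have close: "\<forall>\<^sub>F n in sequentially. \<bar>u y n - (f False m r y + \<Theta> n * (f True m r y - f False m r y))\<bar> \<le> \<epsilon>"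
    if y: "y \<in> {0..1}" and \<epsilon>: "\<epsilon> > 0" for y \<epsilon>
  proof -
    define D where "D n = (\<Sum>j<n. hit_weight m r y w j - f (upper_phase (origin j)) m r y) / real n" for n
    have "D \<longlonglongrightarrow> 0" unfolding D_def using hit_average[OF w Z m y] by blast
    then have "(\<lambda>n. D (m * n)) \<longlonglongrightarrow> 0"
      by (rule filterlim_compose) (use m in \<open>intro mult_nat_left_at_top, simp\<close>)
    then have "\<forall>\<^sub>F n in sequentially. \<bar>D (m * n)\<bar> < \<epsilon>"
      using \<epsilon> by (auto simp: tendsto_iff dist_real_def)
    then show ?thesis using eventually_gt_at_top[of 0]
    proof eventually_elim
      case (elim n)
      have "f (upper_phase (origin j)) m r y = f False m r y + phase_weight j * (f True m r y - f False m r y)" for j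
        by (simp add: phase_weight_def)
      then have "D (m * n) = u y n - ((\<Sum>j<m * n. f False m r y) +
          (\<Sum>j<m * n. phase_weight j) * (f True m r y - f False m r y)) / real (m * n)"
        unfolding D_def u_eq by (simp add: sum_subtractf sum.distrib sum_distrib_right diff_divide_distrib)
      also have "\<dots> = u y n - (f False m r y + \<Theta> n * (f True m r y - f False m r y))"
        using elim m by (simp add: \<Theta>_def phase_average_def add_divide_distrib)
      finally show ?case using elim by simp
    qed
  qed
  have freq: "\<exists>\<^sub>F n in sequentially. \<bar>\<Theta> n - of_bool b\<bar> \<le> \<epsilon>" if "\<epsilon> > 0" for \<epsilon> b
    unfolding \<Theta>_def by (rule frequently_phase_average_close[OF m(1) that])
  have d01: "0 \<le> f True m r y - f False m r y \<and> f True m r y - f False m r y \<le> 1" if "y \<in> {0..1}" for y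
    using le[OF m that] evaluable_family.adf_range[OF family m, of y] that
    by (smt (verit) atLeastAtMost_iff)
  show "has_upper_adf (\<lambda>n. w (m * n + r)) (f True m r)"
    unfolding has_upper_adf_def u_def[symmetric]
  proof (intro ballI limsup_mixture[where \<Theta> = \<Theta>, OF \<Theta>01])
    fix y :: real assume y: "y \<in> {0..1}"
    show "0 \<le> f True m r y - f False m r y" "f True m r y - f False m r y \<le> 1" using d01[OF y] by auto
    show "\<forall>\<^sub>F n in sequentially. \<bar>u y n - (f True m r y - (1 - \<Theta> n) * (f True m r y - f False m r y))\<bar> \<le> \<epsilon>"
      if "\<epsilon> > 0" for \<epsilon> using close[OF y that] by (simp add: algebra_simps)
    show "\<exists>\<^sub>F n in sequentially. \<bar>\<Theta> n - 1\<bar> \<le> \<epsilon>" if "\<epsilon> > 0" for \<epsilon> using freq[OF that, of True] by simp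
  qed
  show "has_lower_adf (\<lambda>n. w (m * n + r)) (f False m r)"
    unfolding has_lower_adf_def u_def[symmetric]
  proof (intro ballI liminf_ereal_eq_uminus_limsup limsup_mixture[where \<Theta> = "\<lambda>n. 1 - \<Theta> n"])
    fix y :: real assume y: "y \<in> {0..1}"
    show "0 \<le> f True m r y - f False m r y" "f True m r y - f False m r y \<le> 1" using d01[OF y] by auto
    show "\<forall>\<^sub>F n in sequentially.
        \<bar>- u y n - (- f False m r y - (1 - (1 - \<Theta> n)) * (f True m r y - f False m r y))\<bar> \<le> \<epsilon>"
      if "\<epsilon> > 0" for \<epsilon> using close[OF y that]
    proof eventually_elim
      case (elim n)
      then show ?case by (simp add: abs_le_iff)
    qed
    show "\<exists>\<^sub>F n in sequentially. \<bar>1 - \<Theta> n - 1\<bar> \<le> \<epsilon>" if "\<epsilon> > 0" for \<epsilon> using freq[OF that, of False] by simp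
  qed (use \<Theta>01 in auto)
qed

end

section \<open>Digit bounds\<close>

text \<open>With x = A q / D and z = q / D, a digit e confines q T to [e, e + 1), which must lie
  inside (x, x + z). The +1 and -2 round inwards and also keep the range away from 0 and q - 1. At
  least z - 3 digits remain, hence at least z/8 because z >= 8.\<close>

lemma digit_range:
  fixes q A D :: nat
  assumes D: "A < D" and q: "q \<ge> 8 * D"
  defines "lo \<equiv> A * q div D + 1" and "hi \<equiv> Suc A * q div D - 2"
  shows "1 \<le> lo" "lo < hi" "hi + 2 \<le> q" "real q / real (hi - lo + 1) \<le> 8 * real D"
    and "\<And>T. int lo \<le> \<lfloor>real q * T\<rfloor> \<Longrightarrow> \<lfloor>real q * T\<rfloor> \<le> int hi \<Longrightarrow>
      real A / real D < T \<and> T < real (Suc A) / real D"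
proof -
  define x where "x = real A * real q / real D"
  define z where "z = real q / real D"
  have "real (8 * D) \<le> real q" using q by (simp only: of_nat_le_iff)
  then have z: "z \<ge> 8" using D by (simp add: z_def pos_le_divide_eq)
  have fl: "real (n div D) = of_int \<lfloor>real n / real D\<rfloor>" for n
    by (simp add: floor_divide_of_nat_eq)
  have sucx: "real (Suc A * q) / real D = x + z"
    by (simp add: x_def z_def add_divide_distrib distrib_right)
  have lo: "real lo = of_int \<lfloor>x\<rfloor> + 1" unfolding lo_def of_nat_add fl x_def by simp
  have big: "real (Suc A * q div D) = of_int \<lfloor>x + z\<rfloor>" unfolding fl sucx ..
  have "real (Suc A * q div D) \<ge> 2" unfolding big
  proof -
    have "x \<ge> 0" by (simp add: x_def)
    then have "\<lfloor>x + z\<rfloor> \<ge> 2" using z by linarith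
    then show "2 \<le> real_of_int \<lfloor>x + z\<rfloor>" by linarith
  qed
  then have "Suc A * q div D \<ge> 2" by linarith
  then have hi: "real hi = of_int \<lfloor>x + z\<rfloor> - 2" unfolding hi_def big[symmetric] by simp
  show "1 \<le> lo" by (simp add: lo_def)
  have "real lo < real hi" using lo hi z by linarith
  then show lohi: "lo < hi" by simp
  have "Suc A * q \<le> D * q" using D by (intro mult_right_mono) auto
  then have "Suc A * q div D \<le> D * q div D" by (rule div_le_mono)
  then have "Suc A * q div D \<le> q" using D by simp
  then show "hi + 2 \<le> q" using \<open>Suc A * q div D \<ge> 2\<close> by (simp add: hi_def)
  have cnt: "real (hi - lo + 1) \<ge> z - 3" using lohi lo hi by (simp add: of_nat_diff) linarith
  have "real q = real D * z" using D by (simp add: z_def)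
  also have "\<dots> \<le> 8 * real D * (z - 3)"
  proof -
    have "z \<le> 8 * (z - 3)" using z by simp
    then have "real D * z \<le> real D * (8 * (z - 3))" by (intro mult_left_mono) auto
    then show ?thesis by (simp only: mult_ac)
  qed
  also have "\<dots> \<le> 8 * real D * real (hi - lo + 1)" using cnt by (intro mult_left_mono) auto
  finally show "real q / real (hi - lo + 1) \<le> 8 * real D" by (simp add: pos_divide_le_eq del: of_nat_Suc)
  fix T assume T: "int lo \<le> \<lfloor>real q * T\<rfloor>" "\<lfloor>real q * T\<rfloor> \<le> int hi"
  have q0: "real q > 0" using D q by simp
  have "x < real q * T" using T(1) lo by linarith
  then have 1: "real A / real D < T" using q0 D by (simp add: x_def field_simps)
  have "real q * T < x + z" using T(2) hi by linarith
  also have "x + z = real q * (real (Suc A) / real D)"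
    unfolding sucx[symmetric] by (simp only: of_nat_mult times_divide_eq_right mult.commute)
  finally have "T < real (Suc A) / real D" using q0 by (simp only: mult_less_cancel_left_pos)
  with 1 show "real A / real D < T \<and> T < real (Suc A) / real D" by simp
qed

section \<open>Digit ranges along one sequence of positions\<close>

locale controlled_sequence = controller +
  fixes q p :: "nat \<Rightarrow> nat"
  assumes p_step: "j \<ge> J \<Longrightarrow> p j < p (Suc j)"
    and q_growth: "n \<ge> 1 \<Longrightarrow> i \<ge> 1 \<Longrightarrow> i \<ge> g n \<Longrightarrow> n \<le> q i"
begin

definition lower_digit :: "nat \<Rightarrow> nat" where
  "lower_digit j = num j * q (Suc (p j)) div den j + 1"

definition upper_digit :: "nat \<Rightarrow> nat" where
  "upper_digit j = Suc (num j) * q (Suc (p j)) div den j - 2"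

text \<open>A total substitute for the inverse of p: the search always ends, and
  \<open>p (index n) = n\<close> decides whether position n is controlled.\<close>

definition index :: "nat \<Rightarrow> nat" where
  "index n = (LEAST j. j \<ge> threshold 0 \<and> n \<le> p j)"

lemma p_ge: "j \<ge> J \<Longrightarrow> p j \<ge> j - J"
proof (induction j rule: dec_induct)
  case (step j)
  then show ?case using p_step[of j] by simp
qed simp

lemma p_strict_mono: "J \<le> i \<Longrightarrow> i < j \<Longrightarrow> p i < p j"
proof (induction j)
  case (Suc j)
  then show ?case using p_step[of j] by (cases "i = j") auto
qed simp

lemma J_le_threshold: "J \<le> threshold s"
  by (simp add: threshold_def)

lemma p_unbounded: "\<exists>j. j \<ge> threshold 0 \<and> n \<le> p j"
  using p_ge[of "n + threshold 0"] J_le_threshold[of 0] by (intro exI[of _ "n + threshold 0"]) simp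

lemma index_ge: "index n \<ge> threshold 0"
  using LeastI_ex[OF p_unbounded[of n]] by (simp add: index_def)

lemma index_p:
  assumes "j \<ge> threshold 0"
  shows "index (p j) = j"
  unfolding index_def
proof (rule Least_equality)
  fix i assume i: "i \<ge> threshold 0 \<and> p j \<le> p i"
  show "j \<le> i"
  proof (rule ccontr)
    assume "\<not> j \<le> i"
    then show False using p_strict_mono[of i j] i J_le_threshold[of 0] by simp
  qed
qed (use assms in simp)

lemma required_base_ge: "required_base s \<ge> 8 * resolution s"
proof -
  have "(8 * resolution s) ^ Suc s \<ge> 8 * resolution s"
    using resolution_props(1)[of s] self_le_power[of "8 * resolution s" "Suc s"] by simp
  then show ?thesis by (simp add: required_base_def)
qed

text \<open>\<open>p j - 1\<close> occurs because the growth condition of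
  \<open>hausdorff_dim_digit_box\<close> compares position \<open>p j + 1\<close> with the base two
  places earlier; the summand 3 in \<open>threshold\<close> makes room for it.\<close>

lemma base_ge_required:
  assumes "j \<ge> threshold 0"
  shows "p j \<ge> 2" "q (Suc (p j)) \<ge> required_base (stage (origin j))"
    "q (p j - 1) \<ge> required_base (stage (origin j))"
proof -
  define W where "W = required_base (stage (origin j))"
  have "threshold (stage (origin j)) \<le> j"
    using origin_threshold[OF assms] origin_bounds(1)[OF assms] by simp
  then have j: "g W + J + 3 \<le> j" by (simp add: threshold_def W_def)
  then have pj: "p j \<ge> g W + 3" using p_ge[of j] by simp
  then show "p j \<ge> 2" by simp
  have "W \<ge> 1" using required_base_ge[of "stage (origin j)"] resolution_props(1)[of "stage (origin j)"]
    by (simp add: W_def)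
  then show "q (Suc (p j)) \<ge> required_base (stage (origin j))" "q (p j - 1) \<ge> required_base (stage (origin j))"
    unfolding W_def[symmetric] using pj by (auto intro!: q_growth)
qed

lemma digit_bounds:
  assumes j: "j \<ge> threshold 0"
  shows "1 \<le> lower_digit j" "lower_digit j < upper_digit j" "upper_digit j + 2 \<le> q (Suc (p j))"
    "real (q (Suc (p j))) / real (upper_digit j - lower_digit j + 1) \<le> 8 * real (den j)"
    and "\<And>T. int (lower_digit j) \<le> \<lfloor>real (q (Suc (p j))) * T\<rfloor> \<Longrightarrow> \<lfloor>real (q (Suc (p j))) * T\<rfloor> \<le> int (upper_digit j) \<Longrightarrow>
      real (num j) / real (den j) < T \<and> T < real (Suc (num j)) / real (den j)"
proof -
  have "q (Suc (p j)) \<ge> 8 * den j"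
    using base_ge_required(2)[OF j] required_base_ge[of "stage (origin j)"] by (simp add: den_def)
  note * = digit_range[OF num_less_den[OF j] this, folded lower_digit_def upper_digit_def]
  show "1 \<le> lower_digit j" "lower_digit j < upper_digit j" "upper_digit j + 2 \<le> q (Suc (p j))"
    "real (q (Suc (p j))) / real (upper_digit j - lower_digit j + 1) \<le> 8 * real (den j)"
    using *(1-4) by auto
  show "\<And>T. int (lower_digit j) \<le> \<lfloor>real (q (Suc (p j))) * T\<rfloor> \<Longrightarrow> \<lfloor>real (q (Suc (p j))) * T\<rfloor> \<le> int (upper_digit j) \<Longrightarrow>
      real (num j) / real (den j) < T \<and> T < real (Suc (num j)) / real (den j)"
    by (rule *(5))
qed

text \<open>The loss 8 D is at most the (s+1)-th root of the base at \<open>p j - 1\<close>, and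
  1/(s + 1) falls below \<epsilon> as the stages tend to infinity.\<close>

lemma digit_ratio_small:
  assumes \<epsilon>: "\<epsilon> > 0"
  shows "\<exists>X. \<forall>j\<ge>threshold 0. p j \<ge> X \<longrightarrow>
    real (q (Suc (p j))) / real (upper_digit j - lower_digit j + 1) \<le> real (q (p j - 1)) powr \<epsilon>"
proof -
  obtain S :: nat where S: "1 / \<epsilon> < real S" using reals_Archimedean2 by blast
  obtain X where X: "\<And>j. j \<ge> X \<Longrightarrow> stage (origin j) \<ge> S" using stage_origin_unbounded by blast
  show ?thesis
  proof (intro exI[of _ "p (X + J)"] allI impI)
    fix j assume j: "j \<ge> threshold 0" and pj: "p (X + J) \<le> p j"
    have "j \<ge> X"
    proof (rule ccontr)
      assume "\<not> X \<le> j"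
      then have "p j < p (X + J)" using J_le_threshold[of 0] j by (intro p_strict_mono) auto
      then show False using pj by simp
    qed
    define s where "s = stage (origin j)"
    have s: "s \<ge> S" using X[OF \<open>j \<ge> X\<close>] by (simp add: s_def)
    define d where "d = 8 * real (den j)"
    have d1: "d \<ge> 1" using resolution_props(1)[of s] by (simp add: d_def den_def s_def)
    have "real (required_base s) = d ^ Suc s"
      by (simp add: required_base_def d_def den_def s_def)
    then have "real (required_base s) = d powr real (Suc s)"
      using d1 by (simp only: powr_realpow)
    have "1 < \<epsilon> * real S" using S \<epsilon> by (simp add: field_simps)
    also have "\<dots> \<le> \<epsilon> * real (Suc s)" using s \<epsilon> by (intro mult_left_mono) auto
    finally have "d powr 1 \<le> d powr (real (Suc s) * \<epsilon>)" using d1 by (intro powr_mono) (auto simp: mult.commute)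
    also have "\<dots> = real (required_base s) powr \<epsilon>"
      unfolding \<open>real (required_base s) = d powr real (Suc s)\<close> by (simp add: powr_powr)
    also have "\<dots> \<le> real (q (p j - 1)) powr \<epsilon>"
      using base_ge_required(3)[OF j] \<epsilon> by (intro powr_mono2) (auto simp: s_def)
    finally show "real (q (Suc (p j))) / real (upper_digit j - lower_digit j + 1) \<le> real (q (p j - 1)) powr \<epsilon>"
      using digit_bounds(4)[OF j] d1 by (simp add: d_def)
  qed
qed

end

section \<open>The joint digit box of two sequences of positions\<close>

locale controlled_box =
  c1: controlled_sequence f1 t1 ft1 h1 g J1 q p1 + c2: controlled_sequence f2 t2 ft2 h2 g J2 q p2
  for f1 t1 ft1 h1 J1 p1 f2 t2 ft2 h2 J2 p2 g q +
  fixes Q :: "nat \<Rightarrow> int"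
  assumes Q: "basic_sequence Q" and q: "n \<ge> 1 \<Longrightarrow> Q n = int (q n)"
    and collision: "density_zero {j. \<exists>i. p2 j = p1 i}"
begin

text \<open>Where both sequences hit a position, the first one, which is sparse in the second, decides.\<close>

definition lower_bound :: "nat \<Rightarrow> nat" where
  "lower_bound n =
     (if p1 (c1.index (n - 1)) = n - 1 then c1.lower_digit (c1.index (n - 1))
      else if p2 (c2.index (n - 1)) = n - 1 then c2.lower_digit (c2.index (n - 1))
      else if 3 \<le> q n then 1 else 0)"

definition upper_bound :: "nat \<Rightarrow> nat" where
  "upper_bound n =
     (if p1 (c1.index (n - 1)) = n - 1 then c1.upper_digit (c1.index (n - 1))
      else if p2 (c2.index (n - 1)) = n - 1 then c2.upper_digit (c2.index (n - 1))
      else q n - 2)"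

lemma bounds_first:
  assumes "j \<ge> c1.threshold 0"
  shows "lower_bound (Suc (p1 j)) = c1.lower_digit j" "upper_bound (Suc (p1 j)) = c1.upper_digit j"
  using c1.index_p[OF assms] by (auto simp: lower_bound_def upper_bound_def)

lemma bounds_second:
  assumes "j \<ge> c2.threshold 0" "\<nexists>i. p2 j = p1 i"
  shows "lower_bound (Suc (p2 j)) = c2.lower_digit j" "upper_bound (Suc (p2 j)) = c2.upper_digit j"
  using c2.index_p[OF assms(1)] assms(2) by (auto simp: lower_bound_def upper_bound_def) metis+

lemma position_cases:
  assumes "n \<ge> 1"
  obtains j where "j \<ge> c1.threshold 0" "n = Suc (p1 j)"
      "lower_bound n = c1.lower_digit j" "upper_bound n = c1.upper_digit j"
  | j where "j \<ge> c2.threshold 0" "n = Suc (p2 j)"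
      "lower_bound n = c2.lower_digit j" "upper_bound n = c2.upper_digit j"
  | "lower_bound n = (if 3 \<le> q n then 1 else 0)" "upper_bound n = q n - 2"
proof -
  consider "p1 (c1.index (n - 1)) = n - 1" | "p1 (c1.index (n - 1)) \<noteq> n - 1" "p2 (c2.index (n - 1)) = n - 1"
    | "p1 (c1.index (n - 1)) \<noteq> n - 1" "p2 (c2.index (n - 1)) \<noteq> n - 1" by blast
  then show ?thesis
  proof cases
    case 1
    then show ?thesis using assms c1.index_ge[of "n - 1"]
      by (intro that(1)[of "c1.index (n - 1)"]) (auto simp: lower_bound_def upper_bound_def)
  next
    case 2
    then show ?thesis using assms c2.index_ge[of "n - 1"]
      by (intro that(2)[of "c2.index (n - 1)"]) (auto simp: lower_bound_def upper_bound_def)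
  next
    case 3
    then show ?thesis by (intro that(3)) (auto simp: lower_bound_def upper_bound_def)
  qed
qed

definition box :: "real set" where
  "box = digit_box Q (\<lambda>n. int (lower_bound n)) (\<lambda>n. int (upper_bound n))"

lemma q_ge_2: "n \<ge> 1 \<Longrightarrow> q n \<ge> 2"
  using Q q[of n] by (auto simp: basic_sequence_def)

lemma q_eventually_ge: "\<forall>\<^sub>F n in sequentially. k \<le> q n"
proof (rule eventually_sequentiallyI)
  fix n assume "g (Suc k) + 1 \<le> n"
  then show "k \<le> q n" using c1.q_growth[of "Suc k" n] by simp
qed

lemma hausdorff_dim_box: "hausdorff_dim box = 1"
proof -
  \<comment> \<open>From base 4 on, the free range 1, ..., q - 2 has at least two digits and
    contains at least half of all digits.\<close>
  obtain n0 where n0: "\<And>n. n \<ge> n0 \<Longrightarrow> 4 \<le> q n"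
    using q_eventually_ge[of 4] unfolding eventually_sequentially by blast
  show ?thesis
    unfolding box_def
  proof (rule hausdorff_dim_digit_box[OF Q, of "\<lambda>n. int (lower_bound n)" "\<lambda>n. int (upper_bound n)" "Suc n0"])
    fix n :: nat assume n: "n \<ge> 1"
    show "0 \<le> int (lower_bound n) \<and> int (lower_bound n) \<le> int (upper_bound n) \<and> int (upper_bound n) \<le> Q n - 1"
      using n
    proof (cases rule: position_cases)
      case (1 j)
      then show ?thesis using c1.digit_bounds(2,3)[of j] q[OF n] by simp
    next
      case (2 j)
      then show ?thesis using c2.digit_bounds(2,3)[of j] q[OF n] by simp
    next
      case 3
      then show ?thesis using q[OF n] q_ge_2[OF n] by auto
    qed
  next
    fix n :: nat assume n: "n \<ge> Suc n0"
    then have n1: "n \<ge> 1" by simp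
    show "1 \<le> int (lower_bound n) \<and> int (lower_bound n) < int (upper_bound n) \<and> int (upper_bound n) \<le> Q n - 2"
      using n1
    proof (cases rule: position_cases)
      case (1 j)
      then show ?thesis using c1.digit_bounds(1-3)[of j] q[OF n1] by simp
    next
      case (2 j)
      then show ?thesis using c2.digit_bounds(1-3)[of j] q[OF n1] by simp
    next
      case 3
      then show ?thesis using q[OF n1] n0[of n] n by auto
    qed
  next
    fix \<epsilon> :: real assume \<epsilon>: "\<epsilon> > 0"
    obtain X1 where X1: "\<And>j. j \<ge> c1.threshold 0 \<Longrightarrow> p1 j \<ge> X1 \<Longrightarrow>
        real (q (Suc (p1 j))) / real (c1.upper_digit j - c1.lower_digit j + 1) \<le> real (q (p1 j - 1)) powr \<epsilon>"
      using c1.digit_ratio_small[OF \<epsilon>] by blast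
    obtain X2 where X2: "\<And>j. j \<ge> c2.threshold 0 \<Longrightarrow> p2 j \<ge> X2 \<Longrightarrow>
        real (q (Suc (p2 j))) / real (c2.upper_digit j - c2.lower_digit j + 1) \<le> real (q (p2 j - 1)) powr \<epsilon>"
      using c2.digit_ratio_small[OF \<epsilon>] by blast
    \<comment> \<open>Chosen so that 2 <= q^\<epsilon> for q >= k, which pays for the factor 2 lost
      at free positions.\<close>
    obtain k :: nat where k: "2 powr (1 / \<epsilon>) < real k" using reals_Archimedean2 by blast
    have conv: "of_int (Q (n + 2)) / of_int (int (upper_bound (n + 2)) - int (lower_bound (n + 2)) + 1)
        = real (q (n + 2)) / real (upper_bound (n + 2) - lower_bound (n + 2) + 1)"
      if "lower_bound (n + 2) \<le> upper_bound (n + 2)" for n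
      using that q[of "n + 2"] by (simp add: of_nat_diff)
    show "\<forall>\<^sub>F n in sequentially. of_int (Q (n + 2)) /
        of_int (int (upper_bound (n + 2)) - int (lower_bound (n + 2)) + 1) \<le> real_of_int (Q n) powr \<epsilon>"
      using q_eventually_ge[of k] eventually_ge_at_top[of "X1 + X2 + n0 + 1"]
    proof eventually_elim
      case (elim n)
      have qn: "real_of_int (Q n) = real (q n)" using q[of n] elim by simp
      have "n + 2 \<ge> 1" by simp
      then show ?case
      proof (cases rule: position_cases)
        case (1 j)
        have pj: "p1 j = Suc n" using 1(2) by simp
        then have "real (q (n + 2)) / real (upper_bound (n + 2) - lower_bound (n + 2) + 1) \<le> real (q n) powr \<epsilon>"
          using X1[OF 1(1)] elim unfolding 1(3,4) by (simp add: pj)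
        moreover have "lower_bound (n + 2) \<le> upper_bound (n + 2)"
          using c1.digit_bounds(2)[OF 1(1)] 1(3,4) by simp
        ultimately show ?thesis unfolding qn by (simp only: conv)
      next
        case (2 j)
        have pj: "p2 j = Suc n" using 2(2) by simp
        then have "real (q (n + 2)) / real (upper_bound (n + 2) - lower_bound (n + 2) + 1) \<le> real (q n) powr \<epsilon>"
          using X2[OF 2(1)] elim unfolding 2(3,4) by (simp add: pj)
        moreover have "lower_bound (n + 2) \<le> upper_bound (n + 2)"
          using c2.digit_bounds(2)[OF 2(1)] 2(3,4) by simp
        ultimately show ?thesis unfolding qn by (simp only: conv)
      next
        case 3
        have q4: "q (n + 2) \<ge> 4" using n0 elim by simp
        have "real (q (n + 2)) / real (upper_bound (n + 2) - lower_bound (n + 2) + 1) \<le> 2"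
          using 3 q4 by (simp add: of_nat_diff divide_simps)
        also have "2 = (2 powr (1 / \<epsilon>)) powr \<epsilon>" using \<epsilon> by (simp add: powr_powr)
        also have "\<dots> \<le> real (q n) powr \<epsilon>" using k elim \<epsilon> by (intro powr_mono2) auto
        finally show ?thesis using 3 q4 by (subst conv) (auto simp: qn)
      qed
    qed
  qed
qed

lemma box_adfs:
  assumes x: "x \<in> box"
    and le1: "\<And>m r y. m \<ge> 1 \<Longrightarrow> r < m \<Longrightarrow> y \<in> {0..1} \<Longrightarrow> f1 False m r y \<le> f1 True m r y"
    and le2: "\<And>m r y. m \<ge> 1 \<Longrightarrow> r < m \<Longrightarrow> y \<in> {0..1} \<Longrightarrow> f2 False m r y \<le> f2 True m r y"
  shows "has_adfs (\<lambda>j. cantor_T Q (p1 j) x) (f1 True) (f1 False)"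
    and "has_adfs (\<lambda>j. cantor_T Q (p2 j) x) (f2 True) (f2 False)"
proof -
  have digit: "cantor_digit Q x (Suc n) = \<lfloor>real (q (Suc n)) * cantor_T Q n x\<rfloor>" for n
    using cantor_base.digit_Suc[OF cantor_base.intro, OF Q, of x n] q[of "Suc n"] by simp
  have bnd: "int (lower_bound (Suc n)) \<le> \<lfloor>real (q (Suc n)) * cantor_T Q n x\<rfloor>"
    "\<lfloor>real (q (Suc n)) * cantor_T Q n x\<rfloor> \<le> int (upper_bound (Suc n))" for n
    using x unfolding box_def digit_box_def digit[symmetric] by auto
  show "has_adfs (\<lambda>j. cantor_T Q (p1 j) x) (f1 True) (f1 False)"
  \<comment> \<open>The first sequence prevails at every collision, so it has no exceptional
    indices.\<close>
  proof (rule c1.controlled_adfs[where Z = "{}"])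
    show "real (c1.num j) / real (c1.den j) < cantor_T Q (p1 j) x \<and>
        cantor_T Q (p1 j) x < real (Suc (c1.num j)) / real (c1.den j)" if "j \<ge> c1.threshold 0" for j
      using bnd[of "p1 j"] that by (intro c1.digit_bounds(5)) (auto simp: bounds_first)
  qed (use le1 cantor_T_bounds(1) in \<open>auto simp: density_zero_def\<close>)
  show "has_adfs (\<lambda>j. cantor_T Q (p2 j) x) (f2 True) (f2 False)"
  proof (rule c2.controlled_adfs[OF _ collision])
    show "real (c2.num j) / real (c2.den j) < cantor_T Q (p2 j) x \<and>
        cantor_T Q (p2 j) x < real (Suc (c2.num j)) / real (c2.den j)"
      if "j \<ge> c2.threshold 0" "j \<notin> {j. \<exists>i. p2 j = p1 i}" for j
      using bnd[of "p2 j"] that by (intro c2.digit_bounds(5)) (auto simp: bounds_second)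
  qed (use le2 cantor_T_bounds(1) in auto)
qed

end

section \<open>Total recursive functions\<close>

text \<open>Membership in \<^const>\<open>total_recursive\<close> up to the values on lists of the wrong length.\<close>

definition recfun :: "nat \<Rightarrow> (nat list \<Rightarrow> nat) \<Rightarrow> bool" where
  "recfun k e \<longleftrightarrow> (\<exists>F. total_recursive k F \<and> (\<forall>xs. length xs = k \<longrightarrow> F xs = e xs))"

definition recpred :: "nat \<Rightarrow> (nat list \<Rightarrow> bool) \<Rightarrow> bool" where
  "recpred k P \<longleftrightarrow> recfun k (\<lambda>xs. if P xs then 1 else 0)"

lemma recfun_total_recursive: "total_recursive k F \<Longrightarrow> recfun k F"
  unfolding recfun_def by blast

lemma recfun_cong:
  assumes "recfun k e" "\<And>xs. length xs = k \<Longrightarrow> e xs = e' xs"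
  shows "recfun k e'"
  using assms unfolding recfun_def by auto

lemma recfun_comp:
  assumes "recfun (length gs) h" "\<And>g. g \<in> set gs \<Longrightarrow> recfun k g"
  shows "recfun k (\<lambda>xs. h (map (\<lambda>g. g xs) gs))"
proof -
  obtain H where H: "total_recursive (length gs) H" "\<And>xs. length xs = length gs \<Longrightarrow> H xs = h xs"
    using assms(1) unfolding recfun_def by auto
  obtain G where G: "\<And>g. g \<in> set gs \<Longrightarrow> total_recursive k (G g)"
    "\<And>g xs. g \<in> set gs \<Longrightarrow> length xs = k \<Longrightarrow> G g xs = g xs"
    using assms(2) unfolding recfun_def by metis
  have "total_recursive k (\<lambda>xs. H (map (\<lambda>g. g xs) (map G gs)))"
    by (rule tr_comp) (use H G in auto)
  moreover have "H (map (\<lambda>g. g xs) (map G gs)) = h (map (\<lambda>g. g xs) gs)" if "length xs = k" for xs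
  proof -
    have "map (\<lambda>g. g xs) (map G gs) = map (\<lambda>g. g xs) gs" using G(2) that by simp
    then show ?thesis using H(2)[of "map (\<lambda>g. g xs) gs"] by (simp only: length_map)
  qed
  ultimately show ?thesis unfolding recfun_def by blast
qed

lemma recfun_nth: "i < k \<Longrightarrow> recfun k (\<lambda>xs. xs ! i)"
  by (intro recfun_total_recursive tr_proj)

text \<open>Bounded quantifiers and searches put their variable in front of the argument list, so
  the outer variables appear below iterated \<open>tl\<close>.\<close>

lemma recfun_tl_nth: "Suc i < k \<Longrightarrow> recfun k (\<lambda>xs. tl xs ! i)"
  by (rule recfun_cong[OF recfun_nth[of "Suc i"]]) (auto simp: nth_tl)

lemma recfun_tl2_nth: "Suc (Suc i) < k \<Longrightarrow> recfun k (\<lambda>xs. tl (tl xs) ! i)"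
  by (rule recfun_cong[OF recfun_nth[of "Suc (Suc i)"]]) (auto simp: nth_tl)

lemma recfun_tl3_nth: "Suc (Suc (Suc i)) < k \<Longrightarrow> recfun k (\<lambda>xs. tl (tl (tl xs)) ! i)"
  by (rule recfun_cong[OF recfun_nth[of "Suc (Suc (Suc i))"]]) (auto simp: nth_tl)

lemma recfun_tl4_nth: "Suc (Suc (Suc (Suc i))) < k \<Longrightarrow> recfun k (\<lambda>xs. tl (tl (tl (tl xs))) ! i)"
  by (rule recfun_cong[OF recfun_nth[of "Suc (Suc (Suc (Suc i)))"]]) (auto simp: nth_tl)

lemma recfun_hd: "0 < k \<Longrightarrow> recfun k (\<lambda>xs. hd xs)"
  by (rule recfun_cong[OF recfun_nth[of 0]]) (auto simp: hd_conv_nth)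

lemma recfun_hd_tl: "Suc 0 < k \<Longrightarrow> recfun k (\<lambda>xs. hd (tl xs))"
  by (rule recfun_cong[OF recfun_nth[of "Suc 0"]]) (auto simp: hd_drop_conv_nth[symmetric] drop_Suc)

lemma recfun_hd_tl2: "Suc (Suc 0) < k \<Longrightarrow> recfun k (\<lambda>xs. hd (tl (tl xs)))"
  by (rule recfun_cong[OF recfun_nth[of "Suc (Suc 0)"]]) (auto simp: hd_drop_conv_nth[symmetric] drop_Suc)

lemma recfun_hd_tl3: "Suc (Suc (Suc 0)) < k \<Longrightarrow> recfun k (\<lambda>xs. hd (tl (tl (tl xs))))"
  by (rule recfun_cong[OF recfun_nth[of "Suc (Suc (Suc 0))"]]) (auto simp: hd_drop_conv_nth[symmetric] drop_Suc)

lemma recfun_Suc: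
  assumes "recfun k a"
  shows "recfun k (\<lambda>xs. Suc (a xs))"
  using recfun_comp[of "[a]" "\<lambda>xs. Suc (xs ! 0)" k] assms recfun_total_recursive[OF tr_succ]
  by simp

lemma recfun_const: "recfun k (\<lambda>xs. c)"
  by (induction c) (auto intro: recfun_Suc recfun_total_recursive tr_zero)

lemma recfun_comp1:
  assumes "recfun 1 (\<lambda>xs. f (xs ! 0))" "recfun k a"
  shows "recfun k (\<lambda>xs. f (a xs))"
  using recfun_comp[of "[a]" "\<lambda>xs. f (xs ! 0)" k] assms by simp

lemma recfun_comp2:
  assumes "recfun 2 (\<lambda>xs. f (xs ! 0) (xs ! 1))" "recfun k a" "recfun k b"
  shows "recfun k (\<lambda>xs. f (a xs) (b xs))"
  using recfun_comp[of "[a, b]" "\<lambda>xs. f (xs ! 0) (xs ! 1)" k] assms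
  by (auto simp: numeral_2_eq_2)

lemma recfun_comp3:
  assumes "recfun 3 (\<lambda>xs. f (xs ! 0) (xs ! 1) (xs ! 2))" "recfun k a" "recfun k b" "recfun k c"
  shows "recfun k (\<lambda>xs. f (a xs) (b xs) (c xs))"
  using recfun_comp[of "[a, b, c]" "\<lambda>xs. f (xs ! 0) (xs ! 1) (xs ! 2)" k] assms
  by (auto simp: numeral_2_eq_2 numeral_3_eq_3)

lemma recfun_comp4:
  assumes "recfun 4 (\<lambda>xs. f (xs ! 0) (xs ! 1) (xs ! 2) (xs ! 3))"
    "recfun k a" "recfun k b" "recfun k c" "recfun k d"
  shows "recfun k (\<lambda>xs. f (a xs) (b xs) (c xs) (d xs))"
  using recfun_comp[of "[a, b, c, d]" "\<lambda>xs. f (xs ! 0) (xs ! 1) (xs ! 2) (xs ! 3)" k] assms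
  by (auto simp: eval_nat_numeral)

lemma recpred_comp1:
  assumes "recpred 1 (\<lambda>xs. f (xs ! 0))" "recfun k a"
  shows "recpred k (\<lambda>xs. f (a xs))"
  using assms recfun_comp1[of "\<lambda>x. if f x then 1 else 0"] unfolding recpred_def by simp

text \<open>Primitive recursion runs over the first argument; substituting an expression in the
  remaining ones yields recursion up to an arbitrary recursive bound.\<close>

lemma recfun_cons_env:
  assumes "recfun (Suc k) (\<lambda>ys. f (hd ys) (tl ys))" "recfun k b"
  shows "recfun k (\<lambda>xs. f (b xs) xs)"
proof -
  define gs where "gs = b # map (\<lambda>i xs. xs ! i) [0..<k]"
  have "recfun k (\<lambda>xs. (\<lambda>ys. f (hd ys) (tl ys)) (map (\<lambda>g. g xs) gs))"
    by (rule recfun_comp) (use assms recfun_nth in \<open>auto simp: gs_def\<close>)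
  then show ?thesis
  proof (rule recfun_cong)
    fix xs :: "nat list" assume "length xs = k"
    then have "map (\<lambda>g. g xs) gs = b xs # xs"
      by (auto simp: gs_def comp_def map_nth)
    then show "f (hd (map (\<lambda>g. g xs) gs)) (tl (map (\<lambda>g. g xs) gs)) = f (b xs) xs" by simp
  qed
qed

lemma recfun_rec_nat:
  assumes "recfun k b" "recfun k g"
    and "recfun (Suc (Suc k)) (\<lambda>ys. h (hd ys) (hd (tl ys)) (tl (tl ys)))"
  shows "recfun k (\<lambda>xs. rec_nat (g xs) (\<lambda>n v. h n v xs) (b xs))"
proof -
  obtain G where G: "total_recursive k G" "\<And>xs. length xs = k \<Longrightarrow> G xs = g xs"
    using assms(2) unfolding recfun_def by blast
  obtain H where H: "total_recursive (Suc (Suc k)) H"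
    "\<And>ys. length ys = Suc (Suc k) \<Longrightarrow> H ys = h (hd ys) (hd (tl ys)) (tl (tl ys))"
    using assms(3) unfolding recfun_def by blast
  have "recfun (Suc k) (\<lambda>xs. rec_nat (G (tl xs)) (\<lambda>n v. H (n # v # tl xs)) (hd xs))"
    by (rule recfun_total_recursive[OF tr_primrec]) (use G(1) H(1) in simp_all)
  then have "recfun (Suc k) (\<lambda>ys. rec_nat (g (tl ys)) (\<lambda>n v. h n v (tl ys)) (hd ys))"
    by (rule recfun_cong) (simp add: G H)
  from recfun_cons_env[where f = "\<lambda>y xs. rec_nat (g xs) (\<lambda>n v. h n v xs) y", OF this assms(1)]
  show ?thesis .
qed

lemma recfun_add:
  assumes "recfun k a" "recfun k b"
  shows "recfun k (\<lambda>xs. a xs + b xs)"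
proof -
  have "recfun k (\<lambda>xs. rec_nat (a xs) (\<lambda>n v. Suc v) (b xs))"
    by (intro recfun_rec_nat assms recfun_Suc recfun_hd_tl) simp
  moreover have "rec_nat x (\<lambda>n v. Suc v) y = x + y" for x y :: nat by (induction y) auto
  ultimately show ?thesis by simp
qed

lemma recfun_mult:
  assumes "recfun k a" "recfun k b"
  shows "recfun k (\<lambda>xs. a xs * b xs)"
proof -
  have "recfun (Suc (Suc k)) (\<lambda>ys. a (tl (tl ys)))"
  proof -
    have "recfun (Suc (Suc k)) (\<lambda>ys. a (map (\<lambda>g. g ys) (map (\<lambda>i ys. ys ! Suc (Suc i)) [0..<k])))"
      by (rule recfun_comp) (use assms(1) recfun_nth in auto)
    then show ?thesis
    proof (rule recfun_cong)
      fix ys :: "nat list" assume "length ys = Suc (Suc k)"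
      then have "map (\<lambda>g. g ys) (map (\<lambda>i ys. ys ! Suc (Suc i)) [0..<k]) = tl (tl ys)"
        by (auto intro!: nth_equalityI simp: nth_tl)
      then show "a (map (\<lambda>g. g ys) (map (\<lambda>i ys. ys ! Suc (Suc i)) [0..<k])) = a (tl (tl ys))" by simp
    qed
  qed
  then have "recfun k (\<lambda>xs. rec_nat 0 (\<lambda>n v. v + a xs) (b xs))"
    by (intro recfun_rec_nat assms recfun_const recfun_add recfun_hd_tl) simp_all
  moreover have "rec_nat 0 (\<lambda>n v. v + x) y = x * y" for x y :: nat by (induction y) auto
  ultimately show ?thesis by simp
qed

lemma recfun_diff:
  assumes "recfun k a" "recfun k b"
  shows "recfun k (\<lambda>xs. a xs - b xs)"
proof -
  have pred: "recfun k (\<lambda>xs. c xs - 1)" if "recfun k c" for k c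
  proof -
    have "recfun k (\<lambda>xs. rec_nat 0 (\<lambda>n v. n) (c xs))"
      by (intro recfun_rec_nat that recfun_const recfun_hd) simp
    moreover have "rec_nat 0 (\<lambda>n v. n) x = x - 1" for x :: nat by (cases x) auto
    ultimately show ?thesis by simp
  qed
  have "recfun k (\<lambda>xs. rec_nat (a xs) (\<lambda>n v. v - 1) (b xs))"
    by (intro recfun_rec_nat assms pred recfun_hd_tl) simp
  moreover have "rec_nat x (\<lambda>n v. v - 1) y = x - y" for x y :: nat by (induction y) auto
  ultimately show ?thesis by simp
qed

lemma recpred_le:
  assumes "recfun k a" "recfun k b"
  shows "recpred k (\<lambda>xs. a xs \<le> b xs)"
  unfolding recpred_def
  by (rule recfun_cong[OF recfun_diff[OF recfun_const[of _ 1] recfun_diff[OF assms]]]) auto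

lemma recpred_less:
  assumes "recfun k a" "recfun k b"
  shows "recpred k (\<lambda>xs. a xs < b xs)"
  using recpred_le[OF recfun_Suc[OF assms(1)] assms(2)] by (simp add: Suc_le_eq)

lemma recpred_not:
  assumes "recpred k P"
  shows "recpred k (\<lambda>xs. \<not> P xs)"
  unfolding recpred_def
  by (rule recfun_cong[OF recfun_diff[OF recfun_const[of _ 1] assms[unfolded recpred_def]]]) auto

lemma recpred_conj:
  assumes "recpred k P" "recpred k R"
  shows "recpred k (\<lambda>xs. P xs \<and> R xs)"
  unfolding recpred_def
  by (rule recfun_cong[OF recfun_mult[OF assms[unfolded recpred_def]]]) auto

lemma recpred_disj:
  assumes "recpred k P" "recpred k R"
  shows "recpred k (\<lambda>xs. P xs \<or> R xs)"
  using recpred_not[OF recpred_conj[OF recpred_not[OF assms(1)] recpred_not[OF assms(2)]]] by simp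

lemma recpred_eq:
  assumes "recfun k a" "recfun k b"
  shows "recpred k (\<lambda>xs. a xs = b xs)"
  using recpred_conj[OF recpred_le[OF assms] recpred_le[OF assms(2,1)]] by (simp add: eq_iff)

lemma recfun_if:
  assumes "recpred k P" "recfun k a" "recfun k b"
  shows "recfun k (\<lambda>xs. if P xs then a xs else b xs)"
  by (rule recfun_cong[OF recfun_add[OF recfun_mult[OF assms(1)[unfolded recpred_def] assms(2)]
        recfun_mult[OF recpred_not[OF assms(1), unfolded recpred_def] assms(3)]]]) auto

lemma recfun_Least:
  assumes "recpred (Suc k) (\<lambda>ys. P (hd ys) (tl ys))" "\<And>xs. length xs = k \<Longrightarrow> \<exists>y. P y xs"
  shows "recfun k (\<lambda>xs. LEAST y. P y xs)"
proof -
  obtain F where F: "total_recursive (Suc k) F"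
    "\<And>ys. length ys = Suc k \<Longrightarrow> F ys = (if P (hd ys) (tl ys) then 0 else 1)"
    using recpred_not[OF assms(1)] unfolding recpred_def recfun_def by auto
  have *: "F (y # xs) = 0 \<longleftrightarrow> P y xs" if "length xs = k" for y xs using F(2)[of "y # xs"] that by auto
  have "recfun k (\<lambda>xs. LEAST y. F (y # xs) = 0)"
    by (rule recfun_total_recursive[OF tr_minim[OF F(1)]]) (use * assms(2) in auto)
  then show ?thesis by (rule recfun_cong) (simp add: *)
qed

lemma recpred_All_less:
  assumes "recfun k b" "recpred (Suc k) (\<lambda>ys. P (hd ys) (tl ys))"
  shows "recpred k (\<lambda>xs. \<forall>i<b xs. P i xs)"
proof -
  have "recfun (Suc (Suc k)) (\<lambda>ys. (\<lambda>zs. if P (hd zs) (tl zs) then 1 else 0)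
      (map (\<lambda>g. g ys) (hd # map (\<lambda>i ys. ys ! Suc (Suc i)) [0..<k])))"
    by (rule recfun_comp) (use assms(2)[unfolded recpred_def] recfun_nth recfun_hd in auto)
  then have P: "recfun (Suc (Suc k)) (\<lambda>ys. if P (hd ys) (tl (tl ys)) then 1 else 0)"
  proof (rule recfun_cong)
    fix ys :: "nat list" assume "length ys = Suc (Suc k)"
    then have "map (\<lambda>g. g ys) (hd # map (\<lambda>i ys. ys ! Suc (Suc i)) [0..<k]) = hd ys # tl (tl ys)"
      by (auto intro!: nth_equalityI simp: nth_tl)
    then show "(\<lambda>zs. if P (hd zs) (tl zs) then 1 else 0)
      (map (\<lambda>g. g ys) (hd # map (\<lambda>i ys. ys ! Suc (Suc i)) [0..<k]))
      = (if P (hd ys) (tl (tl ys)) then 1 else 0)" by (simp only: list.sel)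
  qed
  have "recfun k (\<lambda>xs. rec_nat 1 (\<lambda>n v. v * (if P n xs then 1 else 0)) (b xs))"
    by (intro recfun_rec_nat assms(1) recfun_const recfun_mult P recfun_hd_tl) simp
  moreover have "rec_nat 1 (\<lambda>n v. v * (if R n then 1 else 0)) y = (if \<forall>i<y. R i then 1 else (0::nat))"
    for R y by (induction y) (auto simp: less_Suc_eq)
  ultimately show ?thesis unfolding recpred_def by simp
qed

lemma recpred_Ex_less:
  assumes "recfun k b" "recpred (Suc k) (\<lambda>ys. P (hd ys) (tl ys))"
  shows "recpred k (\<lambda>xs. \<exists>i<b xs. P i xs)"
  using recpred_not[OF recpred_All_less[OF assms(1) recpred_not[OF assms(2)]]] by simp

lemmas rec_intros = recfun_nth recfun_tl_nth recfun_tl2_nth recfun_tl3_nth recfun_tl4_nth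
  recfun_hd recfun_hd_tl recfun_hd_tl2 recfun_hd_tl3 recfun_const recfun_Suc recfun_add recfun_mult
  recfun_diff recpred_le recpred_less recpred_not recpred_conj recpred_disj recpred_eq
  recfun_if recpred_All_less recpred_Ex_less

lemma recfun_div:
  assumes "recfun k a" "recfun k b"
  shows "recfun k (\<lambda>xs. a xs div b xs)"
proof -
  \<comment> \<open>The alternative y = 0 lets the search end in every case; it then returns 0, the
    value of x div 0.\<close>
  have eq: "(LEAST q. y = 0 \<or> x < Suc q * y) = x div y" for x y :: nat
  proof (rule Least_equality)
    show "y = 0 \<or> x < Suc (x div y) * y"
      using dividend_less_div_times[of y x] by (auto simp: add.commute)
    show "x div y \<le> q" if "y = 0 \<or> x < Suc q * y" for q
      using that less_mult_imp_div_less[of x "Suc q" y] by auto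
  qed
  have "recfun 2 (\<lambda>xs. LEAST q. xs ! 1 = 0 \<or> xs ! 0 < Suc q * xs ! 1)"
  proof (rule recfun_Least)
    show "recpred (Suc 2) (\<lambda>ys. tl ys ! 1 = 0 \<or> tl ys ! 0 < Suc (hd ys) * tl ys ! 1)"
      by (intro rec_intros) auto
    show "\<exists>q. xs ! 1 = 0 \<or> xs ! 0 < Suc q * xs ! 1" for xs :: "nat list"
      using dividend_less_div_times[of "xs ! 1" "xs ! 0"] by (auto simp: add.commute intro!: exI[of _ "xs ! 0 div xs ! 1"])
  qed
  from recfun_comp2[where f = "\<lambda>x y. LEAST q. y = 0 \<or> x < Suc q * y", OF this assms]
  show ?thesis unfolding eq .
qed

lemma recfun_mod:
  assumes "recfun k a" "recfun k b"
  shows "recfun k (\<lambda>xs. a xs mod b xs)"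
  using recfun_diff[OF assms(1) recfun_mult[OF assms(2) recfun_div[OF assms]]]
  by (simp add: minus_mult_div_eq_mod)

lemma recfun_power:
  assumes "recfun k a" "recfun k b"
  shows "recfun k (\<lambda>xs. a xs ^ b xs)"
proof -
  have "recfun 2 (\<lambda>xs. rec_nat 1 (\<lambda>n v. v * xs ! 0) (xs ! 1))"
    by (intro recfun_rec_nat rec_intros) auto
  moreover have "rec_nat 1 (\<lambda>n v. v * x) y = x ^ y" for x y :: nat by (induction y) auto
  ultimately have "recfun 2 (\<lambda>xs. xs ! 0 ^ xs ! 1)" by simp
  from recfun_comp2[OF this assms] show ?thesis .
qed

lemma recfun_fact:
  assumes "recfun k a"
  shows "recfun k (\<lambda>xs. fact (a xs))"
proof -
  have "recfun k (\<lambda>xs. rec_nat 1 (\<lambda>n v. Suc n * v) (a xs))"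
    by (intro recfun_rec_nat rec_intros assms) auto
  moreover have "rec_nat 1 (\<lambda>n v. Suc n * v) x = fact x" for x :: nat by (induction x) auto
  ultimately show ?thesis by simp
qed

section \<open>Computable integer sequences and recursive functions\<close>

lemma computable_int_seq_recfun:
  assumes "recfun 1 (\<lambda>xs. f (xs ! 0))"
  shows "computable_int_seq (\<lambda>n. int (f n))"
proof -
  have "recfun 2 (\<lambda>xs. xs ! 0 * f (xs ! 1))"
    by (intro recfun_mult recfun_comp1[OF assms] recfun_nth) auto
  then obtain F where F: "total_recursive 2 F" "\<And>xs. length xs = 2 \<Longrightarrow> F xs = xs ! 0 * f (xs ! 1)"
    unfolding recfun_def by blast
  have "total_recursive_int 2 (\<lambda>xs. int (F xs))"
    unfolding total_recursive_int_def
    by (rule exI[of _ F], rule exI[of _ "\<lambda>xs. 0"]) (auto intro: F tr_zero)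
  then show ?thesis
    unfolding computable_int_seq_def computable_seq_def
    by (intro exI[of _ "\<lambda>xs. int (F xs)"]) (auto simp: F field_simps)
qed

lemma total_recursive_int_recfun:
  assumes "total_recursive_int k f"
  shows "recfun k (\<lambda>xs. nat (f xs))"
proof -
  obtain a b where ab: "total_recursive k a" "total_recursive k b" "\<And>xs. f xs = int (a xs) - int (b xs)"
    using assms unfolding total_recursive_int_def by blast
  have "recfun k (\<lambda>xs. a xs - b xs)"
    using ab by (intro recfun_diff recfun_total_recursive)
  moreover have "nat (f xs) = a xs - b xs" for xs using ab(3)[of xs] by auto
  ultimately show ?thesis by simp
qed

text \<open>Precision 1 already determines an integer, because both inequalities are strict.\<close>

lemma recfun_of_computable_int_seq:
  assumes "computable_int_seq a"
  shows "\<exists>f. recfun 1 (\<lambda>xs. f (xs ! 0)) \<and> (\<forall>n\<ge>1. f n = nat (a n))"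
proof -
  obtain f where f: "total_recursive_int 2 f"
    "\<And>m n. m \<ge> 1 \<Longrightarrow> n \<ge> 1 \<Longrightarrow> (real_of_int (f [m, n]) - 1) / real m < real_of_int (a n) \<and>
       real_of_int (a n) < (real_of_int (f [m, n]) + 1) / real m"
    using assms unfolding computable_int_seq_def computable_seq_def by blast
  have "recfun 1 (\<lambda>xs. (\<lambda>zs. nat (f zs)) (map (\<lambda>g. g xs) [\<lambda>_. 1, \<lambda>xs. xs ! 0]))"
    by (rule recfun_comp) (use total_recursive_int_recfun[OF f(1)] in \<open>auto intro: rec_intros simp: numeral_2_eq_2\<close>)
  moreover have "f [1, n] = a n" if "n \<ge> 1" for n using f(2)[of 1 n] that by simp
  ultimately show ?thesis by (intro exI[of _ "\<lambda>n. nat (f [1, n])"]) auto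
qed

text \<open>Horner's rule on differences of naturals: positive and negative parts stay apart until
  the final truncated subtraction.\<close>

lemma recfun_poly: "recfun 1 (\<lambda>xs. nat (poly p (int (xs ! 0))))"
proof -
  have "\<exists>a b. recfun 1 (\<lambda>xs. a (xs ! 0)) \<and> recfun 1 (\<lambda>xs. b (xs ! 0)) \<and>
      (\<forall>n. poly p (int n) = int (a n) - int (b n))"
  proof (induction p)
    case 0 show ?case
      by (rule exI[of _ "\<lambda>_. 0"], rule exI[of _ "\<lambda>_. 0"]) (auto intro: recfun_const)
  next
    case (pCons c p)
    then obtain a b where ab: "recfun 1 (\<lambda>xs. a (xs ! 0))" "recfun 1 (\<lambda>xs. b (xs ! 0))"
      "\<And>n. poly p (int n) = int (a n) - int (b n)" by blast
    show ?case
    proof (intro exI conjI allI)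
      show "recfun 1 (\<lambda>xs. (\<lambda>n. nat c + n * a n) (xs ! 0))"
        by (intro rec_intros ab) auto
      show "recfun 1 (\<lambda>xs. (\<lambda>n. nat (- c) + n * b n) (xs ! 0))"
        by (intro rec_intros ab) auto
      show "poly (pCons c p) (int n) = int (nat c + n * a n) - int (nat (- c) + n * b n)" for n
        by (simp add: ab(3) algebra_simps)
    qed
  qed
  then obtain a b where ab: "recfun 1 (\<lambda>xs. a (xs ! 0))" "recfun 1 (\<lambda>xs. b (xs ! 0))"
    "\<And>n. poly p (int n) = int (a n) - int (b n)" by blast
  have "recfun 1 (\<lambda>xs. a (xs ! 0) - b (xs ! 0))" by (intro recfun_diff ab)
  then show ?thesis by (rule recfun_cong) (simp add: ab(3))
qed

section \<open>Recursiveness of the digit bounds\<close>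

lemma recpred_comp5:
  assumes "recpred 5 (\<lambda>xs. P (xs ! 0) (xs ! 1) (xs ! 2) (xs ! 3) (xs ! 4))"
    "recfun k a" "recfun k b" "recfun k c" "recfun k d" "recfun k e"
  shows "recpred k (\<lambda>xs. P (a xs) (b xs) (c xs) (d xs) (e xs))"
proof -
  have "recfun k (\<lambda>xs. (\<lambda>zs. if P (zs ! 0) (zs ! 1) (zs ! 2) (zs ! 3) (zs ! 4) then 1 else 0)
      (map (\<lambda>g. g xs) [a, b, c, d, e]))"
    by (rule recfun_comp) (use assms in \<open>auto simp: recpred_def eval_nat_numeral\<close>)
  then show ?thesis by (simp add: recpred_def numeral_eq_Suc)
qed

locale recursive_controller = controller +
  assumes recfun_ft: "recfun 2 (\<lambda>xs. ft b (xs ! 0) (xs ! 1))"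
    and recfun_h: "recfun 4 (\<lambda>xs. h b (xs ! 0) (xs ! 1) (xs ! 2) (xs ! 3))"
    and recfun_g: "recfun 1 (\<lambda>xs. g (xs ! 0))"
begin

lemma recpred_quantile_test:
  "recpred 5 (\<lambda>xs. quantile_test (ft b) (h b) (xs ! 0) (xs ! 1) (xs ! 2) (xs ! 3) (xs ! 4))"
  unfolding quantile_test_def
  by (intro rec_intros recfun_fact recfun_comp2[OF recfun_ft] recfun_comp4[OF recfun_h]) auto

lemma recfun_resolution: "recfun 1 (\<lambda>xs. resolution (xs ! 0))"
  unfolding resolution_def
proof (rule recfun_Least[OF _ resolution_ex])
  show "recpred (Suc 1) (\<lambda>ys. resolves (tl ys ! 0) (hd ys))"
    unfolding resolves_def
    by (intro rec_intros recfun_fact recpred_comp5[OF recpred_quantile_test]) auto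
qed

lemma recfun_quantile: "recfun 3 (\<lambda>xs. quantile b (xs ! 0) (xs ! 1) (xs ! 2))"
  unfolding quantile_def
proof (rule recfun_Least)
  show "recpred (Suc 3) (\<lambda>ys. resolution (tl ys ! 0) \<le> hd ys \<or>
      quantile_test (ft b) (h b) (tl ys ! 0) (tl ys ! 1) (tl ys ! 2) (resolution (tl ys ! 0)) (hd ys))"
    by (intro rec_intros recfun_comp1[OF recfun_resolution] recpred_comp5[OF recpred_quantile_test]) auto
qed auto

lemma recfun_chunk_length: "recfun 1 (\<lambda>xs. chunk_length (xs ! 0))"
  unfolding chunk_length_def by (intro rec_intros recfun_fact) auto

lemma recfun_threshold: "recfun 1 (\<lambda>xs. threshold (xs ! 0))"
  unfolding threshold_def required_base_def
  by (intro rec_intros recfun_power recfun_comp1[OF recfun_g] recfun_comp1[OF recfun_resolution]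
      recfun_comp1[OF recfun_chunk_length]) auto

lemma recfun_stage: "recfun 1 (\<lambda>xs. stage (xs ! 0))"
  unfolding stage_def
proof (rule recfun_Least[OF _ stage_ex])
  show "recpred (Suc 1) (\<lambda>ys. tl ys ! 0 < threshold (Suc (hd ys)))"
    by (intro rec_intros recfun_comp1[OF recfun_threshold]) auto
qed

lemma recfun_chunk_start: "recfun 1 (\<lambda>xs. chunk_start (xs ! 0))"
  unfolding chunk_start_def
  by (intro recfun_rec_nat rec_intros recfun_comp1[OF recfun_chunk_length] recfun_comp1[OF recfun_stage]) auto

lemma recfun_origin: "recfun 1 (\<lambda>xs. origin (xs ! 0))"
proof -
  have "recfun 1 (\<lambda>xs. chunk_index (xs ! 0))"
    unfolding chunk_index_def
  proof (rule recfun_Least[OF _ chunk_index_ex])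
    show "recpred (Suc 1) (\<lambda>ys. tl ys ! 0 < chunk_start (Suc (hd ys)))"
      by (intro rec_intros recfun_comp1[OF recfun_chunk_start]) auto
  qed
  then show ?thesis
    unfolding origin_def by (rule recfun_comp1[OF recfun_chunk_start])
qed

lemma recpred_upper_phase: "recpred 1 (\<lambda>xs. upper_phase (xs ! 0))"
proof -
  have "recfun 1 (\<lambda>xs. fact_level (xs ! 0))"
    unfolding fact_level_def
  proof (rule recfun_Least[OF _ fact_gt_self_arg])
    show "recpred (Suc 1) (\<lambda>ys. tl ys ! 0 < fact (hd ys))"
      by (intro rec_intros recfun_fact) auto
  qed
  then show ?thesis
    unfolding upper_phase_def by (intro rec_intros recfun_mod)
qed

lemma recfun_den: "recfun 1 (\<lambda>xs. den (xs ! 0))"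
  unfolding den_def
  by (intro rec_intros recfun_comp1[OF recfun_resolution] recfun_comp1[OF recfun_stage]
      recfun_comp1[OF recfun_origin]) auto

lemma recfun_num: "recfun 1 (\<lambda>xs. num (xs ! 0))"
proof -
  \<comment> \<open>A Boolean cannot be passed as an argument, so the phase becomes a case
    distinction between two recursive functions.\<close>
  have num_if: "num j = (if upper_phase (origin j)
      then quantile True (stage (origin j)) (j mod fact (stage (origin j))) ((j - origin j) div fact (stage (origin j)))
      else quantile False (stage (origin j)) (j mod fact (stage (origin j))) ((j - origin j) div fact (stage (origin j))))" for j
    by (cases "upper_phase (origin j)") (simp_all add: num_def)
  show ?thesis unfolding num_if
    by (intro rec_intros recfun_div recfun_mod recfun_fact recfun_comp3[OF recfun_quantile]
        recpred_comp1[OF recpred_upper_phase] recfun_comp1[OF recfun_stage] recfun_comp1[OF recfun_origin]) auto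
qed

end

locale recursive_controlled_sequence = controlled_sequence + recursive_controller +
  assumes recfun_q: "recfun 1 (\<lambda>xs. q (xs ! 0))" and recfun_p: "recfun 1 (\<lambda>xs. p (xs ! 0))"
begin

lemma recfun_lower_digit: "recfun 1 (\<lambda>xs. lower_digit (xs ! 0))"
  unfolding lower_digit_def
  by (intro rec_intros recfun_div recfun_comp1[OF recfun_num] recfun_comp1[OF recfun_den]
      recfun_comp1[OF recfun_q] recfun_comp1[OF recfun_p]) auto

lemma recfun_upper_digit: "recfun 1 (\<lambda>xs. upper_digit (xs ! 0))"
  unfolding upper_digit_def
  by (intro rec_intros recfun_div recfun_comp1[OF recfun_num] recfun_comp1[OF recfun_den]
      recfun_comp1[OF recfun_q] recfun_comp1[OF recfun_p]) auto

lemma recfun_index: "recfun 1 (\<lambda>xs. index (xs ! 0))"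
  unfolding index_def
proof (rule recfun_Least[OF _ p_unbounded])
  show "recpred (Suc 1) (\<lambda>ys. threshold 0 \<le> hd ys \<and> tl ys ! 0 \<le> p (hd ys))"
    by (intro rec_intros recfun_comp1[OF recfun_p]) auto
qed

end

locale recursive_controlled_box = controlled_box +
  c1: recursive_controlled_sequence f1 t1 ft1 h1 g J1 q p1 +
  c2: recursive_controlled_sequence f2 t2 ft2 h2 g J2 q p2
begin

lemma recfun_lower_bound: "recfun 1 (\<lambda>xs. lower_bound (xs ! 0))"
  unfolding lower_bound_def
  by (intro rec_intros recfun_comp1[OF c1.recfun_p] recfun_comp1[OF c2.recfun_p] recfun_comp1[OF c1.recfun_q]
      recfun_comp1[OF c1.recfun_index] recfun_comp1[OF c2.recfun_index]
      recfun_comp1[OF c1.recfun_lower_digit] recfun_comp1[OF c2.recfun_lower_digit]) auto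

lemma recfun_upper_bound: "recfun 1 (\<lambda>xs. upper_bound (xs ! 0))"
  unfolding upper_bound_def
  by (intro rec_intros recfun_comp1[OF c1.recfun_p] recfun_comp1[OF c2.recfun_p] recfun_comp1[OF c1.recfun_q]
      recfun_comp1[OF c1.recfun_index] recfun_comp1[OF c2.recfun_index]
      recfun_comp1[OF c1.recfun_upper_digit] recfun_comp1[OF c2.recfun_upper_digit]) auto

end

section \<open>Assembling the digit box\<close>

text \<open>Effective data are used if there are any. Otherwise countability of the discontinuities
  of monotone functions gives an enumeration, and floors serve as approximations. Thus one
  construction yields both halves of the theorem.\<close>

lemma evaluable_family_exists:
  assumes lin: "linear_family f"
  shows "\<exists>t ft h. evaluable_family f t ft h \<and>
    (uniformly_evaluable f \<longrightarrow> recfun 2 (\<lambda>xs. ft (xs ! 0) (xs ! 1)) \<and>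
       recfun 4 (\<lambda>xs. h (xs ! 0) (xs ! 1) (xs ! 2) (xs ! 3)))"
proof -
  have f01: "0 \<le> f m r x" if "m \<ge> 1" "r < m" "x \<in> {0..1}" for m r x
    using lin that unfolding linear_family_def is_adf_def by (meson atLeastAtMost_iff image_subset_iff)
  define C where "C k z y \<longleftrightarrow> (real_of_int z - 1) / real k < y \<and> y < (real_of_int z + 1) / real k" for k z y
  define good where "good t F h \<longleftrightarrow> t ` {1..} \<subseteq> {0..1} \<and> \<rat> \<inter> {0..1} \<subseteq> t ` {1..} \<and>
      (\<forall>m\<ge>1. \<forall>r<m. discontinuities (f m r) \<subseteq> t ` {1..}) \<and> (\<forall>k\<ge>1. \<forall>n\<ge>1. C k (F [k, n]) (t n)) \<and>
      (\<forall>k\<ge>1. \<forall>m\<ge>1. \<forall>r<m. \<forall>n\<ge>1. C k (h [k, m, r, n]) (f m r (t n)))" for t F h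
  have "\<exists>t F h. good t F h \<and>
      (uniformly_evaluable f \<longrightarrow> total_recursive_int 2 F \<and> total_recursive_int 4 h)"
  proof (cases "uniformly_evaluable f")
    case True
    then obtain t h where t: "computable_seq t" "t ` {1..} \<subseteq> {0..1}" "\<rat> \<inter> {0..1} \<subseteq> t ` {1..}"
        "\<forall>m\<ge>1. \<forall>r<m. discontinuities (f m r) \<subseteq> t ` {1..}"
      and h: "total_recursive_int 4 h" "\<forall>k\<ge>1. \<forall>m\<ge>1. \<forall>r<m. \<forall>n\<ge>1. C k (h [k, m, r, n]) (f m r (t n))"
      unfolding uniformly_evaluable_def by (elim exE conjE) (rule that, (unfold C_def)?, assumption+)
    obtain F where F: "total_recursive_int 2 F" "\<forall>k\<ge>1. \<forall>n\<ge>1. C k (F [k, n]) (t n)"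
      using t(1) unfolding computable_seq_def by (elim exE conjE) (rule that, (unfold C_def)?, assumption+)
    have "good t F h" unfolding good_def using t(2-4) F(2) h(2) by (intro conjI)
    then show ?thesis using F(1) h(1) by blast
  next
    case False
    define S where "S = (\<rat> \<inter> {0..1}) \<union> (\<Union>m. \<Union>r\<in>{..<m}. discontinuities (f m r))"
    have "countable (discontinuities (f m r))" if "r < m" for m r
    proof -
      have "mono_on {0..1} (f m r)" using lin that unfolding linear_family_def is_adf_def by auto
      then show ?thesis unfolding discontinuities_def by (rule mono_on_ctble_discont)
    qed
    then have cS: "countable S" unfolding S_def by (auto intro: countable_rat)
    have "0 \<in> S" by (simp add: S_def)
    have S01: "S \<subseteq> {0..1}" by (auto simp: S_def discontinuities_def)
    define t where "t n = from_nat_into S (n - 1)" for n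
    have rangeS: "t ` {1..} = S"
    proof
      show "t ` {1..} \<subseteq> S" using from_nat_into[of S] \<open>0 \<in> S\<close> by (auto simp: t_def)
      show "S \<subseteq> t ` {1..}"
      proof
        fix x assume "x \<in> S"
        then have "x = t (Suc (to_nat_on S x))" using cS by (simp add: t_def)
        then show "x \<in> t ` {1..}" by (rule image_eqI) simp
      qed
    qed
    have floor: "C k \<lfloor>real k * y\<rfloor> y" if "k \<ge> 1" for k y
    proof -
      have "real_of_int \<lfloor>real k * y\<rfloor> - 1 < y * real k" "y * real k < real_of_int \<lfloor>real k * y\<rfloor> + 1"
        unfolding mult.commute[of y] by linarith+
      then show ?thesis using that by (simp add: C_def pos_divide_less_eq pos_less_divide_eq)
    qed
    have "good t (\<lambda>xs. \<lfloor>real (xs ! 0) * t (xs ! 1)\<rfloor>)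
        (\<lambda>xs. \<lfloor>real (xs ! 0) * f (xs ! 1) (xs ! 2) (t (xs ! 3))\<rfloor>)"
      unfolding good_def rangeS
    proof (intro conjI allI impI)
      show "\<rat> \<inter> {0..1} \<subseteq> S" by (simp add: S_def)
      show "discontinuities (f m r) \<subseteq> S" if "r < m" for m r using that by (auto simp: S_def)
    qed (use S01 in \<open>simp_all add: floor\<close>)
    then show ?thesis using False by (intro exI conjI impI) simp_all
  qed
  then obtain t F h where "good t F h" and
    "uniformly_evaluable f \<longrightarrow> total_recursive_int 2 F \<and> total_recursive_int 4 h"
    by (elim exE conjE) (rule that)
  then have rec: "uniformly_evaluable f \<Longrightarrow> total_recursive_int 2 F" "uniformly_evaluable f \<Longrightarrow> total_recursive_int 4 h"
    by simp_all
  have t: "t ` {1..} \<subseteq> {0..1}" "\<rat> \<inter> {0..1} \<subseteq> t ` {1..}"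
      "\<forall>m\<ge>1. \<forall>r<m. discontinuities (f m r) \<subseteq> t ` {1..}"
    and F: "\<forall>k\<ge>1. \<forall>n\<ge>1. C k (F [k, n]) (t n)"
    and h: "\<forall>k\<ge>1. \<forall>m\<ge>1. \<forall>r<m. \<forall>n\<ge>1. C k (h [k, m, r, n]) (f m r (t n))"
    using \<open>good t F h\<close> unfolding good_def by - (elim conjE, assumption)+
  have t01: "t n \<in> {0..1}" if "n \<ge> 1" for n using t(1) that by auto
  \<comment> \<open>Since z + 1 > k y >= 0, the integer z is nonnegative and truncation to naturals
    does not change it.\<close>
  have approx: "real (nat z) - 1 < real k * y \<and> real k * y < real (nat z) + 1"
    if "k \<ge> 1" "0 \<le> y" "C k z y" for z k y
  proof -
    have b: "real_of_int z - 1 < real k * y" "real k * y < real_of_int z + 1"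
      using that by (auto simp: C_def field_simps)
    have "0 \<le> real k * y" using that by simp
    then have "z \<ge> 0" using b(2) by linarith
    then show ?thesis using b by simp
  qed
  define ft where "ft k n = nat (F [k, n])" for k n
  define h' where "h' k m r n = nat (h [k, m, r, n])" for k m r n
  have "evaluable_family f t ft h'"
  proof
    show "real (ft k n) - 1 < real k * t n \<and> real k * t n < real (ft k n) + 1"
      if "k \<ge> 1" "n \<ge> 1" for k n
      unfolding ft_def using F[rule_format, OF that] t01[OF that(2)] that by (intro approx) auto
    show "real (h' k m r n) - 1 < real k * f m r (t n) \<and> real k * f m r (t n) < real (h' k m r n) + 1"
      if "k \<ge> 1" "m \<ge> 1" "r < m" "n \<ge> 1" for k m r n
      unfolding h'_def using h[rule_format, OF that] f01[OF that(2,3) t01[OF that(4)]] that by (intro approx) auto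
  qed (use lin t t01 in auto)
  moreover have "recfun 2 (\<lambda>xs. ft (xs ! 0) (xs ! 1))" if "uniformly_evaluable f"
    by (rule recfun_cong[OF total_recursive_int_recfun[OF rec(1)[OF that]]])
      (auto simp: ft_def numeral_2_eq_2 length_Suc_conv)
  moreover have "recfun 4 (\<lambda>xs. h' (xs ! 0) (xs ! 1) (xs ! 2) (xs ! 3))" if "uniformly_evaluable f"
    by (rule recfun_cong[OF total_recursive_int_recfun[OF rec(2)[OF that]]])
      (auto simp: h'_def eval_nat_numeral length_Suc_conv)
  ultimately show ?thesis by blast
qed

lemma growth_modulus_exists:
  assumes lim: "infinite_in_limit Q" and q: "\<And>n. n \<ge> 1 \<Longrightarrow> Q n = int (q n)"
  shows "\<exists>g. (\<forall>n\<ge>1. \<forall>i\<ge>1. i \<ge> g n \<longrightarrow> n \<le> q i) \<and> (computably_growing Q \<longrightarrow> recfun 1 (\<lambda>xs. g (xs ! 0)))"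
proof -
  define I where "I n = Inf {i. i \<ge> 1 \<and> (\<forall>j\<ge>i. Q j \<ge> int n)}" for n
  have I: "n \<le> q i" if "i \<ge> 1" "i \<ge> I n" for n i
  proof -
    have "\<forall>\<^sub>F i in sequentially. int n \<le> Q i"
      using lim unfolding infinite_in_limit_def filterlim_at_top by blast
    then obtain k where "\<And>j. j \<ge> k \<Longrightarrow> int n \<le> Q j" unfolding eventually_sequentially by blast
    then have "max k 1 \<in> {i. i \<ge> 1 \<and> (\<forall>j\<ge>i. Q j \<ge> int n)}" by auto
    then have "I n \<in> {i. i \<ge> 1 \<and> (\<forall>j\<ge>i. Q j \<ge> int n)}" unfolding I_def by (intro Inf_nat_def1) blast
    then have "int n \<le> Q i" using that by blast
    then show ?thesis using q[OF that(1)] by simp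
  qed
  show ?thesis
  proof (cases "computably_growing Q")
    case True
    then have "computable_int_seq (\<lambda>n. int (I n))"
      unfolding computably_growing_def computable_int_seq_def I_def by simp
    then obtain g where "recfun 1 (\<lambda>xs. g (xs ! 0))" "\<forall>n\<ge>1. g n = nat (int (I n))"
      using recfun_of_computable_int_seq by blast
    then show ?thesis using I by (intro exI[of _ g]) auto
  next
    case False
    then show ?thesis using I by (intro exI[of _ I]) auto
  qed
qed

lemma poly_index_step:
  fixes p :: "int poly"
  assumes "degree p > 0" "lead_coeff p > 0"
  shows "\<exists>J. \<forall>j\<ge>J. nat (poly p (int j)) < nat (poly p (int (Suc j)))"
proof -
  have "\<forall>\<^sub>F j in sequentially. nat (poly p (int j)) < nat (poly p (int (Suc j)))"
    using int_poly_eventually_diff_ge(1)[OF assms] int_poly_eventually_ge[OF assms, of 0]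
    by eventually_elim auto
  then show ?thesis by (simp only: eventually_sequentially)
qed

lemma evaluable_families_exist:
  assumes lin: "\<And>b::bool. linear_family (F b)"
  shows "\<exists>t ft h. \<forall>b. evaluable_family (F b) (t b) (ft b) (h b) \<and>
    (uniformly_evaluable (F b) \<longrightarrow> recfun 2 (\<lambda>xs. ft b (xs ! 0) (xs ! 1)) \<and>
       recfun 4 (\<lambda>xs. h b (xs ! 0) (xs ! 1) (xs ! 2) (xs ! 3)))"
proof -
  define R where "R b d \<longleftrightarrow> (case d of (t, ft, h) \<Rightarrow> evaluable_family (F b) t ft h \<and>
    (uniformly_evaluable (F b) \<longrightarrow> recfun 2 (\<lambda>xs. ft (xs ! 0) (xs ! 1)) \<and>
       recfun 4 (\<lambda>xs. h (xs ! 0) (xs ! 1) (xs ! 2) (xs ! 3))))" for b d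
  have "\<forall>b. \<exists>d. R b d"
  proof
    fix b
    obtain t ft h where "evaluable_family (F b) t ft h \<and>
    (uniformly_evaluable (F b) \<longrightarrow> recfun 2 (\<lambda>xs. ft (xs ! 0) (xs ! 1)) \<and>
       recfun 4 (\<lambda>xs. h (xs ! 0) (xs ! 1) (xs ! 2) (xs ! 3)))"
      using evaluable_family_exists[OF lin[of b]] by (elim exE) (rule that)
    then have "R b (t, ft, h)" unfolding R_def by simp
    then show "\<exists>d. R b d" ..
  qed
  then obtain D where D: "\<forall>b. R b (D b)" by (rule choice[THEN exE])
  show ?thesis
  proof (intro exI allI)
    fix b
    show "evaluable_family (F b) (fst (D b)) (fst (snd (D b))) (snd (snd (D b))) \<and>
      (uniformly_evaluable (F b) \<longrightarrow> recfun 2 (\<lambda>xs. fst (snd (D b)) (xs ! 0) (xs ! 1)) \<and>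
       recfun 4 (\<lambda>xs. snd (snd (D b)) (xs ! 0) (xs ! 1) (xs ! 2) (xs ! 3)))"
      using D[rule_format, of b] unfolding R_def by (simp add: case_prod_beta)
  qed
qed

text \<open>The computability clause speaks of the same \<alpha> and \<beta>: they are constructed
  in any case and are recursive once the chosen data are.\<close>

lemma digit_box_exists:
  fixes p l :: "int poly"
  assumes Q: "basic_sequence Q" "infinite_in_limit Q"
    and p: "degree p \<ge> 2" "lead_coeff p > 0" and l: "degree l = 1" "lead_coeff l > 0"
    and fam: "\<And>b. linear_family (F b)" "\<And>b. linear_family (G b)"
    and le: "\<And>m r x. m \<ge> 1 \<Longrightarrow> r < m \<Longrightarrow> x \<in> {0..1} \<Longrightarrow> F False m r x \<le> F True m r x"
      "\<And>m r x. m \<ge> 1 \<Longrightarrow> r < m \<Longrightarrow> x \<in> {0..1} \<Longrightarrow> G False m r x \<le> G True m r x"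
  shows "\<exists>\<alpha> \<beta>. hausdorff_dim (digit_box Q \<alpha> \<beta>) = 1 \<and>
    (\<forall>x\<in>digit_box Q \<alpha> \<beta>.
      has_adfs (\<lambda>j. cantor_T Q (nat (poly p (int j))) x) (F True) (F False) \<and>
      has_adfs (\<lambda>j. cantor_T Q (nat (poly l (int j))) x) (G True) (G False)) \<and>
    (computable_int_seq Q \<and> computably_growing Q \<and>
      (\<forall>b. uniformly_evaluable (F b) \<and> uniformly_evaluable (G b)) \<longrightarrow>
      computable_int_seq \<alpha> \<and> computable_int_seq \<beta>)"
    (is "\<exists>\<alpha> \<beta>. _ \<and> _ \<and> (?comp \<longrightarrow> _)")
proof -
  have Qnat: "Q n = int (nat (Q n))" if "n \<ge> 1" for n
  proof -
    have "Q n \<ge> 2" using Q(1) that by (simp add: basic_sequence_def)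
    then show ?thesis by simp
  qed
  have "\<exists>q. (\<forall>n\<ge>1. Q n = int (q n)) \<and> (computable_int_seq Q \<longrightarrow> recfun 1 (\<lambda>xs. q (xs ! 0)))"
  proof (cases "computable_int_seq Q")
    case True
    then obtain q where "recfun 1 (\<lambda>xs. q (xs ! 0))" "\<forall>n\<ge>1. q n = nat (Q n)"
      using recfun_of_computable_int_seq by blast
    then show ?thesis using Qnat by (intro exI[of _ q]) simp
  next
    case False
    then show ?thesis using Qnat by (intro exI[of _ "\<lambda>n. nat (Q n)"]) simp
  qed
  then obtain q where Q_q: "\<And>n. n \<ge> 1 \<Longrightarrow> Q n = int (q n)" "computable_int_seq Q \<Longrightarrow> recfun 1 (\<lambda>xs. q (xs ! 0))"
    by blast
  obtain g where g: "\<And>n i. n \<ge> 1 \<Longrightarrow> i \<ge> 1 \<Longrightarrow> i \<ge> g n \<Longrightarrow> n \<le> q i"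
    "computably_growing Q \<Longrightarrow> recfun 1 (\<lambda>xs. g (xs ! 0))"
    using growth_modulus_exists[OF Q(2) Q_q(1)] by blast
  have "degree p > 0" "degree l > 0" using p l by auto
  obtain J1 where J1: "\<And>j. j \<ge> J1 \<Longrightarrow> nat (poly p (int j)) < nat (poly p (int (Suc j)))"
    using poly_index_step[OF \<open>degree p > 0\<close> p(2)] by blast
  obtain J2 where J2: "\<And>j. j \<ge> J2 \<Longrightarrow> nat (poly l (int j)) < nat (poly l (int (Suc j)))"
    using poly_index_step[OF \<open>degree l > 0\<close> l(2)] by blast
  obtain t1 ft1 h1 where e1: "\<forall>b. evaluable_family (F b) (t1 b) (ft1 b) (h1 b) \<and>
    (uniformly_evaluable (F b) \<longrightarrow> recfun 2 (\<lambda>xs. ft1 b (xs ! 0) (xs ! 1)) \<and>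
       recfun 4 (\<lambda>xs. h1 b (xs ! 0) (xs ! 1) (xs ! 2) (xs ! 3)))"
    using evaluable_families_exist[of F, OF fam(1)] by (elim exE) (rule that)
  obtain t2 ft2 h2 where e2: "\<forall>b. evaluable_family (G b) (t2 b) (ft2 b) (h2 b) \<and>
    (uniformly_evaluable (G b) \<longrightarrow> recfun 2 (\<lambda>xs. ft2 b (xs ! 0) (xs ! 1)) \<and>
       recfun 4 (\<lambda>xs. h2 b (xs ! 0) (xs ! 1) (xs ! 2) (xs ! 3)))"
    using evaluable_families_exist[of G, OF fam(2)] by (elim exE) (rule that)
  define p1 where "p1 j = nat (poly p (int j))" for j
  define p2 where "p2 j = nat (poly l (int j))" for j
  interpret controlled_box F t1 ft1 h1 J1 p1 G t2 ft2 h2 J2 p2 g q Q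
  proof (intro controlled_box.intro controlled_sequence.intro controller.intro
      controlled_sequence_axioms.intro controlled_box_axioms.intro)
    show "evaluable_family (F b) (t1 b) (ft1 b) (h1 b)" "evaluable_family (G b) (t2 b) (ft2 b) (h2 b)" for b
      using e1 e2 by blast+
    show "p1 j < p1 (Suc j)" if "J1 \<le> j" for j unfolding p1_def by (rule J1[OF that])
    show "p2 j < p2 (Suc j)" if "J2 \<le> j" for j unfolding p2_def by (rule J2[OF that])
    show "n \<le> q i" if "1 \<le> n" "1 \<le> i" "g n \<le> i" for n i by (rule g(1)[OF that])
    show "basic_sequence Q" by (rule Q(1))
    show "Q n = int (q n)" if "1 \<le> n" for n by (rule Q_q(1)[OF that])
    show "density_zero {j. \<exists>i. p2 j = p1 i}"
      unfolding p1_def p2_def by (rule density_zero_poly_collisions[OF p l])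
  qed (rule g(1))
  show ?thesis
  proof (intro exI conjI)
    show "hausdorff_dim (digit_box Q (\<lambda>n. int (lower_bound n)) (\<lambda>n. int (upper_bound n))) = 1"
      using hausdorff_dim_box by (simp only: box_def)
    show "\<forall>x\<in>digit_box Q (\<lambda>n. int (lower_bound n)) (\<lambda>n. int (upper_bound n)).
      has_adfs (\<lambda>j. cantor_T Q (nat (poly p (int j))) x) (F True) (F False) \<and>
      has_adfs (\<lambda>j. cantor_T Q (nat (poly l (int j))) x) (G True) (G False)"
      unfolding box_def[symmetric] p1_def[symmetric] p2_def[symmetric]
      by (intro ballI conjI box_adfs le)
    show "?comp \<longrightarrow> computable_int_seq (\<lambda>n. int (lower_bound n)) \<and> computable_int_seq (\<lambda>n. int (upper_bound n))"
    proof
      assume comp: ?comp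
      interpret recursive_controlled_box F t1 ft1 h1 J1 p1 G t2 ft2 h2 J2 p2 g q Q
      proof unfold_locales
        show "recfun 2 (\<lambda>xs. ft1 b (xs ! 0) (xs ! 1))" "recfun 2 (\<lambda>xs. ft2 b (xs ! 0) (xs ! 1))"
          "recfun 4 (\<lambda>xs. h1 b (xs ! 0) (xs ! 1) (xs ! 2) (xs ! 3))"
          "recfun 4 (\<lambda>xs. h2 b (xs ! 0) (xs ! 1) (xs ! 2) (xs ! 3))" for b
          using e1[rule_format, of b] e2[rule_format, of b] comp by blast+
        show "recfun 1 (\<lambda>xs. g (xs ! 0))" "recfun 1 (\<lambda>xs. q (xs ! 0))" using comp g(2) Q_q(2) by blast+
        show "recfun 1 (\<lambda>xs. p1 (xs ! 0))" "recfun 1 (\<lambda>xs. p2 (xs ! 0))"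
          unfolding p1_def p2_def by (rule recfun_poly)+
      qed
      show "computable_int_seq (\<lambda>n. int (lower_bound n)) \<and> computable_int_seq (\<lambda>n. int (upper_bound n))"
        using computable_int_seq_recfun[OF recfun_lower_bound] computable_int_seq_recfun[OF recfun_upper_bound]
        by blast
    qed
  qed
qed

lemma hausdorff_dim_unit_interval: "hausdorff_dim {0..<1::real} = 1"
proof (rule antisym)
  show "hausdorff_dim {0..<1::real} \<le> 1" by (rule hausdorff_dim_le_1) simp
  show "1 \<le> hausdorff_dim {0..<1::real}"
  proof (rule hausdorff_dim_ge_1[where X = "\<lambda>z. z"])
    fix s :: real assume s: "0 < s" "s < 1"
    have "\<bar>z - z'\<bar> \<le> 1 * \<bar>z - z'\<bar> powr s" if "z \<in> {0..<1}" "z' \<in> {0..<1}" for z z' :: real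
    proof -
      have "\<bar>z - z'\<bar> powr 1 \<le> \<bar>z - z'\<bar> powr s" using that s by (intro powr_mono') auto
      then show ?thesis by simp
    qed
    then show "\<exists>C>0. \<forall>z\<in>{0..<1}. \<forall>z'\<in>{0..<1}. \<bar>z - z'\<bar> \<le> C * \<bar>z - z'\<bar> powr s"
      using zero_less_one by blast
  qed
qed

theorem mainTheorem1:
  fixes Q :: "nat \<Rightarrow> int"
    and P :: "int poly set"
    and fu fl :: "int poly \<Rightarrow> nat \<Rightarrow> nat \<Rightarrow> real \<Rightarrow> real"
  assumes "basic_sequence Q"
    and "infinite_in_limit Q"
    and "sparsely_intersecting P"
    and "\<forall>p\<in>P. degree p > 0 \<and> lead_coeff p > 0"
    and "\<forall>p\<in>P. linear_family (fu p) \<and> linear_family (fl p)"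
    and "\<forall>p\<in>P. \<forall>m\<ge>1. \<forall>r<m. \<forall>x\<in>{0..1}. fl p m r x \<le> fu p m r x"
  shows "hausdorff_dim (Phi_set Q P fu fl) = 1 \<and>
    (computable_int_seq Q \<and> computably_growing Q \<and>
     explicit_sparsely_intersecting P \<and>
     (\<forall>p\<in>P. explicit_linear_family (fu p) \<and> explicit_linear_family (fl p)) \<and>
     (\<forall>p\<in>P. uniformly_evaluable (fu p) \<and> uniformly_evaluable (fl p))
     \<longrightarrow>
     (\<exists>\<Phi>' \<alpha> \<beta>.
        \<Phi>' \<subseteq> Phi_set Q P fu fl \<and>
        computable_int_seq \<alpha> \<and> computable_int_seq \<beta> \<and>
        hausdorff_dim \<Phi>' = 1 \<and>
        \<Phi>' = {x \<in> {0..<1}. \<forall>n\<ge>1. \<alpha> n \<le> cantor_digit Q x n \<and> cantor_digit Q x n \<le> \<beta> n}))"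
proof -
  have Phi: "Phi_set Q P fu fl = {x \<in> {0..<1}. \<forall>p\<in>P.
      has_adfs (\<lambda>j. cantor_T Q (nat (poly p (int j))) x) (fu p) (fl p)}"
    by (simp only: Phi_set_def has_adfs_def)
  have "\<exists>\<alpha> \<beta>. hausdorff_dim (digit_box Q \<alpha> \<beta>) = 1 \<and> digit_box Q \<alpha> \<beta> \<subseteq> Phi_set Q P fu fl \<and>
    (computable_int_seq Q \<and> computably_growing Q \<and>
      (\<forall>p\<in>P. uniformly_evaluable (fu p) \<and> uniformly_evaluable (fl p)) \<longrightarrow>
      computable_int_seq \<alpha> \<and> computable_int_seq \<beta>)"
  proof (cases "P = {}")
    case True
    \<comment> \<open>Without polynomials the box may be all of [0, 1). As upper bound Q itself is
      taken, whose computability is a hypothesis.\<close>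
    have "0 \<le> cantor_digit Q x n \<and> cantor_digit Q x n \<le> Q n" if "n \<ge> 1" for x n
      using cantor_base.expansion_cantor_digit[OF cantor_base.intro, OF assms(1), of x] that
      unfolding is_cantor_expansion_def by force
    then have eq: "digit_box Q (\<lambda>_. int 0) Q = {0..<1}" by (auto simp: digit_box_def)
    have zero: "computable_int_seq (\<lambda>_. int 0)"
      using computable_int_seq_recfun[OF recfun_const[of 1 0]] by simp
    have sub: "{0..<1} \<subseteq> Phi_set Q P fu fl" unfolding Phi using True by auto
    show ?thesis
      by (rule exI[of _ "\<lambda>_. int 0"], rule exI[of _ Q])
        (simp only: eq sub zero hausdorff_dim_unit_interval simp_thms, blast)
  next
    case False
    then obtain p0 where p0: "p0 \<in> P" by blast
    obtain p l where pl: "degree p \<ge> 2" "lead_coeff p > 0" "degree l = 1" "lead_coeff l > 0" "P \<subseteq> {p, l}"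
      using sparsely_intersecting_subset_pair[OF assms(3,4)] by blast
    \<comment> \<open>A stand-in monomial outside P borrows the families of p0;
      \<open>Phi_set\<close> imposes no condition on it.\<close>
    define p' where "p' = (if p \<in> P then p else p0)"
    define l' where "l' = (if l \<in> P then l else p0)"
    have P': "p' \<in> P" "l' \<in> P" using p0 by (auto simp: p'_def l'_def)
    define F where "F b = (if b then fu p' else fl p')" for b
    define G where "G b = (if b then fu l' else fl l')" for b
    have lin: "linear_family (F b)" "linear_family (G b)" for b
      using assms(5) P' by (auto simp: F_def G_def)
    have le: "F False m r x \<le> F True m r x" "G False m r x \<le> G True m r x"
      if "m \<ge> 1" "r < m" "x \<in> {0..1}" for m r x
      using assms(6)[rule_format, OF P'(1) that] assms(6)[rule_format, OF P'(2) that]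
      by (simp_all add: F_def G_def)
    obtain \<alpha> \<beta> where box: "hausdorff_dim (digit_box Q \<alpha> \<beta>) = 1"
      "\<And>x. x \<in> digit_box Q \<alpha> \<beta> \<Longrightarrow> has_adfs (\<lambda>j. cantor_T Q (nat (poly p (int j))) x) (F True) (F False)"
      "\<And>x. x \<in> digit_box Q \<alpha> \<beta> \<Longrightarrow> has_adfs (\<lambda>j. cantor_T Q (nat (poly l (int j))) x) (G True) (G False)"
      "computable_int_seq Q \<and> computably_growing Q \<and>
        (\<forall>b. uniformly_evaluable (F b) \<and> uniformly_evaluable (G b)) \<longrightarrow>
        computable_int_seq \<alpha> \<and> computable_int_seq \<beta>"
      using digit_box_exists[of Q p l F G, OF assms(1,2) pl(1-4) lin le] by blast
    have "digit_box Q \<alpha> \<beta> \<subseteq> Phi_set Q P fu fl"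
    proof
      fix x assume x: "x \<in> digit_box Q \<alpha> \<beta>"
      have "has_adfs (\<lambda>j. cantor_T Q (nat (poly r (int j))) x) (fu r) (fl r)" if r: "r \<in> P" for r
      proof -
        have "r = p \<or> r = l" using pl(5) r by blast
        then show ?thesis
        proof
          assume "r = p"
          then show ?thesis using box(2)[OF x] r by (simp add: F_def p'_def)
        next
          assume "r = l"
          then show ?thesis using box(3)[OF x] r by (simp add: G_def l'_def)
        qed
      qed
      then show "x \<in> Phi_set Q P fu fl" using x by (simp add: Phi digit_box_def)
    qed
    moreover have "(\<forall>p\<in>P. uniformly_evaluable (fu p) \<and> uniformly_evaluable (fl p)) \<Longrightarrow>
        \<forall>b. uniformly_evaluable (F b) \<and> uniformly_evaluable (G b)"
      using P' by (simp add: F_def G_def)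
    ultimately show ?thesis using box(1,4) by blast
  qed
  then obtain \<alpha> \<beta> where box: "hausdorff_dim (digit_box Q \<alpha> \<beta>) = 1" "digit_box Q \<alpha> \<beta> \<subseteq> Phi_set Q P fu fl"
    "computable_int_seq Q \<and> computably_growing Q \<and>
      (\<forall>p\<in>P. uniformly_evaluable (fu p) \<and> uniformly_evaluable (fl p)) \<longrightarrow>
      computable_int_seq \<alpha> \<and> computable_int_seq \<beta>" by blast
  have "hausdorff_dim (Phi_set Q P fu fl) = 1"
  proof (rule antisym)
    show "hausdorff_dim (Phi_set Q P fu fl) \<le> 1"
      by (rule hausdorff_dim_le_1) (auto simp: Phi_set_def)
    show "1 \<le> hausdorff_dim (Phi_set Q P fu fl)" using hausdorff_dim_mono[OF box(2)] box(1) by simp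
  qed
  then show ?thesis using box digit_box_def by blast
qed

end
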